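(* Work in the heavy-tailed setting described in the context. Suppose there is a positive integer $\tilde k\le k$ such that $d_1\ge\cdots\ge d_{\tilde k}>\sqrt{(p/n)^{1/2}+\delta}$ for a small but fixed $\delta>0$. Then for every $i=1,\dots,\tilde k$, $$|\lambda_i-d_i|=o(1)\quad\text{in probability, as } n\to\infty .$$
   Context: Setting. $p=p(n)$ and $p/n\to c\in(0,\infty)$ as $n\to\infty$. $X=(x_{ij})\in\mathbb R^{p\times n}$ has iid real entries with $\mathbb E x_{ij}=0$, $\mathbb E x_{ij}^2=1/n$ (no further moment assumption). $X_1,X_2$ are two independent copies of $X$. Signal: $S=\sum_{i=1}^k d_iu_iv_i^*\in\mathbb R^{p\times n}$, with $k\ge0$ fixed, $C>d_1\ge\cdots\ge d_k\ge0$ for a constant $C>0$, and $\{u_i\}\subset\mathbb R^p$, $\{v_i\}\subset\mathbb R^n$ deterministic orthonormal families. Model: $H_a=S+X_a$ ($a=1,2$) and $\mathcal Y=\begin{pmatrix}0&H_1\\H_2^*&0\end{pmatrix}\in\mathbb R^{(p+n)\times(p+n)}$. Its non-zero eigenvalues come in pairs $\pm\lambda_i$, $i=1,\dots,n\wedge p$, where $\lambda_1,\dots,\lambda_{n\wedge p}$ are those with argument in $(-\pi/2,\pi/2]$, listed in descending order of modulus (a non-real one with argument in $(0,\pi/2)$ is followed by its complex conjugate).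
   Formalization: The law of the rescaled entries √n·x_ij is taken to be the same for every n; if it may vary freely with n under only mean 0 and variance 1/n, the claim fails (e.g. p=n, x_ij=±3 with total probability 1/(9n), d_1=2). *)

theory Defs
  imports "HOL-Probability.Probability" "Jordan_Normal_Form.Char_Poly"
    "HOL-Computational_Algebra.Fundamental_Theorem_Algebra"
begin

text \<open>
  Matrices and vectors are those of Jordan_Normal_Form, with entries indexed from 0. The families
  \<open>d\<close>, \<open>u\<close>, \<open>v\<close> and the eigenvalues \<open>lam\<close> are indexed from 1.
\<close>

text \<open>
  \<open>X 1\<close> and \<open>X 2\<close> are independent random \<open>p \<times> n\<close> matrices with iid entries of mean 0 and
  variance \<open>1/n\<close>. The parameter \<open>\<mu>\<close> is the law of the entries rescaled by \<open>sqrt n\<close>; using the same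
  \<open>\<mu>\<close> for every \<open>n\<close> expresses that the matrices are built from one fixed entry distribution.
\<close>

definition iid_matrix_pair ::
    "'w measure \<Rightarrow> nat \<Rightarrow> nat \<Rightarrow> real measure \<Rightarrow> (nat \<Rightarrow> 'w \<Rightarrow> real mat) \<Rightarrow> bool" where
  "iid_matrix_pair M p n \<mu> X \<longleftrightarrow>
     prob_space M \<and>
     (\<forall>a\<in>{1,2}. \<forall>\<omega>\<in>space M. X a \<omega> \<in> carrier_mat p n) \<and>
     prob_space.indep_vars M (\<lambda>_. borel) (\<lambda>(a, i, j) \<omega>. X a \<omega> $$ (i, j))
       ({1,2} \<times> {..<p} \<times> {..<n}) \<and>
     (\<forall>a\<in>{1,2}. \<forall>i<p. \<forall>j<n.
        distr M borel (\<lambda>\<omega>. sqrt (real n) * X a \<omega> $$ (i, j)) = \<mu> \<and>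
        integrable M (\<lambda>\<omega>. X a \<omega> $$ (i, j)) \<and>
        integrable M (\<lambda>\<omega>. (X a \<omega> $$ (i, j))\<^sup>2) \<and>
        prob_space.expectation M (\<lambda>\<omega>. X a \<omega> $$ (i, j)) = 0 \<and>
        prob_space.expectation M (\<lambda>\<omega>. (X a \<omega> $$ (i, j))\<^sup>2) = 1 / real n)"

definition orthonormal_family :: "nat \<Rightarrow> nat \<Rightarrow> (nat \<Rightarrow> real Matrix.vec) \<Rightarrow> bool" where
  "orthonormal_family m k w \<longleftrightarrow>
     (\<forall>i\<in>{1..k}. w i \<in> carrier_vec m) \<and>
     (\<forall>i\<in>{1..k}. \<forall>j\<in>{1..k}. scalar_prod (w i) (w j) = (if i = j then 1 else 0))"

definition signal_matrix ::
    "nat \<Rightarrow> nat \<Rightarrow> nat \<Rightarrow> (nat \<Rightarrow> real) \<Rightarrow> (nat \<Rightarrow> real Matrix.vec) \<Rightarrow> (nat \<Rightarrow> real Matrix.vec) \<Rightarrow> real mat"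
  where
  "signal_matrix p n k d u v =
     Matrix.mat p n (\<lambda>(a, b). \<Sum>i=1..k. d i * vec_index (u i) a * vec_index (v i) b)"

definition asymmetric_dilation :: "nat \<Rightarrow> nat \<Rightarrow> real mat \<Rightarrow> real mat \<Rightarrow> real mat" where
  "asymmetric_dilation p n H1 H2 = four_block_mat (0\<^sub>m p p) H1 (transpose_mat H2) (0\<^sub>m n n)"

definition eigenvalue_mset :: "real mat \<Rightarrow> complex multiset" where
  "eigenvalue_mset A = proots (char_poly (map_mat complex_of_real A))"

text \<open>
  \<open>lam 1, \<dots>, lam (min n p)\<close> is an admissible listing of the eigenvalues (with algebraic multiplicity)
  of the \<open>(p+n) \<times> (p+n)\<close> matrix \<open>Y\<close>, up to sign. Some of the \<open>lam i\<close> may vanish; besides them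
  \<open>Y\<close> has \<open>p + n - 2 * min n p\<close> trivial zero eigenvalues (and \<open>Arg 0 = 0\<close>). The listing need not
  be unique, since eigenvalues of equal modulus that are not conjugate can be permuted.
\<close>

definition eigenvalue_listing :: "nat \<Rightarrow> nat \<Rightarrow> real mat \<Rightarrow> (nat \<Rightarrow> complex) \<Rightarrow> bool" where
  "eigenvalue_listing p n Y lam \<longleftrightarrow>
     eigenvalue_mset Y =
       (\<Sum>i\<in>{1..min n p}. {#lam i, - lam i#}) + replicate_mset (p + n - 2 * min n p) 0 \<and>
     (\<forall>i\<in>{1..min n p}. - pi / 2 < Arg (lam i) \<and> Arg (lam i) \<le> pi / 2) \<and>
     (\<forall>i\<in>{1..min n p}. \<forall>j\<in>{1..min n p}. i \<le> j \<longrightarrow> cmod (lam j) \<le> cmod (lam i)) \<and>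
     (\<forall>i\<in>{1..min n p}. 0 < Arg (lam i) \<and> Arg (lam i) < pi / 2 \<longrightarrow>
        i + 1 \<le> min n p \<and> lam (i + 1) = cnj (lam i))"

end

theory Submission
  imports Defs "HOL-Complex_Analysis.Complex_Analysis" "Jordan_Normal_Form.Schur_Decomposition"
begin

text \<open>
  Let \<open>X\<close> be the dilation of the noise, \<open>Q(z) = det (1 - z X)\<close>, and \<open>P(z) = det (1 - z Y)\<close>. As the signal
  has rank \<open>2k\<close>, \<open>P = Q * det (1 - z G(z))\<close> with a \<open>2k \<times> 2k\<close> matrix \<open>G\<close> built from bilinear forms of
  \<open>(1 - z X)\<^sup>-\<^sup>1\<close>. By Cramer's rule \<open>Q\<close> times such a form is a polynomial in \<open>z\<close> whose coefficients, like
  those of \<open>Q\<close>, are multi-affine in the independent entries: distinct monomials are orthogonal, so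
  second moments of the entries suffice. Apart from the deterministic part of the forms these
  coefficients are small, hence \<open>P \<approx> Q * D\<close> on \<open>cmod z \<le> r\<close> with \<open>D = (\<Prod>j. 1 - z\<^sup>2 * d j\<^sup>2)\<close>, for any
  \<open>r < c powr (- 1/4)\<close>, provided that \<open>Q\<close> stays away from 0.

  For that lower bound, multi-affinity also shows that truncating the entries at a high fixed
  level changes \<open>Q\<close> little. For the truncated matrix the traces of the first \<open>J\<close> powers have bounded second
  moments, by counting pairs of closed walks, and \<open>Q(z) * exp (\<Sum>m\<le>J. tr X^m * z^m / m) - 1\<close> vanishes to
  order \<open>J + 1\<close> at 0; as \<open>Q\<close> is bounded on a slightly larger disc, the Schwarz lemma makes it small.

  Rouche's theorem then equates the number of \<open>lam i\<close> and of \<open>d j\<close> outside any circle of radius above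
  \<open>1 / r\<close> that is not too close to some \<open>d j\<close>, which gives \<open>cmod (lam i) \<approx> d i\<close>. Since
  \<open>D (1 / lam i) \<approx> 0\<close>, \<open>lam i\<close> or \<open>- lam i\<close> is close to some \<open>d j\<close>, and the constraint on the argument
  selects the sign.
\<close>

subsection \<open>Zeros of polynomials and Weierstrass factors\<close>

text \<open>Where c powr (-1/4) comes from: the coefficient of z^m in \<open>Q\<close> is a signed
  sum of at most (p n)^(m/2) monomials, each of variance n^(-m), so its size is about c^(m/4) and
  the series is controlled up to radius c powr (-1/4), the reciprocal of the threshold for the
  spikes. In the code \<open>\<kappa>\<close> is slightly above sqrt c, and
  \<open>sqrt \<kappa> * r' < 1\<close>.

  Obstacle: with two moments the norm of \<open>X\<close> need not stay bounded, so no Neumann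
  series is used; random quantities enter as polynomial coefficients. Multi-affinity fails for the
  traces, where a closed walk may repeat an entry and higher moments appear; hence the truncation.
  It need not change the matrix little in norm, but closeness of \<open>Q\<close> is enough.

  Upper bounds on \<open>Q\<close> cannot exclude zeros; bounds on finitely many traces do. Their
  number \<open>J\<close> is fixed before n grows, so walks of bounded length suffice. Order of
  choices: the bounds \<open>L1\<close>, \<open>L2\<close> for determinant and traces, then
  \<open>J\<close> and the truncation level, then n.\<close>

lemma schwarz_power:
  fixes f :: "complex \<Rightarrow> complex"
  assumes "f holomorphic_on UNIV" and "0 < r"
    and "\<And>z. cmod z \<le> r \<Longrightarrow> cmod (f z) \<le> L"
    and "0 < \<rho>" and "\<And>z. 0 < cmod z \<Longrightarrow> cmod z < \<rho> \<Longrightarrow> cmod (f z) \<le> C * cmod z ^ n"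
    and "cmod z \<le> r"
  shows "cmod (f z) \<le> L * (cmod z / r) ^ n"
  using assms
proof (induction n arbitrary: f L z)
  case 0
  then show ?case by simp
next
  case (Suc n)
  \<comment> \<open>The bound is assumed off 0 only, because there the quotient by z inherits it
    directly; \<open>f 0 = 0\<close> is recovered by continuity.\<close>
  have lim: "(\<lambda>z. C * cmod z ^ Suc n) \<midarrow>0\<rightarrow> 0"
    by (rule tendsto_eq_intros refl | simp)+
  have cont: "isCont f 0"
    using holomorphic_on_imp_continuous_on[OF Suc.prems(1)]
    by (simp add: continuous_on_eq_continuous_at)
  have f0: "f 0 = 0"
  proof -
    have "((\<lambda>z. f z) \<longlongrightarrow> 0) (at 0)"
    proof (rule Lim_null_comparison[OF _ lim])
      show "\<forall>\<^sub>F z in at 0. cmod (f z) \<le> C * cmod z ^ Suc n"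
        unfolding eventually_at using Suc.prems(4,5)
        by (intro exI[of _ \<rho>]) (auto simp: dist_norm)
    qed
    then show ?thesis
      using cont LIM_unique unfolding isCont_def by blast
  qed
  define g where "g = (\<lambda>z. if z = 0 then deriv f 0 else f z / z)"
  have gf: "f z = z * g z" for z
    by (simp add: g_def f0)
  have holg: "g holomorphic_on UNIV"
  proof (rule pole_theorem_open_0[OF Suc.prems(1)])
    show "f z = (z - 0) * g z" for z by (simp add: gf)
  qed (auto simp: g_def f0)
  \<comment> \<open>Maximum modulus: on the circle of radius \<open>r\<close> the division by z
    costs exactly the factor \<open>r\<close>, and the bound extends to the inside.\<close>
  have "cmod (g w) \<le> L / r" if "cmod w \<le> r" for w
  proof (rule maximum_modulus_frontier[of g "cball 0 r"])
    show "g holomorphic_on interior (cball 0 r)" by (rule holomorphic_on_subset[OF holg]) simp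
    show "continuous_on (closure (cball 0 r)) g"
      by (rule continuous_on_subset[OF holomorphic_on_imp_continuous_on[OF holg]]) simp
    show "cmod (g w) \<le> L / r" if "w \<in> frontier (cball 0 r)" for w
    proof -
      have w: "cmod w = r" using that Suc.prems(2) by (simp add: frontier_cball)
      then have "r * cmod (g w) \<le> L" using Suc.prems(3)[of w] by (simp add: gf norm_mult)
      then show ?thesis using Suc.prems(2) by (simp add: field_simps)
    qed
  qed (use that in auto)
  moreover have "cmod (g w) \<le> C * cmod w ^ n" if "0 < cmod w" "cmod w < \<rho>" for w
    using Suc.prems(5)[OF that] that by (simp add: gf norm_mult)
  ultimately have "cmod (g z) \<le> L / r * (cmod z / r) ^ n"
    using Suc.IH[OF holg Suc.prems(2) _ Suc.prems(4)] Suc.prems(6) by blast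
  then have "cmod z * cmod (g z) \<le> cmod z * (L / r * (cmod z / r) ^ n)"
    by (intro mult_left_mono) auto
  then show ?case by (simp add: gf norm_mult field_simps)
qed

text \<open>Each factor (1 - w) exp (w + ... + w^J / J) is 1 + O(w^(J+1)), and products keep this.
  \<open>C\<close> and \<open>\<rho>\<close> depend on the list, hence later on n, which is
  harmless: \<open>schwarz_power\<close> uses them only for the order of vanishing, and its bound
  contains neither.\<close>

lemma weierstrass_prod_near_0:
  fixes vs :: "complex list"
  shows "\<exists>C \<rho>. 0 < \<rho> \<and> (\<forall>z. cmod z < \<rho> \<longrightarrow>
           cmod ((\<Prod>\<nu>\<leftarrow>vs. weierstrass_factor J (z * \<nu>)) - 1) \<le> C * cmod z ^ Suc J)"
proof (induction vs)
  case Nil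
  then show ?case by (intro exI[of _ 0] exI[of _ 1]) auto
next
  case (Cons \<nu> vs)
  define P where "P = (\<lambda>z. \<Prod>\<nu>\<leftarrow>vs. weierstrass_factor J (z * \<nu>))"
  define E where "E = (\<lambda>z. weierstrass_factor J (z * \<nu>))"
  obtain C \<rho> where C: "0 < \<rho>" "\<And>z. cmod z < \<rho> \<Longrightarrow> cmod (P z - 1) \<le> C * cmod z ^ Suc J"
    using Cons.IH unfolding P_def by blast
  \<comment> \<open>Inside this radius \<open>z * \<nu>\<close> has modulus at most 1/2, as
    \<open>weierstrass_factor_bound\<close> asks; the summand 1 covers \<open>\<nu> = 0\<close>, and
    \<open>cmod z \<le> 1\<close> serves to bound \<open>P\<close>.\<close>
  define \<rho>' where "\<rho>' = min (min \<rho> 1) (1 / (2 * (cmod \<nu> + 1)))"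
  have pos: "0 < \<rho>'" using C(1) by (auto simp: \<rho>'_def add_nonneg_pos)
  have "cmod (E z * P z - 1) \<le> (3 * cmod \<nu> ^ Suc J * (1 + \<bar>C\<bar>) + C) * cmod z ^ Suc J"
    if z: "cmod z < \<rho>'" for z
  proof -
    have z1: "cmod z < \<rho>" "cmod z \<le> 1" and z3: "cmod z \<le> 1 / (2 * (cmod \<nu> + 1))"
      using z by (auto simp: \<rho>'_def)
    have "0 < 2 * (cmod \<nu> + 1)" by (simp add: add_nonneg_pos)
    then have "cmod z * (2 * (cmod \<nu> + 1)) \<le> 1"
      using z3 by (simp only: pos_le_divide_eq)
    then have "2 * (cmod z * cmod \<nu>) + 2 * cmod z \<le> 1"
      by (simp add: algebra_simps)
    then have "cmod (z * \<nu>) \<le> 1 / 2"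
      using norm_ge_zero[of z] unfolding norm_mult by linarith
    then have E: "cmod (E z - 1) \<le> 3 * cmod (z * \<nu>) ^ Suc J"
      unfolding E_def by (rule weierstrass_factor_bound)
    have "C * cmod z ^ Suc J \<le> \<bar>C\<bar> * 1"
      by (intro mult_mono power_le_one) (use z1 in auto)
    then have "cmod (P z) \<le> 1 + \<bar>C\<bar>"
      using C(2)[OF z1(1)] norm_triangle_sub[of "P z" 1] by simp
    then have "cmod (E z - 1) * cmod (P z) \<le> (3 * cmod (z * \<nu>) ^ Suc J) * (1 + \<bar>C\<bar>)"
      using E by (intro mult_mono) auto
    moreover have "E z * P z - 1 = (E z - 1) * P z + (P z - 1)" by (simp add: algebra_simps)
    then have "cmod (E z * P z - 1) \<le> cmod (E z - 1) * cmod (P z) + cmod (P z - 1)"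
      by (metis norm_mult norm_triangle_ineq)
    ultimately show ?thesis
      using C(2)[OF z1(1)] by (simp add: norm_mult power_mult_distrib algebra_simps)
  qed
  then show ?case
    using pos unfolding P_def E_def by (intro exI conjI allI impI) auto
qed

text \<open>\<open>H\<close> is the exponential of the truncated series of minus the logarithm of
  \<open>Q\<close>, so \<open>Q * H\<close> - 1 vanishes to order \<open>J + 1\<close> and is at
  most \<open>exp L2 * L1 + 1\<close> on the larger disc. It is therefore at most 1/2 on the smaller
  disc, where \<open>cmod Q\<close> is at least 1 / (2 \<open>cmod H\<close>).\<close>

lemma prod_list_lower_bound:
  fixes vs :: "complex list"
  assumes r: "0 < r'" "cmod z \<le> r" "r < r'"
    and L1: "\<And>z. cmod z \<le> r' \<Longrightarrow> cmod (\<Prod>\<nu>\<leftarrow>vs. 1 - z * \<nu>) \<le> L1"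
    and L2: "(\<Sum>m=1..J. cmod (\<Sum>\<nu>\<leftarrow>vs. \<nu> ^ m) * r' ^ m / real m) \<le> L2"
    and small: "(exp L2 * L1 + 1) * (r / r') ^ Suc J \<le> 1 / 2"
  shows "exp (- L2) / 2 \<le> cmod (\<Prod>\<nu>\<leftarrow>vs. 1 - z * \<nu>)"
proof -
  define Q where "Q = (\<lambda>z. \<Prod>\<nu>\<leftarrow>vs. 1 - z * \<nu>)"
  define H where "H = (\<lambda>z. exp (\<Sum>m=1..J. (\<Sum>\<nu>\<leftarrow>vs. \<nu> ^ m) * z ^ m / of_nat m))"
  define f where "f = (\<lambda>z. Q z * H z - 1)"
  have QH: "Q z * H z = (\<Prod>\<nu>\<leftarrow>vs. weierstrass_factor J (z * \<nu>))" for z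
    unfolding Q_def H_def
    by (induction vs) (simp_all add: weierstrass_factor_def algebra_simps sum.distrib add_divide_distrib exp_add
          power_mult_distrib)
  have hol: "f holomorphic_on UNIV"
  proof -
    have "(\<lambda>z. \<Prod>\<nu>\<leftarrow>us. 1 - z * \<nu>) holomorphic_on UNIV" for us :: "complex list"
      by (induction us) (auto intro!: holomorphic_intros)
    then show ?thesis unfolding f_def Q_def H_def by (intro holomorphic_intros) auto
  qed
  have Hb: "cmod (H w) \<le> exp L2" if "cmod w \<le> r'" for w
  proof -
    have "cmod (H w) \<le> exp (cmod (\<Sum>m=1..J. (\<Sum>\<nu>\<leftarrow>vs. \<nu> ^ m) * w ^ m / of_nat m))"
      unfolding H_def by (rule norm_exp)
    also have "cmod (\<Sum>m=1..J. (\<Sum>\<nu>\<leftarrow>vs. \<nu> ^ m) * w ^ m / of_nat m)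
        \<le> (\<Sum>m=1..J. cmod (\<Sum>\<nu>\<leftarrow>vs. \<nu> ^ m) * r' ^ m / real m)"
      by (rule sum_norm_le)
        (auto simp: norm_mult norm_divide norm_power intro!: divide_right_mono mult_left_mono power_mono that)
    also have "\<dots> \<le> L2" by (rule L2)
    finally show ?thesis by simp
  qed
  have "cmod (f w) \<le> exp L2 * L1 + 1" if "cmod w \<le> r'" for w
  proof -
    have "cmod (Q w) * cmod (H w) \<le> L1 * exp L2"
      using L1[OF that] Hb[OF that] unfolding Q_def
      by (intro mult_mono) (auto intro: order_trans[OF norm_ge_zero])
    then show ?thesis
      using norm_triangle_ineq4[of "Q w * H w" 1] unfolding f_def by (simp add: norm_mult mult.commute)
  qed
  moreover obtain C \<rho> where "0 < \<rho>" "\<And>z. cmod z < \<rho> \<Longrightarrow> cmod (f z) \<le> C * cmod z ^ Suc J"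
    using weierstrass_prod_near_0[of J vs] unfolding f_def QH by blast
  ultimately have "cmod (f z) \<le> (exp L2 * L1 + 1) * (cmod z / r') ^ Suc J"
    using hol r by (intro schwarz_power[where f = f and \<rho> = \<rho> and C = C]) auto
  also have "\<dots> \<le> (exp L2 * L1 + 1) * (r / r') ^ Suc J"
  proof (intro mult_left_mono power_mono divide_right_mono)
    have "0 \<le> L1" using L1[of 0] r by (auto intro: order_trans[OF norm_ge_zero])
    then show "0 \<le> exp L2 * L1 + 1" by simp
  qed (use r in auto)
  also have "\<dots> \<le> 1 / 2" by (rule small)
  finally have "cmod (f z) \<le> 1 / 2" .
  then have "1 / 2 \<le> cmod (Q z * H z)"
    using norm_triangle_ineq4[of "Q z * H z" "f z"] by (simp add: f_def)
  also have "\<dots> \<le> cmod (Q z) * exp L2"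
    using Hb[of z] r by (simp add: norm_mult mult_left_mono)
  finally show ?thesis unfolding Q_def exp_minus by (simp add: field_simps)
qed

section \<open>Rouche's theorem for the root multisets of polynomials\<close>

lemma zorder_poly:
  fixes q :: "complex poly"
  assumes "q \<noteq> 0"
  shows "zorder (poly q) a = int (Polynomial.order a q)"
proof -
  obtain g where g: "q = [:- a, 1:] ^ Polynomial.order a q * g" "\<not> [:- a, 1:] dvd g"
    using order_decomp[OF assms] by blast
  show ?thesis
  proof (rule zorder_eqI[of UNIV _ "poly g"])
    show "poly g a \<noteq> 0" using g(2) by (simp add: poly_eq_0_iff_dvd)
    show "poly q w = poly g w * (w - a) powi int (Polynomial.order a q)" for w
      by (subst g(1)) (simp add: poly_power power_int_def mult.commute)
  qed (auto intro!: holomorphic_intros)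
qed

lemma size_filter_proots:
  fixes q :: "complex poly"
  assumes "q \<noteq> 0"
  shows "size (filter_mset P (proots q)) = (\<Sum>z | P z \<and> poly q z = 0. Polynomial.order z q)"
proof -
  have "set_mset (filter_mset P (proots q)) = {z. P z \<and> poly q z = 0}"
    using assms by auto
  then have "size (filter_mset P (proots q))
      = (\<Sum>z | P z \<and> poly q z = 0. count (filter_mset P (proots q)) z)"
    by (simp only: size_multiset_overloaded_eq)
  also have "\<dots> = (\<Sum>z | P z \<and> poly q z = 0. Polynomial.order z q)"
    by (rule sum.cong) (simp_all add: assms)
  finally show ?thesis .
qed

lemma rouche_proots:
  fixes q h :: "complex poly"
  assumes t: "0 < t" and less: "\<And>z. cmod z = t \<Longrightarrow> cmod (poly h z - poly q z) < cmod (poly q z)"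
  shows "size (filter_mset (\<lambda>z. cmod z < t) (proots h)) = size (filter_mset (\<lambda>z. cmod z < t) (proots q))"
proof -
  have tt: "cmod (complex_of_real t) = t" using t by simp
  have nz: "poly q z \<noteq> 0" "poly h z \<noteq> 0" if "cmod z = t" for z
    using less[OF that] by auto
  have q0: "q \<noteq> 0" and h0: "h \<noteq> 0" using nz[OF tt] by auto
  \<comment> \<open>\<open>Rouche_theorem\<close> counts zeros in an open set around the circle. The
    ball of radius \<open>T\<close> has no root in the annulus between \<open>t\<close> and
    \<open>T\<close>, so its count is that of the disc of radius \<open>t\<close>.\<close>
  obtain T where T: "t < T" "\<And>z. cmod z < T \<Longrightarrow> poly q z = 0 \<or> poly h z = 0 \<Longrightarrow> cmod z < t"
  proof -
    define S where "S = cmod ` {z. (poly q z = 0 \<or> poly h z = 0) \<and> t \<le> cmod z}"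
    have fin: "finite S"
      unfolding S_def
    proof (rule finite_imageI, rule finite_subset)
      show "finite ({z. poly q z = 0} \<union> {z. poly h z = 0})"
        using poly_roots_finite[OF q0] poly_roots_finite[OF h0] by simp
    qed auto
    have gt: "t < s" if "s \<in> S" for s
      using that nz unfolding S_def by force
    define T where "T = Min (insert (t + 1) S)"
    have "t < T" unfolding T_def using fin gt by simp
    moreover have "cmod z < t" if "cmod z < T" "poly q z = 0 \<or> poly h z = 0" for z
    proof (rule ccontr)
      assume "\<not> cmod z < t"
      then have "cmod z \<in> S" using that(2) unfolding S_def by auto
      then have "T \<le> cmod z" unfolding T_def using fin by simp
      then show False using that(1) by simp
    qed
    ultimately show ?thesis using that by blast
  qed
  define S where "S = ball (0::complex) T"
  define g where "g = poly (h - q)"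
  have fg: "poly q z + g z = poly h z" for z by (simp add: g_def)
  have zs: "{z\<in>S. poly f z = 0} = {z. cmod z < t \<and> poly f z = 0}" if "f = q \<or> f = h" for f
    using that T unfolding S_def by fastforce
  have fin: "finite {z\<in>S. poly f z = 0}" if "f = q \<or> f = h" for f
  proof (rule finite_subset[OF _ poly_roots_finite])
    show "f \<noteq> 0" using that q0 h0 by auto
  qed auto
  have "(\<Sum>z\<in>{z\<in>S. poly q z + g z = 0}. winding_number (circlepath 0 t) z * zorder (\<lambda>z. poly q z + g z) z)
      = (\<Sum>z\<in>{z\<in>S. poly q z = 0}. winding_number (circlepath 0 t) z * zorder (poly q) z)"
  proof (rule Rouche_theorem)
    show "\<forall>z. z \<notin> S \<longrightarrow> winding_number (circlepath 0 t) z = 0"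
    proof (intro allI impI winding_number_zero_outside[of _ "cball 0 t"])
      fix z assume "z \<notin> S"
      then show "z \<notin> cball 0 t" using T(1) by (simp add: S_def)
    qed (use t in auto)
    show "\<forall>z\<in>path_image (circlepath 0 t). cmod (g z) < cmod (poly q z)"
      using less t by (simp add: g_def)
    show "path_image (circlepath 0 t) \<subseteq> S" using t T(1) by (auto simp: S_def)
  qed (use fin in \<open>auto simp: S_def fg g_def intro!: holomorphic_intros\<close>)
  then have "(\<Sum>z | cmod z < t \<and> poly h z = 0. winding_number (circlepath 0 t) z * zorder (poly h) z)
      = (\<Sum>z | cmod z < t \<and> poly q z = 0. winding_number (circlepath 0 t) z * zorder (poly q) z)"
    by (simp add: fg zs)
  moreover have cnt: "(\<Sum>z | cmod z < t \<and> poly f z = 0. winding_number (circlepath 0 t) z * zorder (poly f) z)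
      = of_nat (size (filter_mset (\<lambda>z. cmod z < t) (proots f)))" if "f \<noteq> 0" for f
    unfolding size_filter_proots[OF that] of_nat_sum
    by (rule sum.cong) (auto simp: zorder_poly[OF that] winding_number_circlepath)
  ultimately have "of_nat (size (filter_mset (\<lambda>z. cmod z < t) (proots h)))
      = (of_nat (size (filter_mset (\<lambda>z. cmod z < t) (proots q))) :: complex)"
    by (simp only: cnt[OF h0] cnt[OF q0])
  then show ?thesis by (simp only: of_nat_eq_iff)
qed

subsection \<open>Multi-affine functions of independent variables\<close>

context prob_space
begin

text \<open>Independence factorises the expectation over the indices of \<open>F\<close> and
  \<open>G\<close>; an index in exactly one of them contributes a factor of mean 0. Two functions
  are allowed so that one statement covers original, truncated and mixed products.\<close>

lemma expectation_prod_two: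
  fixes \<xi> :: "'e \<Rightarrow> 'a \<Rightarrow> real" and g h :: "real \<Rightarrow> real"
  assumes indep: "indep_vars (\<lambda>_. borel) \<xi> E" and fin: "finite F" "finite G" and sub: "F \<subseteq> E" "G \<subseteq> E"
    and [measurable]: "g \<in> borel_measurable borel" "h \<in> borel_measurable borel"
    and g: "\<And>e. e \<in> E \<Longrightarrow> integrable M (\<lambda>\<omega>. (g (\<xi> e \<omega>))\<^sup>2)" "\<And>e. e \<in> E \<Longrightarrow> expectation (\<lambda>\<omega>. g (\<xi> e \<omega>)) = 0"
    and h: "\<And>e. e \<in> E \<Longrightarrow> integrable M (\<lambda>\<omega>. (h (\<xi> e \<omega>))\<^sup>2)" "\<And>e. e \<in> E \<Longrightarrow> expectation (\<lambda>\<omega>. h (\<xi> e \<omega>)) = 0"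
    and gh: "\<And>e. e \<in> E \<Longrightarrow> expectation (\<lambda>\<omega>. g (\<xi> e \<omega>) * h (\<xi> e \<omega>)) = \<theta>"
  shows "integrable M (\<lambda>\<omega>. (\<Prod>e\<in>F. g (\<xi> e \<omega>)) * (\<Prod>e\<in>G. h (\<xi> e \<omega>)))" (is ?I)
    and "expectation (\<lambda>\<omega>. (\<Prod>e\<in>F. g (\<xi> e \<omega>)) * (\<Prod>e\<in>G. h (\<xi> e \<omega>))) = (if F = G then \<theta> ^ card F else 0)" (is ?E)
proof -
  define k where "k e t = (if e \<in> F then g t else 1) * (if e \<in> G then h t else 1)" for e t
  have meas: "\<xi> e \<in> borel_measurable M" if "e \<in> E" for e
    using indep that by (auto simp: indep_vars_def)
  have kmeas: "k e \<in> borel_measurable borel" for e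
    unfolding k_def by simp
  have ind: "indep_vars (\<lambda>_. borel) (\<lambda>e \<omega>. k e (\<xi> e \<omega>)) (F \<union> G)"
    using indep_vars_compose2[OF indep_vars_subset[OF indep], of "F \<union> G" k "\<lambda>_. borel"] sub kmeas by auto
  have int1: "integrable M (\<lambda>\<omega>. f (\<xi> e \<omega>))"
    if "e \<in> E" "integrable M (\<lambda>\<omega>. (f (\<xi> e \<omega>))\<^sup>2)" "f \<in> borel_measurable borel" for e and f :: "real \<Rightarrow> real"
    using square_integrable_imp_integrable[OF _ that(2)] that(3) meas[OF that(1)] by simp
  have int2: "integrable M (\<lambda>\<omega>. g (\<xi> e \<omega>) * h (\<xi> e \<omega>))" if e: "e \<in> E" for e
  proof (rule Bochner_Integration.integrable_bound)
    show "integrable M (\<lambda>\<omega>. (g (\<xi> e \<omega>))\<^sup>2 + (h (\<xi> e \<omega>))\<^sup>2)"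
      using g(1)[OF e] h(1)[OF e] by simp
    show "(\<lambda>\<omega>. g (\<xi> e \<omega>) * h (\<xi> e \<omega>)) \<in> borel_measurable M"
      using meas[OF e] by measurable
    have "\<bar>a * b\<bar> \<le> a\<^sup>2 + b\<^sup>2" for a b :: real
    proof -
      have "0 \<le> (\<bar>a\<bar> - \<bar>b\<bar>)\<^sup>2" by simp
      then have "2 * \<bar>a * b\<bar> \<le> a\<^sup>2 + b\<^sup>2" by (simp add: power2_diff abs_mult)
      then show ?thesis using abs_ge_zero[of "a * b"] by linarith
    qed
    then show "AE \<omega> in M. norm (g (\<xi> e \<omega>) * h (\<xi> e \<omega>)) \<le> norm ((g (\<xi> e \<omega>))\<^sup>2 + (h (\<xi> e \<omega>))\<^sup>2)"
      by (auto intro!: AE_I2)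
  qed
  have kint: "integrable M (\<lambda>\<omega>. k e (\<xi> e \<omega>))" if "e \<in> F \<union> G" for e
  proof -
    have e: "e \<in> E" using that sub by auto
    show ?thesis
      using int1[OF e g(1)[OF e]] int1[OF e h(1)[OF e]] int2[OF e] that unfolding k_def
      by (cases "e \<in> F"; cases "e \<in> G") auto
  qed
  have eq: "(\<Prod>e\<in>F. g (\<xi> e \<omega>)) * (\<Prod>e\<in>G. h (\<xi> e \<omega>)) = (\<Prod>e\<in>F \<union> G. k e (\<xi> e \<omega>))" for \<omega>
  proof -
    have "(\<Prod>e\<in>F \<union> G. k e (\<xi> e \<omega>)) = (\<Prod>e\<in>F \<union> G. if e \<in> F then g (\<xi> e \<omega>) else 1) *
        (\<Prod>e\<in>F \<union> G. if e \<in> G then h (\<xi> e \<omega>) else 1)"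
      unfolding k_def by (rule prod.distrib)
    also have "(\<Prod>e\<in>F \<union> G. if e \<in> F then g (\<xi> e \<omega>) else 1) = (\<Prod>e\<in>F. g (\<xi> e \<omega>))"
      using fin by (intro prod.mono_neutral_cong_right) auto
    also have "(\<Prod>e\<in>F \<union> G. if e \<in> G then h (\<xi> e \<omega>) else 1) = (\<Prod>e\<in>G. h (\<xi> e \<omega>))"
      using fin by (intro prod.mono_neutral_cong_right) auto
    finally show ?thesis by simp
  qed
  show ?I unfolding eq
    by (rule indep_vars_integrable[OF _ ind kint]) (use fin in auto)
  have "expectation (\<lambda>\<omega>. \<Prod>e\<in>F \<union> G. k e (\<xi> e \<omega>)) = (\<Prod>e\<in>F \<union> G. expectation (\<lambda>\<omega>. k e (\<xi> e \<omega>)))"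
    by (rule indep_vars_lebesgue_integral[OF _ ind kint]) (use fin in auto)
  also have "\<dots> = (if F = G then \<theta> ^ card F else 0)"
  proof (cases "F = G")
    case True
    then show ?thesis using gh sub by (auto simp: k_def subset_iff)
  next
    case False
    then obtain e where e: "e \<in> F \<union> G" "\<not> (e \<in> F \<and> e \<in> G)" by blast
    then have "e \<in> E" using sub by auto
    then have "expectation (\<lambda>\<omega>. k e (\<xi> e \<omega>)) = 0"
      using e g(2) h(2) unfolding k_def by (cases "e \<in> F"; cases "e \<in> G") auto
    then have "(\<Prod>e\<in>F \<union> G. expectation (\<lambda>\<omega>. k e (\<xi> e \<omega>))) = 0"
      using e fin by (intro prod_zero) auto
    then show ?thesis using False by simp
  qed
  finally show ?E unfolding eq .
qed

lemma expectation_square_orthogonal: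
  fixes U :: "'i \<Rightarrow> 'a \<Rightarrow> real"
  assumes "finite I" and int: "\<And>i j. i \<in> I \<Longrightarrow> j \<in> I \<Longrightarrow> integrable M (\<lambda>\<omega>. U i \<omega> * U j \<omega>)"
    and orth: "\<And>i j. i \<in> I \<Longrightarrow> j \<in> I \<Longrightarrow> i \<noteq> j \<Longrightarrow> expectation (\<lambda>\<omega>. U i \<omega> * U j \<omega>) = 0"
  shows "integrable M (\<lambda>\<omega>. (\<Sum>i\<in>I. c i * U i \<omega>)\<^sup>2)"
    and "expectation (\<lambda>\<omega>. (\<Sum>i\<in>I. c i * U i \<omega>)\<^sup>2) = (\<Sum>i\<in>I. (c i)\<^sup>2 * expectation (\<lambda>\<omega>. U i \<omega> * U i \<omega>))"
proof -
  have eq: "(\<Sum>i\<in>I. c i * U i \<omega>)\<^sup>2 = (\<Sum>i\<in>I. \<Sum>j\<in>I. c i * c j * (U i \<omega> * U j \<omega>))" for \<omega>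
    unfolding power2_eq_square sum_product by (simp add: mult.assoc mult.left_commute)
  show "integrable M (\<lambda>\<omega>. (\<Sum>i\<in>I. c i * U i \<omega>)\<^sup>2)"
    unfolding eq using int by (intro Bochner_Integration.integrable_sum integrable_mult_right) auto
  have "expectation (\<lambda>\<omega>. (\<Sum>i\<in>I. c i * U i \<omega>)\<^sup>2) = (\<Sum>i\<in>I. \<Sum>j\<in>I. c i * c j * expectation (\<lambda>\<omega>. U i \<omega> * U j \<omega>))"
    unfolding eq using int by (subst Bochner_Integration.integral_sum; simp)+
  also have "\<dots> = (\<Sum>i\<in>I. \<Sum>j\<in>I. if j = i then c i * c i * expectation (\<lambda>\<omega>. U i \<omega> * U i \<omega>) else 0)"
    using orth by (intro sum.cong) auto
  also have "\<dots> = (\<Sum>i\<in>I. (c i)\<^sup>2 * expectation (\<lambda>\<omega>. U i \<omega> * U i \<omega>))"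
    using assms(1) by (simp add: power2_eq_square)
  finally show "expectation (\<lambda>\<omega>. (\<Sum>i\<in>I. c i * U i \<omega>)\<^sup>2) = (\<Sum>i\<in>I. (c i)\<^sup>2 * expectation (\<lambda>\<omega>. U i \<omega> * U i \<omega>))" .
qed

text \<open>Injectivity of \<open>F\<close> makes the monomials pairwise distinct, hence orthogonal,
  and only the diagonal terms survive.\<close>

lemma second_moment_multiaffine:
  fixes \<xi> :: "'e \<Rightarrow> 'a \<Rightarrow> real" and g :: "real \<Rightarrow> real"
  assumes indep: "indep_vars (\<lambda>_. borel) \<xi> E" and "g \<in> borel_measurable borel"
    and g: "\<And>e. e \<in> E \<Longrightarrow> integrable M (\<lambda>\<omega>. (g (\<xi> e \<omega>))\<^sup>2)" "\<And>e. e \<in> E \<Longrightarrow> expectation (\<lambda>\<omega>. g (\<xi> e \<omega>)) = 0"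
      "\<And>e. e \<in> E \<Longrightarrow> expectation (\<lambda>\<omega>. (g (\<xi> e \<omega>))\<^sup>2) = \<theta>"
    and I: "finite I" "inj_on F I" "\<And>i. i \<in> I \<Longrightarrow> finite (F i) \<and> F i \<subseteq> E"
  shows "integrable M (\<lambda>\<omega>. (\<Sum>i\<in>I. c i * (\<Prod>e\<in>F i. g (\<xi> e \<omega>)))\<^sup>2)"
    and "expectation (\<lambda>\<omega>. (\<Sum>i\<in>I. c i * (\<Prod>e\<in>F i. g (\<xi> e \<omega>)))\<^sup>2) = (\<Sum>i\<in>I. (c i)\<^sup>2 * \<theta> ^ card (F i))"
proof -
  have *: "integrable M (\<lambda>\<omega>. (\<Prod>e\<in>F i. g (\<xi> e \<omega>)) * (\<Prod>e\<in>F j. g (\<xi> e \<omega>)))"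
    "expectation (\<lambda>\<omega>. (\<Prod>e\<in>F i. g (\<xi> e \<omega>)) * (\<Prod>e\<in>F j. g (\<xi> e \<omega>))) = (if F i = F j then \<theta> ^ card (F i) else 0)"
    if "i \<in> I" "j \<in> I" for i j
    by (rule expectation_prod_two[OF indep, where g = g and h = g];
        use that I g assms(2) in \<open>auto simp: power2_eq_square\<close>)+
  have ne: "F i \<noteq> F j" if "i \<in> I" "j \<in> I" "i \<noteq> j" for i j
    using I(2) that by (auto dest: inj_onD)
  have orth: "expectation (\<lambda>\<omega>. (\<Prod>e\<in>F i. g (\<xi> e \<omega>)) * (\<Prod>e\<in>F j. g (\<xi> e \<omega>))) = 0"
    if "i \<in> I" "j \<in> I" "i \<noteq> j" for i j
    using *(2)[OF that(1,2)] ne[OF that] by simp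
  note sq = expectation_square_orthogonal[of I "\<lambda>i \<omega>. \<Prod>e\<in>F i. g (\<xi> e \<omega>)", OF I(1) *(1) orth]
  show "integrable M (\<lambda>\<omega>. (\<Sum>i\<in>I. c i * (\<Prod>e\<in>F i. g (\<xi> e \<omega>)))\<^sup>2)"
    by (rule sq(1))
  show "expectation (\<lambda>\<omega>. (\<Sum>i\<in>I. c i * (\<Prod>e\<in>F i. g (\<xi> e \<omega>)))\<^sup>2) = (\<Sum>i\<in>I. (c i)\<^sup>2 * \<theta> ^ card (F i))"
    using sq(2)[of c] by (simp add: *(2))
qed

text \<open>This measures the effect of truncating the entries. In the square of a difference the
  cross terms bring in the mixed moment \<open>\<theta>\<close>; different monomials are orthogonal
  in the mixed case too.\<close>

lemma second_moment_multiaffine_diff: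
  fixes \<xi> :: "'e \<Rightarrow> 'a \<Rightarrow> real" and g :: "real \<Rightarrow> real"
  assumes indep: "indep_vars (\<lambda>_. borel) \<xi> E" and gm: "g \<in> borel_measurable borel"
    and g: "\<And>e. e \<in> E \<Longrightarrow> integrable M (\<lambda>\<omega>. (g (\<xi> e \<omega>))\<^sup>2)" "\<And>e. e \<in> E \<Longrightarrow> expectation (\<lambda>\<omega>. g (\<xi> e \<omega>)) = 0"
      "\<And>e. e \<in> E \<Longrightarrow> expectation (\<lambda>\<omega>. (g (\<xi> e \<omega>))\<^sup>2) = \<tau>"
    and x: "\<And>e. e \<in> E \<Longrightarrow> integrable M (\<lambda>\<omega>. (\<xi> e \<omega>)\<^sup>2)" "\<And>e. e \<in> E \<Longrightarrow> expectation (\<lambda>\<omega>. \<xi> e \<omega>) = 0"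
      "\<And>e. e \<in> E \<Longrightarrow> expectation (\<lambda>\<omega>. (\<xi> e \<omega>)\<^sup>2) = v"
    and xg: "\<And>e. e \<in> E \<Longrightarrow> expectation (\<lambda>\<omega>. \<xi> e \<omega> * g (\<xi> e \<omega>)) = \<theta>"
    and I: "finite I" "inj_on F I" "\<And>i. i \<in> I \<Longrightarrow> finite (F i) \<and> F i \<subseteq> E"
  shows "integrable M (\<lambda>\<omega>. (\<Sum>i\<in>I. c i * ((\<Prod>e\<in>F i. \<xi> e \<omega>) - (\<Prod>e\<in>F i. g (\<xi> e \<omega>))))\<^sup>2)"
    and "expectation (\<lambda>\<omega>. (\<Sum>i\<in>I. c i * ((\<Prod>e\<in>F i. \<xi> e \<omega>) - (\<Prod>e\<in>F i. g (\<xi> e \<omega>))))\<^sup>2)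
      = (\<Sum>i\<in>I. (c i)\<^sup>2 * (v ^ card (F i) - 2 * \<theta> ^ card (F i) + \<tau> ^ card (F i)))"
proof -
  let ?P = "\<lambda>i \<omega>. \<Prod>e\<in>F i. \<xi> e \<omega>" and ?G = "\<lambda>i \<omega>. \<Prod>e\<in>F i. g (\<xi> e \<omega>)"
  have GG: "integrable M (\<lambda>\<omega>. ?G i \<omega> * ?G j \<omega>)"
    "expectation (\<lambda>\<omega>. ?G i \<omega> * ?G j \<omega>) = (if F i = F j then \<tau> ^ card (F i) else 0)"
    if "i \<in> I" "j \<in> I" for i j
    by (rule expectation_prod_two[OF indep, where g = g and h = g];
        use that I g gm in \<open>auto simp: power2_eq_square\<close>)+
  have PG: "integrable M (\<lambda>\<omega>. ?P i \<omega> * ?G j \<omega>)"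
    "expectation (\<lambda>\<omega>. ?P i \<omega> * ?G j \<omega>) = (if F i = F j then \<theta> ^ card (F i) else 0)"
    if "i \<in> I" "j \<in> I" for i j
    by (rule expectation_prod_two[OF indep, where g = "\<lambda>t. t" and h = g];
        use that I g x xg gm in \<open>auto simp: power2_eq_square\<close>)+
  have PP: "integrable M (\<lambda>\<omega>. ?P i \<omega> * ?P j \<omega>)"
    "expectation (\<lambda>\<omega>. ?P i \<omega> * ?P j \<omega>) = (if F i = F j then v ^ card (F i) else 0)"
    if "i \<in> I" "j \<in> I" for i j
    by (rule expectation_prod_two[OF indep, where g = "\<lambda>t. t" and h = "\<lambda>t. t"];
        use that I x in \<open>auto simp: power2_eq_square\<close>)+
  have eq: "(?P i \<omega> - ?G i \<omega>) * (?P j \<omega> - ?G j \<omega>) =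
      ?P i \<omega> * ?P j \<omega> - ?P i \<omega> * ?G j \<omega> - ?P j \<omega> * ?G i \<omega> + ?G i \<omega> * ?G j \<omega>" for i j \<omega>
    by (simp add: algebra_simps)
  have int: "integrable M (\<lambda>\<omega>. (?P i \<omega> - ?G i \<omega>) * (?P j \<omega> - ?G j \<omega>))" if "i \<in> I" "j \<in> I" for i j
    unfolding eq using GG(1) PG(1) PP(1) that by auto
  have ex: "expectation (\<lambda>\<omega>. (?P i \<omega> - ?G i \<omega>) * (?P j \<omega> - ?G j \<omega>)) =
      (if F i = F j then v ^ card (F i) - 2 * \<theta> ^ card (F i) + \<tau> ^ card (F i) else 0)" if "i \<in> I" "j \<in> I" for i j
    unfolding eq using GG PG PP that by auto
  have ne: "F i \<noteq> F j" if "i \<in> I" "j \<in> I" "i \<noteq> j" for i j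
    using I(2) that by (auto dest: inj_onD)
  have orth: "expectation (\<lambda>\<omega>. (?P i \<omega> - ?G i \<omega>) * (?P j \<omega> - ?G j \<omega>)) = 0"
    if "i \<in> I" "j \<in> I" "i \<noteq> j" for i j
    using ex[OF that(1,2)] ne[OF that] by simp
  note sq = expectation_square_orthogonal[of I "\<lambda>i \<omega>. ?P i \<omega> - ?G i \<omega>", OF I(1) int orth]
  show "integrable M (\<lambda>\<omega>. (\<Sum>i\<in>I. c i * (?P i \<omega> - ?G i \<omega>))\<^sup>2)"
    by (rule sq(1))
  show "expectation (\<lambda>\<omega>. (\<Sum>i\<in>I. c i * (?P i \<omega> - ?G i \<omega>))\<^sup>2)
      = (\<Sum>i\<in>I. (c i)\<^sup>2 * (v ^ card (F i) - 2 * \<theta> ^ card (F i) + \<tau> ^ card (F i)))"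
    using sq(2)[of c] by (simp add: ex)
qed

end

subsection \<open>Counting alternating permutations\<close>

text \<open>These index the monomials of det (1 - z X): \<open>F\<close> is the set of rows in which
  the term - z X is chosen, and the vanishing diagonal blocks force \<open>\<sigma>\<close> to
  change the block at each step.\<close>

definition alternating_perms :: "nat \<Rightarrow> nat \<Rightarrow> nat \<Rightarrow> (nat set \<times> (nat \<Rightarrow> nat)) set" where
  "alternating_perms p n m = {(F, \<sigma>). F \<subseteq> {0..<p + n} \<and> card F = m \<and> \<sigma> permutes F \<and>
     (\<forall>i\<in>F. (i < p) \<noteq> (\<sigma> i < p))}"

text \<open>In Cramer's rule row \<open>j\<close> is replaced by a vector, so the step at
  \<open>j\<close> carries no matrix entry and need not alternate. Removing it opens the cycle of
  \<open>j\<close> to a path from \<open>i\<close> to \<open>j\<close>; \<open>m\<close> counts the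
  remaining steps.\<close>

definition alternating_paths :: "nat \<Rightarrow> nat \<Rightarrow> nat \<Rightarrow> nat \<Rightarrow> nat \<Rightarrow> (nat set \<times> (nat \<Rightarrow> nat)) set" where
  "alternating_paths p n m j i = {(F, \<sigma>). F \<subseteq> {0..<p + n} - {j} \<and> card F = m \<and>
     \<sigma> permutes (insert j F) \<and> \<sigma> j = i \<and> (\<forall>k\<in>F. (k < p) \<noteq> (\<sigma> k < p))}"

text \<open>Union bound over the position at which \<open>j\<close> occurs: that letter is fixed and
  the other \<open>l - 1\<close> are free.\<close>

lemma card_words_through:
  assumes "finite B"
  shows "card {w \<in> {..<l} \<rightarrow>\<^sub>E B. j \<in> w ` {..<l}} \<le> l * card B ^ (l - 1)"
proof -
  let ?W = "\<lambda>k. PiE {..<l} (\<lambda>i. if i = k then {j} else B)"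
  have "{w \<in> {..<l} \<rightarrow>\<^sub>E B. j \<in> w ` {..<l}} \<subseteq> (\<Union>k\<in>{..<l}. ?W k)"
    by (fastforce simp: PiE_iff)
  then have "card {w \<in> {..<l} \<rightarrow>\<^sub>E B. j \<in> w ` {..<l}} \<le> card (\<Union>k\<in>{..<l}. ?W k)"
    using assms by (intro card_mono) (auto intro!: finite_PiE)
  also have "\<dots> \<le> (\<Sum>k\<in>{..<l}. card (?W k))"
    by (rule card_UN_le) simp
  also have "\<dots> = (\<Sum>k\<in>{..<l}. card B ^ (l - 1))"
  proof (rule sum.cong[OF refl])
    fix k assume k: "k \<in> {..<l}"
    have "card (?W k) = (\<Prod>i\<in>{..<l}. card (if i = k then {j} else B))"
      by (simp add: card_PiE)
    also have "\<dots> = (\<Prod>i\<in>{..<l} - {k}. card (if i = k then {j} else B))"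
      using k by (simp add: prod.remove)
    also have "\<dots> = (\<Prod>i\<in>{..<l} - {k}. card B)"
      by (rule prod.cong) auto
    also have "\<dots> = card B ^ (l - 1)"
      using k by simp
    finally show "card (?W k) = card B ^ (l - 1)" .
  qed
  finally show ?thesis by simp
qed

text \<open>Each half is mapped into the other and the images together exhaust \<open>F\<close>, so
  both inclusions are equalities; hence the halves have equal size and \<open>m\<close> is
  even.\<close>

lemma alternating_perms_split:
  assumes "(F, \<sigma>) \<in> alternating_perms p n m"
  defines "P \<equiv> F \<inter> {..<p}" and "N \<equiv> F - {..<p}"
  shows "\<sigma> ` P = N" "\<sigma> ` N = P" "m = 2 * card P" "finite F"
proof -
  have F: "finite F" "\<sigma> permutes F" "card F = m" and alt: "\<And>i. i \<in> F \<Longrightarrow> (i < p) \<noteq> (\<sigma> i < p)"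
    using assms(1) finite_subset by (auto simp: alternating_perms_def)
  show "finite F" by (rule F(1))
  have im: "\<sigma> ` F = F" by (rule permutes_image[OF F(2)])
  have 1: "\<sigma> ` P \<subseteq> N" "\<sigma> ` N \<subseteq> P"
    using alt im unfolding P_def N_def by auto
  have "P \<union> N = F" unfolding P_def N_def by auto
  then have un: "\<sigma> ` P \<union> \<sigma> ` N = P \<union> N"
    using im by (simp flip: image_Un)
  have disj: "P \<inter> N = {}" unfolding P_def N_def by auto
  show PN: "\<sigma> ` P = N"
  proof
    show "N \<subseteq> \<sigma> ` P"
    proof
      fix x assume "x \<in> N"
      then have "x \<in> \<sigma> ` P \<union> \<sigma> ` N" "x \<notin> P" using un disj by auto
      then show "x \<in> \<sigma> ` P" using 1(2) by (metis Un_iff subsetD)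
    qed
  qed (rule 1)
  show "\<sigma> ` N = P"
  proof
    show "P \<subseteq> \<sigma> ` N"
    proof
      fix x assume "x \<in> P"
      then have "x \<in> \<sigma> ` P \<union> \<sigma> ` N" "x \<notin> N" using un disj by auto
      then show "x \<in> \<sigma> ` N" using 1(1) by (metis Un_iff subsetD)
    qed
  qed (rule 1)
  have "card N = card P"
    unfolding PN[symmetric] by (rule card_image[OF permutes_inj_on[OF F(2)]])
  moreover have "card F = card P + card N"
    using card_Int_Diff[of F "{..<p}"] F(1) by (simp add: P_def N_def)
  ultimately show "m = 2 * card P" using F(3) by simp
qed

text \<open>
  Enumerating \<open>F \<inter> {..<p}\<close> increasingly as \<open>s\<close>, the pair is recovered from the two words
  \<open>\<sigma> (s k)\<close> and \<open>\<sigma> (\<sigma> (s k))\<close>: the range of the second one is \<open>F \<inter> {..<p}\<close>.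
\<close>

definition perm_words :: "nat \<Rightarrow> nat set \<times> (nat \<Rightarrow> nat) \<Rightarrow> (nat \<Rightarrow> nat) \<times> (nat \<Rightarrow> nat)" where
  "perm_words p = (\<lambda>(F, \<sigma>). let s = sorted_list_of_set (F \<inter> {..<p}) in
     (\<lambda>k\<in>{..<length s}. \<sigma> (s ! k), \<lambda>k\<in>{..<length s}. \<sigma> (\<sigma> (s ! k))))"

lemma perm_words_image:
  assumes "(F, \<sigma>) \<in> alternating_perms p n (2 * l)"
  shows "fst (perm_words p (F, \<sigma>)) ` {..<l} = F - {..<p}"
    and "snd (perm_words p (F, \<sigma>)) ` {..<l} = F \<inter> {..<p}"
    and "fst (perm_words p (F, \<sigma>)) \<in> extensional {..<l}"
    and "snd (perm_words p (F, \<sigma>)) \<in> extensional {..<l}"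
    and "k < l \<Longrightarrow> fst (perm_words p (F, \<sigma>)) k = \<sigma> (sorted_list_of_set (F \<inter> {..<p}) ! k)"
    and "k < l \<Longrightarrow> snd (perm_words p (F, \<sigma>)) k = \<sigma> (\<sigma> (sorted_list_of_set (F \<inter> {..<p}) ! k))"
proof -
  define s where "s = sorted_list_of_set (F \<inter> {..<p})"
  note sp = alternating_perms_split[OF assms]
  have len: "length s = l" and set: "set s = F \<inter> {..<p}"
    using sp unfolding s_def by auto
  have w: "perm_words p (F, \<sigma>) = (\<lambda>k\<in>{..<l}. \<sigma> (s ! k), \<lambda>k\<in>{..<l}. \<sigma> (\<sigma> (s ! k)))"
    using len unfolding perm_words_def s_def by (simp add: Let_def)
  have nth: "(!) s ` {..<l} = F \<inter> {..<p}"
    using len set by (metis atLeast_upt list.set_map map_nth)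
  have "fst (perm_words p (F, \<sigma>)) ` {..<l} = \<sigma> ` ((!) s ` {..<l})"
    unfolding w image_image by (auto simp: image_iff)
  then show "fst (perm_words p (F, \<sigma>)) ` {..<l} = F - {..<p}"
    using sp(1) nth by simp
  have "snd (perm_words p (F, \<sigma>)) ` {..<l} = \<sigma> ` (\<sigma> ` ((!) s ` {..<l}))"
    unfolding w image_image by (auto simp: image_iff)
  then show "snd (perm_words p (F, \<sigma>)) ` {..<l} = F \<inter> {..<p}"
    using sp(1,2) nth by simp
  show "fst (perm_words p (F, \<sigma>)) \<in> extensional {..<l}" "snd (perm_words p (F, \<sigma>)) \<in> extensional {..<l}"
    "k < l \<Longrightarrow> fst (perm_words p (F, \<sigma>)) k = \<sigma> (sorted_list_of_set (F \<inter> {..<p}) ! k)"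
    "k < l \<Longrightarrow> snd (perm_words p (F, \<sigma>)) k = \<sigma> (\<sigma> (sorted_list_of_set (F \<inter> {..<p}) ! k))"
    unfolding w by (auto simp: s_def)
qed

text \<open>The second range gives \<open>F \<inter> {..<p}\<close> and so its enumeration; the
  first word then gives \<open>\<sigma>\<close> on that set. The remaining elements of
  \<open>F\<close> are images \<open>\<sigma> x\<close> of it, and the second word gives
  \<open>\<sigma>\<close> on them.\<close>

lemma perm_words_inj: "inj_on (perm_words p) (alternating_perms p n (2 * l))"
proof (rule inj_onI, clarify)
  fix F \<sigma> G \<tau>
  assume F: "(F, \<sigma>) \<in> alternating_perms p n (2 * l)" and G: "(G, \<tau>) \<in> alternating_perms p n (2 * l)"
    and eq: "perm_words p (F, \<sigma>) = perm_words p (G, \<tau>)"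
  note iF = perm_words_image[OF F] and iG = perm_words_image[OF G]
  have FP: "F \<inter> {..<p} = G \<inter> {..<p}" using iF(2) iG(2) eq by simp
  have FN: "F - {..<p} = G - {..<p}" using iF(1) iG(1) eq by simp
  have FG: "F = G" using FP FN by blast
  have card: "card (F \<inter> {..<p}) = l" and fin: "finite F"
    using alternating_perms_split[OF F] by auto
  have perm: "\<sigma> permutes F" "\<tau> permutes F"
    using F G FG by (auto simp: alternating_perms_def)
  define s where "s = sorted_list_of_set (F \<inter> {..<p})"
  have s: "set s = F \<inter> {..<p}" "length s = l" using card fin by (auto simp: s_def)
  have onP: "\<sigma> i = \<tau> i" "\<sigma> (\<sigma> i) = \<tau> (\<tau> i)" if "i \<in> F \<inter> {..<p}" for i
  proof -
    have "i \<in> set s" using that s(1) by simp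
    then obtain k where k: "k < l" "i = s ! k" by (auto simp: in_set_conv_nth s(2))
    show "\<sigma> i = \<tau> i" "\<sigma> (\<sigma> i) = \<tau> (\<tau> i)"
      using iF(5,6)[OF k(1)] iG(5,6)[OF k(1)] k(2) eq FG by (auto simp: s_def)
  qed
  have "\<sigma> i = \<tau> i" for i
  proof (cases "i \<in> F")
    case True
    show ?thesis
    proof (cases "i < p")
      case False
      then have "i \<in> \<sigma> ` (F \<inter> {..<p})"
        using True alternating_perms_split(1)[OF F] by simp
      then obtain x where "x \<in> F \<inter> {..<p}" "i = \<sigma> x" by blast
      then show ?thesis using onP[of x] by simp
    qed (use onP True in auto)
  qed (use perm in \<open>auto simp: permutes_not_in\<close>)
  then show "F = G \<and> \<sigma> = \<tau>" using FG by auto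
qed

lemma finite_alternating_perms: "finite (alternating_perms p n m)"
proof (rule finite_subset)
  show "alternating_perms p n m \<subseteq> Pow {0..<p + n} \<times> {\<sigma>. \<sigma> permutes {0..<p + n}}"
    by (auto simp: alternating_perms_def intro: permutes_subset)
qed (simp add: finite_permutations)

lemma alternating_perms_odd: "odd m \<Longrightarrow> alternating_perms p n m = {}"
  using alternating_perms_split(3) by fastforce

text \<open>A vertex required to lie in \<open>F\<close> must occur as a letter in the word of its
  block, so the requirements in the two blocks act on separate words.\<close>

lemma card_alternating_perms_through:
  "card {x \<in> alternating_perms p n (2 * l). J \<subseteq> fst x}
    \<le> card {w \<in> {..<l} \<rightarrow>\<^sub>E {p..<p + n}. J - {..<p} \<subseteq> w ` {..<l}} * card {w \<in> {..<l} \<rightarrow>\<^sub>E {..<p}. J \<inter> {..<p} \<subseteq> w ` {..<l}}"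
  (is "card ?X \<le> card ?A * card ?B")
proof -
  have fin: "finite ?A" "finite ?B"
    using finite_PiE[of "{..<l}" "\<lambda>_. {p..<p + n}"] finite_PiE[of "{..<l}" "\<lambda>_. {..<p}"]
    by (auto intro: finite_subset[rotated])
  have sub: "perm_words p ` ?X \<subseteq> ?A \<times> ?B"
  proof
    fix y assume "y \<in> perm_words p ` ?X"
    then obtain F \<sigma> where x: "(F, \<sigma>) \<in> alternating_perms p n (2 * l)" "J \<subseteq> F" "y = perm_words p (F, \<sigma>)"
      by auto
    note im = perm_words_image[OF x(1)]
    have "F \<subseteq> {0..<p + n}" using x(1) by (auto simp: alternating_perms_def)
    then have "fst y ` {..<l} \<subseteq> {p..<p + n}" "snd y ` {..<l} \<subseteq> {..<p}"
      using im(1,2) x(3) by auto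
    moreover have "J - {..<p} \<subseteq> fst y ` {..<l}" "J \<inter> {..<p} \<subseteq> snd y ` {..<l}"
      unfolding x(3) im(1,2) using x(2) by auto
    ultimately have "fst y \<in> ?A" "snd y \<in> ?B"
      using im(3,4) unfolding x(3) by (simp_all add: PiE_iff image_subset_iff)
    then show "y \<in> ?A \<times> ?B" by (simp add: mem_Times_iff)
  qed
  have "card ?X = card (perm_words p ` ?X)"
    using inj_on_subset[OF perm_words_inj[of p n l], of ?X] by (simp add: card_image)
  also have "\<dots> \<le> card (?A \<times> ?B)"
    using sub fin by (intro card_mono) auto
  finally show ?thesis by (simp add: card_cartesian_product)
qed

text \<open>Compared with \<open>n ^ l * p ^ l\<close>, each prescribed vertex trades one factor n
  or p, according to its block, for at most \<open>l\<close> positions. This saving is the source of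
  the factor 1 / n for the bilinear forms.\<close>

lemma card_alternating_perms_le:
  "card (alternating_perms p n (2 * l)) \<le> n ^ l * p ^ l"
  "j < p \<Longrightarrow> card {x \<in> alternating_perms p n (2 * l). j \<in> fst x} \<le> n ^ l * (l * p ^ (l - 1))"
  "p \<le> j \<Longrightarrow> card {x \<in> alternating_perms p n (2 * l). j \<in> fst x} \<le> (l * n ^ (l - 1)) * p ^ l"
  "i < p \<Longrightarrow> p \<le> j \<Longrightarrow> card {x \<in> alternating_perms p n (2 * l). i \<in> fst x \<and> j \<in> fst x}
     \<le> (l * n ^ (l - 1)) * (l * p ^ (l - 1))"
proof -
  have w: "card {w \<in> {..<l} \<rightarrow>\<^sub>E {p..<p + n}. {} \<subseteq> w ` {..<l}} = n ^ l"
    "card {w \<in> {..<l} \<rightarrow>\<^sub>E {..<p}. {} \<subseteq> w ` {..<l}} = p ^ l"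
    by (simp_all add: card_PiE)
  have t: "card {w \<in> {..<l} \<rightarrow>\<^sub>E {p..<p + n}. {j} \<subseteq> w ` {..<l}} \<le> l * n ^ (l - 1)"
    "card {w \<in> {..<l} \<rightarrow>\<^sub>E {..<p}. {j} \<subseteq> w ` {..<l}} \<le> l * p ^ (l - 1)" for j
    using card_words_through[of "{p..<p + n}" l j] card_words_through[of "{..<p}" l j] by simp_all
  note thr = card_alternating_perms_through[of p n l]
  show "card (alternating_perms p n (2 * l)) \<le> n ^ l * p ^ l"
    using thr[of "{}"] w by simp
  show "card {x \<in> alternating_perms p n (2 * l). j \<in> fst x} \<le> n ^ l * (l * p ^ (l - 1))" if "j < p"
  proof -
    have J: "{j} - {..<p} = {}" "{j} \<inter> {..<p} = {j}" using that by auto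
    show ?thesis
      using order_trans[OF thr[of "{j}", unfolded J w(1)] mult_le_mono2[OF t(2)[of j]]] by simp
  qed
  show "card {x \<in> alternating_perms p n (2 * l). j \<in> fst x} \<le> (l * n ^ (l - 1)) * p ^ l" if "p \<le> j"
  proof -
    have J: "{j} - {..<p} = {j}" "{j} \<inter> {..<p} = {}" using that by auto
    show ?thesis
      using order_trans[OF thr[of "{j}", unfolded J w(2)] mult_le_mono1[OF t(1)[of j]]] by simp
  qed
  show "card {x \<in> alternating_perms p n (2 * l). i \<in> fst x \<and> j \<in> fst x} \<le> (l * n ^ (l - 1)) * (l * p ^ (l - 1))"
    if "i < p" "p \<le> j"
  proof -
    have J: "{i, j} - {..<p} = {j}" "{i, j} \<inter> {..<p} = {i}" using that by auto
    show ?thesis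
      using order_trans[OF thr[of "{i, j}", unfolded J] mult_le_mono[OF t(1)[of j] t(2)[of i]]] by simp
  qed
qed

lemma finite_alternating_paths: "finite (alternating_paths p n m j i)"
proof (rule finite_subset)
  show "alternating_paths p n m j i \<subseteq> Pow {0..<p + n} \<times> {\<sigma>. \<sigma> permutes (insert j {0..<p + n})}"
    by (auto simp: alternating_paths_def elim!: permutes_subset)
qed (simp add: finite_permutations)

text \<open>When the ends lie in opposite blocks the step from \<open>j\<close> to \<open>i\<close>
  alternates as well; keeping it turns the path into an alternating permutation with one more
  vertex.\<close>

lemma card_alternating_paths_opposite:
  assumes "(i < p) \<noteq> (j < p)" "j < p + n"
  shows "card (alternating_paths p n m j i) \<le> card {x \<in> alternating_perms p n (Suc m). i \<in> fst x \<and> j \<in> fst x}"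
proof (rule card_inj_on_le)
  show "inj_on (\<lambda>(F, \<sigma>). (insert j F, \<sigma>)) (alternating_paths p n m j i)"
    by (auto simp: inj_on_def alternating_paths_def)
  show "(\<lambda>(F, \<sigma>). (insert j F, \<sigma>)) ` alternating_paths p n m j i
      \<subseteq> {x \<in> alternating_perms p n (Suc m). i \<in> fst x \<and> j \<in> fst x}"
  proof clarify
    fix F \<sigma> assume x: "(F, \<sigma>) \<in> alternating_paths p n m j i"
    then have p: "\<sigma> permutes insert j F" "\<sigma> j = i" "F \<subseteq> {0..<p + n} - {j}" "card F = m"
      by (auto simp: alternating_paths_def)
    have "i \<in> insert j F" using permutes_in_image[OF p(1), of j] p(2) by simp
    moreover have "card (insert j F) = Suc m"
      using p(3,4) finite_subset[of F "{0..<p + n}"] by (subst card_insert_disjoint) auto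
    ultimately show "(insert j F, \<sigma>) \<in> alternating_perms p n (Suc m) \<and>
        i \<in> fst (insert j F, \<sigma>) \<and> j \<in> fst (insert j F, \<sigma>)"
      using x assms by (auto simp: alternating_paths_def alternating_perms_def)
  qed
qed (simp add: finite_alternating_perms)

text \<open>With both ends in one block, composing with the transposition of \<open>i\<close> and
  \<open>j\<close> makes \<open>j\<close> a fixed point and sends its predecessor to
  \<open>i\<close>, which preserves alternation.\<close>

lemma card_alternating_paths_same:
  assumes "(i < p) = (j < p)" "i \<noteq> j"
  shows "card (alternating_paths p n m j i) \<le> card {x \<in> alternating_perms p n m. i \<in> fst x}"
proof (rule card_inj_on_le)
  let ?f = "\<lambda>(F, \<sigma>). (F, Transposition.transpose i j \<circ> \<sigma>)"
  show "inj_on ?f (alternating_paths p n m j i)"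
  proof (rule inj_onI, clarify)
    fix F :: "nat set" and \<sigma> \<tau> :: "nat \<Rightarrow> nat"
    assume "Transposition.transpose i j \<circ> \<sigma> = Transposition.transpose i j \<circ> \<tau>"
    then have "Transposition.transpose i j (\<sigma> x) = Transposition.transpose i j (\<tau> x)" for x
      by (metis comp_apply)
    then have "\<sigma> x = \<tau> x" for x by (metis transpose_involutory)
    then show "F = F \<and> \<sigma> = \<tau>" by auto
  qed
  show "?f ` alternating_paths p n m j i \<subseteq> {x \<in> alternating_perms p n m. i \<in> fst x}"
  proof clarify
    fix F \<sigma> assume x: "(F, \<sigma>) \<in> alternating_paths p n m j i"
    then have p: "\<sigma> permutes insert j F" "\<sigma> j = i" "F \<subseteq> {0..<p + n} - {j}" "card F = m"
        and alt: "\<forall>k\<in>F. (k < p) \<noteq> (\<sigma> k < p)"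
      by (auto simp: alternating_paths_def)
    have i: "i \<in> F" using permutes_in_image[OF p(1), of j] p(2) assms(2) by simp
    have "Transposition.transpose i j permutes insert j F"
      using i by (intro permutes_swap_id) auto
    then have perm: "(Transposition.transpose i j \<circ> \<sigma>) permutes F"
      using p(1,2) by (intro permutes_superset[OF permutes_compose]) auto
    moreover have "(k < p) \<noteq> ((Transposition.transpose i j \<circ> \<sigma>) k < p)" if "k \<in> F" for k
      using alt that assms(1) by (auto simp: Transposition.transpose_def)
    ultimately show "(F, Transposition.transpose i j \<circ> \<sigma>) \<in> alternating_perms p n m \<and>
        i \<in> fst (F, Transposition.transpose i j \<circ> \<sigma>)"
      using p i by (auto simp: alternating_perms_def)
  qed
qed (simp add: finite_alternating_perms)

section \<open>Counts weighted by the variance factor 1 / n for each edge\<close>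

lemma alternating_perms_weight:
  assumes "0 < n" "0 < \<kappa>" "real p \<le> \<kappa>\<^sup>2 * real n"
  shows "real (card (alternating_perms p n m)) * (1 / real n) ^ m \<le> \<kappa> ^ m"
proof (cases "even m")
  case True
  then obtain l where m: "m = 2 * l" by blast
  have "real (card (alternating_perms p n m)) \<le> real (n ^ l * p ^ l)"
    using card_alternating_perms_le(1)[of p n l] unfolding m by (simp only: of_nat_le_iff)
  also have "\<dots> \<le> real n ^ l * (\<kappa>\<^sup>2 * real n) ^ l"
    using assms(3) by (auto intro!: mult_left_mono power_mono)
  finally have "real (card (alternating_perms p n m)) * (1 / real n) ^ m
      \<le> (real n ^ l * (\<kappa>\<^sup>2 * real n) ^ l) * (1 / real n) ^ m"
    by (intro mult_right_mono) auto
  also have "\<dots> = \<kappa> ^ m"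
    using assms(1) unfolding m power_mult by (simp add: power_mult_distrib power_divide power2_eq_square field_simps)
  finally show ?thesis .
qed (use assms in \<open>simp add: alternating_perms_odd\<close>)

text \<open>There is one free vertex fewer than there are edges (\<open>m = a + b + 1\<close>),
  which leaves 1 / n. The power of \<open>\<kappa>\<close> obtained is \<open>2 * b\<close>, short
  of \<open>m\<close> by 0, 1 or 2; the factor \<open>(1 + 1 / \<kappa>)\<^sup>2\<close> makes up
  for it in each case.\<close>

lemma weight_bound_aux:
  assumes "0 < n" "0 < \<kappa>" "real p \<le> \<kappa>\<^sup>2 * real n" "m = a + b + 1"
    and "2 * b \<le> m" "m \<le> 2 * b + 2" "c \<le> (m + 1)\<^sup>2"
  shows "real (c * n ^ a * p ^ b) * (1 / real n) ^ m \<le> (real m + 1)\<^sup>2 * \<kappa> ^ m * (1 + 1 / \<kappa>)\<^sup>2 / real n"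
proof -
  have "real (c * n ^ a * p ^ b) * (1 / real n) ^ m \<le> (real m + 1)\<^sup>2 * real n ^ a * (\<kappa>\<^sup>2 * real n) ^ b * (1 / real n) ^ m"
  proof (intro mult_right_mono)
    have "real c \<le> (real m + 1)\<^sup>2"
      using assms(7) by (metis of_nat_1 of_nat_add of_nat_le_iff of_nat_power)
    then show "real (c * n ^ a * p ^ b) \<le> (real m + 1)\<^sup>2 * real n ^ a * (\<kappa>\<^sup>2 * real n) ^ b"
      unfolding of_nat_mult of_nat_power using assms(3) by (intro mult_mono power_mono) auto
  qed simp
  also have "\<dots> = (real m + 1)\<^sup>2 * \<kappa> ^ (2 * b) / real n"
  proof -
    have "real n ^ a * real n ^ b * real n = real n ^ m"
      using assms(4) by (simp flip: power_add power_Suc2)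
    then have "real n ^ a * real n ^ b * (1 / real n) ^ m = 1 / real n"
      using assms(1) by (simp add: power_divide field_simps)
    then have "(real n ^ a * real n ^ b * (1 / real n) ^ m) * ((real m + 1)\<^sup>2 * (\<kappa>\<^sup>2) ^ b)
        = 1 / real n * ((real m + 1)\<^sup>2 * (\<kappa>\<^sup>2) ^ b)"
      by (rule arg_cong)
    then show ?thesis unfolding power_mult_distrib[of "\<kappa>\<^sup>2"] power_mult by (simp only: mult_ac) simp
  qed
  also have "\<dots> \<le> (real m + 1)\<^sup>2 * (\<kappa> ^ m * (1 + 1 / \<kappa>)\<^sup>2) / real n"
  proof (intro divide_right_mono mult_left_mono)
    obtain q where q: "m = 2 * b + q" "q \<le> 2" using assms(5,6) by (metis add_le_cancel_left le_Suc_ex)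
    have "1 \<le> \<kappa> ^ q * (1 + 1 / \<kappa>)\<^sup>2"
    proof -
      have "\<kappa> ^ q * (1 + 1 / \<kappa>)\<^sup>2 = \<kappa> ^ q + 2 * \<kappa> ^ q / \<kappa> + \<kappa> ^ q / \<kappa>\<^sup>2"
        using assms(2) by (simp add: power2_eq_square field_simps)
      moreover have "q = 0 \<or> q = 1 \<or> q = 2" using q(2) by auto
      then have "1 \<le> \<kappa> ^ q + 2 * \<kappa> ^ q / \<kappa> + \<kappa> ^ q / \<kappa>\<^sup>2"
        using assms(2) by (auto simp: power2_eq_square)
      ultimately show ?thesis by simp
    qed
    then have "\<kappa> ^ (2 * b) * 1 \<le> \<kappa> ^ (2 * b) * (\<kappa> ^ q * (1 + 1 / \<kappa>)\<^sup>2)"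
      using assms(2) by (intro mult_left_mono) auto
    then show "\<kappa> ^ (2 * b) \<le> \<kappa> ^ m * (1 + 1 / \<kappa>)\<^sup>2"
      unfolding q(1) power_add by (simp add: mult.assoc)
  qed auto
  finally show ?thesis by (simp add: mult.assoc)
qed

lemma alternating_perms_weight_at:
  assumes "0 < n" "0 < \<kappa>" "real p \<le> \<kappa>\<^sup>2 * real n"
  shows "real (card {x \<in> alternating_perms p n m. j \<in> fst x}) * (1 / real n) ^ m
    \<le> (real m + 1)\<^sup>2 * \<kappa> ^ m * (1 + 1 / \<kappa>)\<^sup>2 / real n"
proof -
  let ?X = "{x \<in> alternating_perms p n m. j \<in> fst x}"
  have 0: "0 \<le> (real m + 1)\<^sup>2 * \<kappa> ^ m * (1 + 1 / \<kappa>)\<^sup>2 / real n" using assms by simp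
  show ?thesis
  proof (cases "even m \<and> 0 < m")
    case False
    then have "?X = {}"
      using alternating_perms_odd[of m p n]
      by (auto simp: alternating_perms_def dest: card_eq_0_iff[THEN iffD1] finite_subset)
    then show ?thesis using 0 by (simp only: card.empty of_nat_0 mult_zero_left)
  next
    case True
    then obtain l where m: "m = 2 * l" "0 < l" by auto
    have sq: "l \<le> (m + 1)\<^sup>2" using m by (simp add: power2_eq_square)
    have "card ?X \<le> l * n ^ l * p ^ (l - 1) \<or> card ?X \<le> l * n ^ (l - 1) * p ^ l"
    proof (cases "j < p")
      case True
      then show ?thesis
        using card_alternating_perms_le(2)[of j p n l] unfolding m(1) by (simp add: mult_ac)
    next
      case False
      then show ?thesis
        using card_alternating_perms_le(3)[of p j n l] unfolding m(1) by (simp add: mult_ac)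
    qed
    then obtain a b where ab: "card ?X \<le> l * n ^ a * p ^ b" "(a = l \<and> b = l - 1) \<or> (a = l - 1 \<and> b = l)"
      by blast
    have "real (card ?X) * (1 / real n) ^ m \<le> real (l * n ^ a * p ^ b) * (1 / real n) ^ m"
      using ab(1) by (intro mult_right_mono) (auto simp only: of_nat_le_iff, simp)
    also have "\<dots> \<le> (real m + 1)\<^sup>2 * \<kappa> ^ m * (1 + 1 / \<kappa>)\<^sup>2 / real n"
      by (rule weight_bound_aux[OF assms]) (use ab(2) m sq in auto)
    finally show ?thesis .
  qed
qed

lemma alternating_paths_weight:
  assumes "0 < n" "0 < \<kappa>" "real p \<le> \<kappa>\<^sup>2 * real n" and "i \<noteq> j" "j < p + n"
  shows "real (card (alternating_paths p n m j i)) * (1 / real n) ^ m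
    \<le> (real m + 1)\<^sup>2 * \<kappa> ^ m * (1 + 1 / \<kappa>)\<^sup>2 / real n"
proof (cases "(i < p) = (j < p)")
  case True
  have "real (card (alternating_paths p n m j i)) * (1 / real n) ^ m
      \<le> real (card {x \<in> alternating_perms p n m. i \<in> fst x}) * (1 / real n) ^ m"
    using card_alternating_paths_same[OF True assms(4), of n m] by (intro mult_right_mono) auto
  then show ?thesis using alternating_perms_weight_at[OF assms(1-3), of m i] by simp
next
  case False
  let ?X = "{x \<in> alternating_perms p n (Suc m). i \<in> fst x \<and> j \<in> fst x}"
  have le: "card (alternating_paths p n m j i) \<le> card ?X"
    by (rule card_alternating_paths_opposite[OF False assms(5)])
  show ?thesis
  proof (cases "even m")
    case True
    then have "?X = {}" using alternating_perms_odd[of "Suc m" p n] by auto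
    then have "card (alternating_paths p n m j i) = 0" using le by (simp only: card.empty le_zero_eq)
    then show ?thesis using assms by simp
  next
    case odd: False
    then obtain l0 where "m = 2 * l0 + 1" by (auto elim: oddE)
    then obtain l where l: "Suc m = 2 * l" "0 < l" by (intro that[of "Suc l0"]) auto
    have "card ?X \<le> (l * n ^ (l - 1)) * (l * p ^ (l - 1))"
      using card_alternating_perms_le(4)[of i p j n l] card_alternating_perms_le(4)[of j p i n l] False
      unfolding l by (cases "i < p") (auto simp: conj_commute)
    then have X: "card ?X \<le> l * l * n ^ (l - 1) * p ^ (l - 1)" by (simp add: mult_ac)
    have "l * l \<le> (m + 1) * (m + 1)" using l by (intro mult_le_mono) auto
    then have sq: "l * l \<le> (m + 1)\<^sup>2" by (simp add: power2_eq_square)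
    have "real (card (alternating_paths p n m j i)) * (1 / real n) ^ m
        \<le> real (l * l * n ^ (l - 1) * p ^ (l - 1)) * (1 / real n) ^ m"
      using le_trans[OF le X] by (intro mult_right_mono) (auto simp only: of_nat_le_iff, simp)
    also have "\<dots> \<le> (real m + 1)\<^sup>2 * \<kappa> ^ m * (1 + 1 / \<kappa>)\<^sup>2 / real n"
    proof (rule weight_bound_aux[OF assms(1-3) _ _ _ sq])
      show "m = l - 1 + (l - 1) + 1" using l by linarith
    qed (use l in auto)
    finally show ?thesis .
  qed
qed

subsection \<open>Determinants\<close>

text \<open>Expand each row outside \<open>S\<close> into its identity part and its part with
  \<open>A\<close>: \<open>F\<close> is the set of rows where the latter is chosen, and the identity
  part forces fixed points elsewhere. \<open>S = {}\<close> gives the characteristic determinant,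
  \<open>S = {j}\<close> the one with a replaced row.\<close>

lemma det_rows_identity_minus:
  fixes A M :: "'a :: comm_ring_1 mat"
  assumes M: "M \<in> carrier_mat N N" and S: "S \<subseteq> {0..<N}"
    and row: "\<And>i j. i < N \<Longrightarrow> j < N \<Longrightarrow> i \<notin> S \<Longrightarrow> M $$ (i, j) = (if i = j then 1 else 0) - z * A $$ (i, j)"
  shows "det M = (\<Sum>F\<in>Pow ({0..<N} - S). \<Sum>\<sigma> | \<sigma> permutes (S \<union> F).
    signof \<sigma> * (\<Prod>i\<in>S. M $$ (i, \<sigma> i)) * (- z) ^ card F * (\<Prod>i\<in>F. A $$ (i, \<sigma> i)))"
proof -
  let ?V = "{0..<N}"
  have finS: "finite S" using S finite_subset by blast
  have prod: "(\<Prod>i\<in>?V. M $$ (i, \<sigma> i)) = (\<Sum>F\<in>Pow (?V - S).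
      if \<forall>i\<in>?V - S - F. \<sigma> i = i then (\<Prod>i\<in>S. M $$ (i, \<sigma> i)) * ((- z) ^ card F * (\<Prod>i\<in>F. A $$ (i, \<sigma> i))) else 0)"
    if \<sigma>: "\<sigma> permutes ?V" for \<sigma>
  proof -
    have "(\<Prod>i\<in>?V. M $$ (i, \<sigma> i)) = (\<Prod>i\<in>?V - S. M $$ (i, \<sigma> i)) * (\<Prod>i\<in>S. M $$ (i, \<sigma> i))"
      using S by (intro prod.subset_diff) auto
    also have "(\<Prod>i\<in>?V - S. M $$ (i, \<sigma> i)) = (\<Prod>i\<in>?V - S. - z * A $$ (i, \<sigma> i) + (if \<sigma> i = i then 1 else 0))"
      using row permutes_in_image[OF \<sigma>] by (intro prod.cong) auto
    also have "\<dots> = (\<Sum>F\<in>Pow (?V - S). (\<Prod>i\<in>F. - z * A $$ (i, \<sigma> i)) * (\<Prod>i\<in>?V - S - F. if \<sigma> i = i then 1 else 0))"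
      by (rule prod_add) simp
    also have "\<dots> * (\<Prod>i\<in>S. M $$ (i, \<sigma> i)) = (\<Sum>F\<in>Pow (?V - S).
      if \<forall>i\<in>?V - S - F. \<sigma> i = i then (\<Prod>i\<in>S. M $$ (i, \<sigma> i)) * ((- z) ^ card F * (\<Prod>i\<in>F. A $$ (i, \<sigma> i))) else 0)"
      unfolding sum_distrib_right
    proof (rule sum.cong[OF refl])
      fix F assume "F \<in> Pow (?V - S)"
      have "(\<Prod>i\<in>?V - S - F. if \<sigma> i = i then 1 else 0) = (if \<forall>i\<in>?V - S - F. \<sigma> i = i then 1 else 0 :: 'a)"
      proof (cases "\<forall>i\<in>?V - S - F. \<sigma> i = i")
        case False
        then have "(\<Prod>i\<in>?V - S - F. if \<sigma> i = i then 1 else 0 :: 'a) = 0"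
          by (intro prod_zero) auto
        then show ?thesis using False by simp
      qed simp
      moreover have "(\<Prod>i\<in>F. - z * A $$ (i, \<sigma> i)) = (- z) ^ card F * (\<Prod>i\<in>F. A $$ (i, \<sigma> i))"
        by (simp only: prod.distrib prod_constant)
      ultimately show "(\<Prod>i\<in>F. - z * A $$ (i, \<sigma> i)) * (\<Prod>i\<in>?V - S - F. if \<sigma> i = i then 1 else 0) * (\<Prod>i\<in>S. M $$ (i, \<sigma> i))
        = (if \<forall>i\<in>?V - S - F. \<sigma> i = i then (\<Prod>i\<in>S. M $$ (i, \<sigma> i)) * ((- z) ^ card F * (\<Prod>i\<in>F. A $$ (i, \<sigma> i))) else 0)"
        by (simp add: mult_ac)
    qed
    finally show ?thesis .
  qed
  have perms: "{\<sigma>. \<sigma> permutes ?V} \<inter> {\<sigma>. \<forall>i\<in>?V - S - F. \<sigma> i = i} = {\<sigma>. \<sigma> permutes (S \<union> F)}"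
    if "F \<subseteq> ?V - S" for F
  proof (intro equalityI subsetI IntI CollectI)
    fix \<sigma> assume "\<sigma> \<in> {\<sigma>. \<sigma> permutes ?V} \<inter> {\<sigma>. \<forall>i\<in>?V - S - F. \<sigma> i = i}"
    then have "\<sigma> permutes ?V" "\<And>i. i \<in> ?V - (S \<union> F) \<Longrightarrow> \<sigma> i = i" by auto
    then show "\<sigma> permutes (S \<union> F)" by (rule permutes_superset)
  next
    fix \<sigma> assume "\<sigma> \<in> {\<sigma>. \<sigma> permutes (S \<union> F)}"
    then have \<sigma>: "\<sigma> permutes (S \<union> F)" by simp
    show "\<sigma> permutes ?V" by (rule permutes_subset[OF \<sigma>]) (use that S in auto)
    show "\<forall>i\<in>?V - S - F. \<sigma> i = i" using permutes_not_in[OF \<sigma>] by simp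
  qed
  have "det M = (\<Sum>\<sigma> | \<sigma> permutes ?V. signof \<sigma> * (\<Prod>i\<in>?V. M $$ (i, \<sigma> i)))"
    by (rule det_def'[OF M])
  also have "\<dots> = (\<Sum>\<sigma> | \<sigma> permutes ?V. \<Sum>F\<in>Pow (?V - S). if \<forall>i\<in>?V - S - F. \<sigma> i = i
      then signof \<sigma> * (\<Prod>i\<in>S. M $$ (i, \<sigma> i)) * (- z) ^ card F * (\<Prod>i\<in>F. A $$ (i, \<sigma> i)) else 0)"
    by (intro sum.cong refl) (auto simp: prod sum_distrib_left mult_ac intro!: sum.cong)
  also have "\<dots> = (\<Sum>F\<in>Pow (?V - S). \<Sum>\<sigma> | \<sigma> permutes ?V. if \<forall>i\<in>?V - S - F. \<sigma> i = i
      then signof \<sigma> * (\<Prod>i\<in>S. M $$ (i, \<sigma> i)) * (- z) ^ card F * (\<Prod>i\<in>F. A $$ (i, \<sigma> i)) else 0)"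
    by (rule sum.swap)
  also have "\<dots> = (\<Sum>F\<in>Pow (?V - S). \<Sum>\<sigma> | \<sigma> permutes (S \<union> F).
    signof \<sigma> * (\<Prod>i\<in>S. M $$ (i, \<sigma> i)) * (- z) ^ card F * (\<Prod>i\<in>F. A $$ (i, \<sigma> i)))"
  proof (rule sum.cong[OF refl])
    fix F assume "F \<in> Pow (?V - S)"
    then show "(\<Sum>\<sigma> | \<sigma> permutes ?V. if \<forall>i\<in>?V - S - F. \<sigma> i = i
      then signof \<sigma> * (\<Prod>i\<in>S. M $$ (i, \<sigma> i)) * (- z) ^ card F * (\<Prod>i\<in>F. A $$ (i, \<sigma> i)) else 0)
      = (\<Sum>\<sigma> | \<sigma> permutes (S \<union> F). signof \<sigma> * (\<Prod>i\<in>S. M $$ (i, \<sigma> i)) * (- z) ^ card F * (\<Prod>i\<in>F. A $$ (i, \<sigma> i)))"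
      using perms[of F] by (simp add: sum.If_cases finite_permutations)
  qed
  finally show ?thesis .
qed

text \<open>The block matrix with rows (1, C) and (B, 1) can be split off \<open>?L\<close> on the
  left or on the right; \<open>?L\<close> has determinant 1, and the two cofactors \<open>?R\<close>
  and \<open>?R'\<close> have the two determinants in question.\<close>

lemma det_sylvester:
  fixes C B :: "'a :: idom mat"
  assumes C: "C \<in> carrier_mat N q" and B: "B \<in> carrier_mat q N"
  shows "det (1\<^sub>m N - C * B) = det (1\<^sub>m q - B * C)"
proof -
  let ?L = "four_block_mat (1\<^sub>m N) (0\<^sub>m N q) B (1\<^sub>m q)"
  let ?R = "four_block_mat (1\<^sub>m N) C (0\<^sub>m q N) (1\<^sub>m q - B * C)"
  let ?R' = "four_block_mat (1\<^sub>m N - C * B) C (0\<^sub>m q N) (1\<^sub>m q)"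
  have BC: "B * C \<in> carrier_mat q q" and CB: "C * B \<in> carrier_mat N N" using assms by auto
  have 1: "1\<^sub>m q - B * C \<in> carrier_mat q q" "1\<^sub>m N - C * B \<in> carrier_mat N N"
    using BC CB by (simp_all only: minus_carrier_mat)
  have add_minus: "D + (1\<^sub>m m - D) = 1\<^sub>m m" "(1\<^sub>m m - D) + D = 1\<^sub>m m"
    if "D \<in> carrier_mat m m" for D :: "'a mat" and m
    using that by (intro eq_matI; auto)+
  note e1 = add_minus(1)[OF BC] and e2 = add_minus(2)[OF CB]
  have "?L * ?R = four_block_mat (1\<^sub>m N) C B (1\<^sub>m q)"
    using assms 1 by (subst mult_four_block_mat[of _ N N _ q _ q _ _ N _ q]) (auto simp: e1)
  moreover have "?R' * ?L = four_block_mat (1\<^sub>m N) C B (1\<^sub>m q)"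
    using assms 1 by (subst mult_four_block_mat[of _ N N _ q _ q _ _ N _ q]) (auto simp: e2)
  ultimately have eq: "?L * ?R = ?R' * ?L" by simp
  have L: "det ?L = 1"
    using B by (subst det_four_block_mat_upper_right_zero[of _ N _ q]) auto
  have "det (?L * ?R) = det ?L * det ?R" "det (?R' * ?L) = det ?R' * det ?L"
    by (rule det_mult[of _ "N + q"]; use assms 1 in auto)+
  then have "det ?R = det ?R'" using eq L by simp
  moreover have "det ?R = det (1\<^sub>m q - B * C)"
    using C 1 by (subst det_four_block_mat_lower_left_zero[of _ N _ q]) auto
  moreover have "det ?R' = det (1\<^sub>m N - C * B)"
    using C 1 by (subst det_four_block_mat_lower_left_zero[of _ N _ q]) auto
  ultimately show ?thesis by simp
qed

text \<open>Factor \<open>M\<close> out and reduce to size \<open>q\<close> by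
  \<open>det_sylvester\<close>. The inverse is written as adjugate over determinant, so that for M =
  1 - z X the small matrix has polynomials in z over \<open>det M\<close>.\<close>

lemma det_low_rank_perturbation:
  fixes M A B :: "'a :: field mat"
  assumes M: "M \<in> carrier_mat N N" and A: "A \<in> carrier_mat N q" and B: "B \<in> carrier_mat q N"
    and nz: "det M \<noteq> 0"
  shows "det (M - A * B) = det M * det (1\<^sub>m q - (1 / det M) \<cdot>\<^sub>m (B * (adj_mat M * A)))"
proof -
  let ?C = "(1 / det M) \<cdot>\<^sub>m (adj_mat M * A)"
  note adj = adj_mat[OF M]
  have C: "?C \<in> carrier_mat N q" using adj A by auto
  have "M * ?C = (1 / det M) \<cdot>\<^sub>m (M * (adj_mat M * A))"
    using M adj A by (intro mult_smult_distrib) auto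
  also have "M * (adj_mat M * A) = (M * adj_mat M) * A"
    using M adj A by (intro assoc_mult_mat[symmetric]) auto
  also have "\<dots> = det M \<cdot>\<^sub>m A"
    unfolding adj(2) using A by (subst mult_smult_assoc_mat[of _ N N _ q]) auto
  also have "(1 / det M) \<cdot>\<^sub>m (det M \<cdot>\<^sub>m A) = A"
    using nz by (intro eq_matI) auto
  finally have MC: "M * ?C = A" .
  have CB: "?C * B \<in> carrier_mat N N" using C B by auto
  have "M * (1\<^sub>m N - ?C * B) = M * 1\<^sub>m N - M * (?C * B)"
    using M CB by (intro mult_minus_distrib_mat) auto
  also have "M * (?C * B) = (M * ?C) * B"
    using M C B by (intro assoc_mult_mat[symmetric]) auto
  finally have "M - A * B = M * (1\<^sub>m N - ?C * B)" unfolding MC using M by simp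
  then have "det (M - A * B) = det M * det (1\<^sub>m N - ?C * B)"
    using det_mult[OF M minus_carrier_mat[OF CB]] by simp
  also have "det (1\<^sub>m N - ?C * B) = det (1\<^sub>m q - B * ?C)"
    by (rule det_sylvester[OF C B])
  also have "B * ?C = (1 / det M) \<cdot>\<^sub>m (B * (adj_mat M * A))"
    using B adj A by (intro mult_smult_distrib) auto
  finally show ?thesis .
qed

definition replace_row :: "'a mat \<Rightarrow> nat \<Rightarrow> (nat \<Rightarrow> 'a) \<Rightarrow> 'a mat" where
  "replace_row M j b = Matrix.mat (dim_row M) (dim_col M) (\<lambda>(i, l). if i = j then b l else M $$ (i, l))"

lemma det_replace_row:
  fixes M :: "'a :: comm_ring_1 mat"
  assumes M: "M \<in> carrier_mat N N" and j: "j < N"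
  shows "det (replace_row M j b) = (\<Sum>i<N. b i * adj_mat M $$ (i, j))"
proof -
  let ?B = "replace_row M j b"
  have B: "?B \<in> carrier_mat N N" using M by (auto simp: replace_row_def)
  have "det ?B = (\<Sum>i<N. ?B $$ (j, i) * cofactor ?B j i)"
    by (rule laplace_expansion_row[OF B j])
  also have "\<dots> = (\<Sum>i<N. b i * adj_mat M $$ (i, j))"
  proof (rule sum.cong[OF refl])
    fix i assume i: "i \<in> {..<N}"
    have "mat_delete ?B j i = mat_delete M j i"
      using M i j by (intro eq_matI) (auto simp: mat_delete_def replace_row_def)
    then show "?B $$ (j, i) * cofactor ?B j i = b i * adj_mat M $$ (i, j)"
      using M i j by (auto simp: cofactor_def adj_mat_def replace_row_def)
  qed
  finally show ?thesis .
qed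

lemma det_diff_le:
  fixes A B :: "complex mat"
  assumes A: "A \<in> carrier_mat q q" and B: "B \<in> carrier_mat q q" and L: "1 \<le> L"
    and bound: "\<And>i j. i < q \<Longrightarrow> j < q \<Longrightarrow> cmod (A $$ (i, j)) \<le> L" "\<And>i j. i < q \<Longrightarrow> j < q \<Longrightarrow> cmod (B $$ (i, j)) \<le> L"
    and diff: "\<And>i j. i < q \<Longrightarrow> j < q \<Longrightarrow> cmod (A $$ (i, j) - B $$ (i, j)) \<le> \<eta>"
  shows "cmod (det A - det B) \<le> fact q * (L ^ q * (real q * \<eta>))"
proof -
  have pd: "cmod ((\<Prod>i\<in>{0..<q}. A $$ (i, \<sigma> i)) - (\<Prod>i\<in>{0..<q}. B $$ (i, \<sigma> i))) \<le> L ^ q * (real q * \<eta>)"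
    if \<sigma>: "\<sigma> permutes {0..<q}" for \<sigma>
  proof -
    have in_range: "\<sigma> i < q" if "i < q" for i using permutes_in_image[OF \<sigma>] that by simp
    \<comment> \<open>Dividing all entries by \<open>L\<close> brings them into the unit disc, where
      \<open>norm_prod_diff\<close> bounds a difference of products by the sum of the
      differences.\<close>
    have sc: "(\<Prod>i\<in>{0..<q}. f i) = of_real L ^ q * (\<Prod>i\<in>{0..<q}. f i / of_real L)" for f :: "nat \<Rightarrow> complex"
      using L by (simp add: prod_dividef)
    have "cmod ((\<Prod>i\<in>{0..<q}. A $$ (i, \<sigma> i) / of_real L) - (\<Prod>i\<in>{0..<q}. B $$ (i, \<sigma> i) / of_real L))
        \<le> (\<Sum>i\<in>{0..<q}. cmod (A $$ (i, \<sigma> i) / of_real L - B $$ (i, \<sigma> i) / of_real L))"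
      using bound in_range L by (intro norm_prod_diff) (auto simp: norm_divide divide_le_eq)
    also have "\<dots> \<le> (\<Sum>i\<in>{0..<q}. \<eta>)"
    proof (rule sum_mono)
      fix i assume i: "i \<in> {0..<q}"
      then have d: "cmod (A $$ (i, \<sigma> i) - B $$ (i, \<sigma> i)) \<le> \<eta>" using diff in_range by simp
      have "cmod (A $$ (i, \<sigma> i) / of_real L - B $$ (i, \<sigma> i) / of_real L) = cmod (A $$ (i, \<sigma> i) - B $$ (i, \<sigma> i)) / L"
        using L by (simp add: norm_divide flip: diff_divide_distrib)
      also have "\<dots> \<le> cmod (A $$ (i, \<sigma> i) - B $$ (i, \<sigma> i))"
        using L mult_left_mono[OF L norm_ge_zero] by (simp add: divide_le_eq)
      finally show "cmod (A $$ (i, \<sigma> i) / of_real L - B $$ (i, \<sigma> i) / of_real L) \<le> \<eta>" using d by simp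
    qed
    finally have *: "cmod ((\<Prod>i\<in>{0..<q}. A $$ (i, \<sigma> i) / of_real L) - (\<Prod>i\<in>{0..<q}. B $$ (i, \<sigma> i) / of_real L)) \<le> real q * \<eta>"
      by simp
    have "(\<Prod>i\<in>{0..<q}. A $$ (i, \<sigma> i)) - (\<Prod>i\<in>{0..<q}. B $$ (i, \<sigma> i))
        = of_real L ^ q * ((\<Prod>i\<in>{0..<q}. A $$ (i, \<sigma> i) / of_real L) - (\<Prod>i\<in>{0..<q}. B $$ (i, \<sigma> i) / of_real L))"
      unfolding sc[of "\<lambda>i. A $$ (i, \<sigma> i)"] sc[of "\<lambda>i. B $$ (i, \<sigma> i)"] by (simp only: right_diff_distrib)
    then have "cmod ((\<Prod>i\<in>{0..<q}. A $$ (i, \<sigma> i)) - (\<Prod>i\<in>{0..<q}. B $$ (i, \<sigma> i)))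
        = L ^ q * cmod ((\<Prod>i\<in>{0..<q}. A $$ (i, \<sigma> i) / of_real L) - (\<Prod>i\<in>{0..<q}. B $$ (i, \<sigma> i) / of_real L))"
      using L by (simp add: norm_mult norm_power)
    then show ?thesis using * L by (simp add: mult_left_mono)
  qed
  have "det A - det B = (\<Sum>\<sigma> | \<sigma> permutes {0..<q}. signof \<sigma> *
      ((\<Prod>i\<in>{0..<q}. A $$ (i, \<sigma> i)) - (\<Prod>i\<in>{0..<q}. B $$ (i, \<sigma> i))))"
    unfolding det_def'[OF A] det_def'[OF B] by (simp add: sum_subtractf right_diff_distrib)
  also have "cmod \<dots> \<le> (\<Sum>\<sigma> | \<sigma> permutes {0..<q}. L ^ q * (real q * \<eta>))"
    by (rule sum_norm_le) (auto simp: norm_mult sign_def pd)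
  also have "\<dots> = fact q * (L ^ q * (real q * \<eta>))"
    using card_permutations[of "{0..<q}" q] by simp
  finally show ?thesis .
qed

subsection \<open>Coefficients of the characteristic determinant and of the adjugate\<close>

text \<open>
  Edge \<open>(i, j)\<close> carries the entry in row \<open>i\<close>, column \<open>j\<close> of the dilation; the two off-diagonal blocks are
  the edges with exactly one end below \<open>p\<close>.
\<close>

definition alternating_edges :: "nat \<Rightarrow> nat \<Rightarrow> (nat \<times> nat) set" where
  "alternating_edges p n = {(i, j). i < p + n \<and> j < p + n \<and> (i < p) \<noteq> (j < p)}"

definition edge_mat :: "nat \<Rightarrow> nat \<Rightarrow> (nat \<times> nat \<Rightarrow> real) \<Rightarrow> complex mat" where
  "edge_mat p n y = Matrix.mat (p + n) (p + n)
     (\<lambda>(i, j). if (i < p) \<noteq> (j < p) then complex_of_real (y (i, j)) else 0)"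

abbreviation char_det :: "complex mat \<Rightarrow> complex \<Rightarrow> complex" where
  "char_det A z \<equiv> det (1\<^sub>m (dim_row A) - z \<cdot>\<^sub>m A)"

text \<open>The set of entries occurring in a monomial. Orthogonality is a matter of these sets
  being different, hence the injectivity lemmas below.\<close>

definition graph_of :: "nat set \<Rightarrow> (nat \<Rightarrow> nat) \<Rightarrow> (nat \<times> nat) set" where
  "graph_of F \<sigma> = (\<lambda>k. (k, \<sigma> k)) ` F"

text \<open>The coefficient of (-z)^m in det (1 - z X), with the sign of z kept outside; see
  \<open>char_det_edge_mat\<close>.\<close>

definition det_coeff :: "nat \<Rightarrow> nat \<Rightarrow> (nat \<times> nat \<Rightarrow> real) \<Rightarrow> nat \<Rightarrow> real" where
  "det_coeff p n y m = (\<Sum>(F, \<sigma>)\<in>alternating_perms p n m. signof \<sigma> * (\<Prod>e\<in>graph_of F \<sigma>. y e))"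

definition open_paths :: "nat \<Rightarrow> nat \<Rightarrow> nat \<Rightarrow> (nat \<times> nat set \<times> (nat \<Rightarrow> nat)) set" where
  "open_paths p n m = {(j, F, \<sigma>). j < p + n \<and> \<sigma> j \<noteq> j \<and> (F, \<sigma>) \<in> alternating_paths p n m j (\<sigma> j)}"

text \<open>Comes from the terms of Cramer's rule with \<open>\<sigma> j = j\<close>: there the
  remaining permutation avoids \<open>j\<close>, and permutations avoiding \<open>j\<close> are all
  permutations minus those through \<open>j\<close>. This is the subtracted part, summed over
  \<open>j\<close>.\<close>

definition cycle_coeff :: "nat \<Rightarrow> nat \<Rightarrow> (nat \<times> nat \<Rightarrow> real) \<Rightarrow> (nat \<Rightarrow> real) \<Rightarrow> (nat \<Rightarrow> real) \<Rightarrow> nat \<Rightarrow> real" where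
  "cycle_coeff p n y a b m =
     (\<Sum>(F, \<sigma>)\<in>alternating_perms p n m. signof \<sigma> * (\<Sum>j\<in>F. a j * b j) * (\<Prod>e\<in>graph_of F \<sigma>. y e))"

text \<open>The terms with \<open>\<sigma> j \<noteq> j\<close>: the entries of the two vectors sit
  at the two ends of the opened cycle.\<close>

definition path_coeff :: "nat \<Rightarrow> nat \<Rightarrow> (nat \<times> nat \<Rightarrow> real) \<Rightarrow> (nat \<Rightarrow> real) \<Rightarrow> (nat \<Rightarrow> real) \<Rightarrow> nat \<Rightarrow> real" where
  "path_coeff p n y a b m =
     (\<Sum>(j, F, \<sigma>)\<in>open_paths p n m. signof \<sigma> * (a j * b (\<sigma> j)) * (\<Prod>e\<in>graph_of F \<sigma>. y e))"

lemma finite_open_paths: "finite (open_paths p n m)"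
proof (rule finite_subset)
  show "open_paths p n m \<subseteq> (\<Union>j<p + n. \<Union>i<p + n. {j} \<times> alternating_paths p n m j i)"
  proof (rule subsetI, clarify)
    fix j F \<sigma> assume "(j, F, \<sigma>) \<in> open_paths p n m"
    then have j: "j < p + n" and x: "(F, \<sigma>) \<in> alternating_paths p n m j (\<sigma> j)"
      by (auto simp: open_paths_def)
    then have \<sigma>: "\<sigma> permutes insert j F" and F: "F \<subseteq> {0..<p + n} - {j}"
      by (auto simp: alternating_paths_def)
    have "\<sigma> j \<in> insert j F" using permutes_in_image[OF \<sigma>, of j] by simp
    moreover have "insert j F \<subseteq> {0..<p + n}" using F j by auto
    ultimately have "\<sigma> j < p + n" by auto
    then show "(j, F, \<sigma>) \<in> (\<Union>j<p + n. \<Union>i<p + n. {j} \<times> alternating_paths p n m j i)"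
      using j x by blast
  qed
qed (simp add: finite_alternating_paths)

lemma card_graph_of: "card (graph_of F \<sigma>) = card F"
  unfolding graph_of_def by (rule card_image) (auto simp: inj_on_def)

lemma prod_graph_of: "(\<Prod>e\<in>graph_of F \<sigma>. f e) = (\<Prod>k\<in>F. f (k, \<sigma> k))"
  unfolding graph_of_def by (subst prod.reindex) (auto simp: inj_on_def)

lemma graph_of_fst: "fst ` graph_of F \<sigma> = F" and graph_of_snd: "snd ` graph_of F \<sigma> = \<sigma> ` F"
  unfolding graph_of_def by (auto simp: image_image)

lemma graph_of_eqD:
  assumes "graph_of F \<sigma> = graph_of G \<tau>"
  shows "F = G" "\<And>k. k \<in> F \<Longrightarrow> \<sigma> k = \<tau> k"
proof -
  show FG: "F = G" using arg_cong[OF assms, of "image fst"] by (simp add: graph_of_fst)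
  show "\<sigma> k = \<tau> k" if "k \<in> F" for k
  proof -
    have "(k, \<sigma> k) \<in> graph_of F \<sigma>" using that by (simp add: graph_of_def)
    then have "(k, \<sigma> k) \<in> graph_of G \<tau>" unfolding assms .
    then show ?thesis by (auto simp: graph_of_def)
  qed
qed

lemma graph_of_perms:
  assumes "(F, \<sigma>) \<in> alternating_perms p n m"
  shows "finite (graph_of F \<sigma>)" "graph_of F \<sigma> \<subseteq> alternating_edges p n" "card (graph_of F \<sigma>) = m"
proof -
  have x: "F \<subseteq> {0..<p + n}" "card F = m" "\<sigma> permutes F" "\<forall>i\<in>F. (i < p) \<noteq> (\<sigma> i < p)"
    using assms by (auto simp: alternating_perms_def)
  show "finite (graph_of F \<sigma>)" using finite_subset[OF x(1)] by (simp add: graph_of_def)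
  have "\<sigma> k \<in> F" if "k \<in> F" for k using that permutes_in_image[OF x(3)] by simp
  then show "graph_of F \<sigma> \<subseteq> alternating_edges p n"
    using x(1,4) by (fastforce simp: graph_of_def alternating_edges_def)
  show "card (graph_of F \<sigma>) = m" using x(2) by (simp add: card_graph_of)
qed

lemma inj_graph_of_perms: "inj_on (\<lambda>(F, \<sigma>). graph_of F \<sigma>) (alternating_perms p n m)"
proof (rule inj_onI, clarify)
  fix F \<sigma> G \<tau>
  assume x: "(F, \<sigma>) \<in> alternating_perms p n m" "(G, \<tau>) \<in> alternating_perms p n m"
    and eq: "graph_of F \<sigma> = graph_of G \<tau>"
  note FG = graph_of_eqD[OF eq]
  have "\<sigma> k = \<tau> k" for k
    using FG x by (cases "k \<in> F") (auto simp: alternating_perms_def permutes_not_in)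
  then show "F = G \<and> \<sigma> = \<tau>" using FG(1) by auto
qed

lemma graph_of_paths:
  assumes "(j, F, \<sigma>) \<in> open_paths p n m"
  shows "finite (graph_of F \<sigma>)" "graph_of F \<sigma> \<subseteq> alternating_edges p n" "card (graph_of F \<sigma>) = m"
proof -
  have x: "F \<subseteq> {0..<p + n} - {j}" "card F = m" "\<sigma> permutes insert j F" "\<forall>i\<in>F. (i < p) \<noteq> (\<sigma> i < p)" "j < p + n"
    using assms by (auto simp: open_paths_def alternating_paths_def)
  show "finite (graph_of F \<sigma>)" using finite_subset[OF x(1)] by (simp add: graph_of_def)
  have "\<sigma> k \<in> insert j F" if "k \<in> F" for k using that permutes_in_image[OF x(3)] by simp
  then have "\<sigma> k < p + n" if "k \<in> F" for k using that x(1,5) by fastforce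
  then show "graph_of F \<sigma> \<subseteq> alternating_edges p n"
    using x(1,4) by (auto simp: graph_of_def alternating_edges_def)
  show "card (graph_of F \<sigma>) = m" using x(2) by (simp add: card_graph_of)
qed

text \<open>The edge set does not record \<open>j\<close>, but reveals it: \<open>j\<close> is the
  only vertex that is entered and not left, and \<open>\<sigma> j\<close> the only one that is left
  and not entered, since \<open>\<sigma> j \<noteq> j\<close>.\<close>

lemma inj_graph_of_paths: "inj_on (\<lambda>(j, F, \<sigma>). graph_of F \<sigma>) (open_paths p n m)"
proof (rule inj_onI)
  fix x1 x2 assume x12: "x1 \<in> open_paths p n m" "x2 \<in> open_paths p n m"
    "(\<lambda>(j, F, \<sigma>). graph_of F \<sigma>) x1 = (\<lambda>(j, F, \<sigma>). graph_of F \<sigma>) x2"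
  obtain j F \<sigma> i G \<tau> where x1: "x1 = (j, F, \<sigma>)" and x2: "x2 = (i, G, \<tau>)"
    by (cases x1; cases x2) auto
  have x: "(j, F, \<sigma>) \<in> open_paths p n m" "(i, G, \<tau>) \<in> open_paths p n m"
    and eq: "graph_of F \<sigma> = graph_of G \<tau>"
    using x12 unfolding x1 x2 by auto
  have ends: "\<sigma> ` F - F = {j} \<and> F - \<sigma> ` F = {\<sigma> j}" if "(j, F, \<sigma>) \<in> open_paths p n m" for j F \<sigma>
  proof -
    have p: "\<sigma> permutes insert j F" "j \<notin> F" "\<sigma> j \<noteq> j"
      using that by (auto simp: open_paths_def alternating_paths_def)
    have im: "insert (\<sigma> j) (\<sigma> ` F) = insert j F" using permutes_image[OF p(1)] by simp
    have "\<sigma> j \<notin> \<sigma> ` F" using p(2) permutes_inj[OF p(1)] by (auto dest: injD)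
    with im p(2,3) show ?thesis by (auto simp: set_eq_iff)
  qed
  note FG = graph_of_eqD[OF eq]
  have "\<sigma> ` F = \<tau> ` G" using FG by auto
  then have ji: "j = i" "\<sigma> j = \<tau> j" using ends[OF x(1)] ends[OF x(2)] FG(1) by auto
  have "\<sigma> k = \<tau> k" for k
  proof (cases "k \<in> insert j F")
    case False
    then show ?thesis using x FG(1) ji by (auto simp: open_paths_def alternating_paths_def permutes_not_in)
  qed (use FG(2) ji in auto)
  then show "x1 = x2" using FG(1) ji unfolding x1 x2 by auto
qed

lemma edge_mat_carrier [simp]: "edge_mat p n y \<in> carrier_mat (p + n) (p + n)"
  by (simp add: edge_mat_def)

lemma prod_edge_mat:
  assumes "F \<subseteq> {0..<p + n}" "\<And>k. k \<in> F \<Longrightarrow> \<sigma> k < p + n"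
  shows "(\<Prod>k\<in>F. edge_mat p n y $$ (k, \<sigma> k)) =
    (if \<forall>k\<in>F. (k < p) \<noteq> (\<sigma> k < p) then complex_of_real (\<Prod>e\<in>graph_of F \<sigma>. y e) else 0)"
proof (cases "\<forall>k\<in>F. (k < p) \<noteq> (\<sigma> k < p)")
  case True
  then have "(\<Prod>k\<in>F. edge_mat p n y $$ (k, \<sigma> k)) = (\<Prod>k\<in>F. complex_of_real (y (k, \<sigma> k)))"
    using assms by (intro prod.cong refl) (auto simp: edge_mat_def subset_iff)
  then show ?thesis using True by (simp add: prod_graph_of)
next
  case False
  then obtain k where k: "k \<in> F" "(k < p) = (\<sigma> k < p)" by auto
  have "edge_mat p n y $$ (k, \<sigma> k) = 0" using assms k by (auto simp: edge_mat_def subset_iff)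
  then have "(\<Prod>k\<in>F. edge_mat p n y $$ (k, \<sigma> k)) = 0"
    using k(1) finite_subset[OF assms(1)] by (intro prod_zero) auto
  then show ?thesis using False by (simp only: if_False)
qed

lemma sum_by_card:
  fixes c :: "'b \<Rightarrow> nat"
  assumes "finite S" "\<And>x. x \<in> S \<Longrightarrow> c x \<le> N"
  shows "sum f S = (\<Sum>m\<le>N. sum f {x \<in> S. c x = m})"
  using assms by (intro sum.group[symmetric]) auto

text \<open>Grouping by \<open>card F\<close> yields the powers of z, and a non-alternating step
  meets a zero entry of \<open>edge_mat\<close>. The weight \<open>h\<close> is 1 for the
  determinant and the partial inner product over \<open>F\<close> for
  \<open>cycle_coeff\<close>.\<close>

lemma sum_perms_eq:
  fixes h :: "nat set \<Rightarrow> complex"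
  shows "(\<Sum>F\<in>Pow {0..<p + n}. \<Sum>\<sigma> | \<sigma> permutes F.
      signof \<sigma> * h F * (- z) ^ card F * (\<Prod>i\<in>F. edge_mat p n y $$ (i, \<sigma> i)))
    = (\<Sum>m\<le>p + n. (- z) ^ m * (\<Sum>(F, \<sigma>)\<in>alternating_perms p n m.
        signof \<sigma> * h F * complex_of_real (\<Prod>e\<in>graph_of F \<sigma>. y e)))"
proof -
  let ?S = "SIGMA F:Pow {0..<p + n}. {\<sigma>. \<sigma> permutes F}"
  let ?T = "\<lambda>(F, \<sigma>). signof \<sigma> * h F * (- z) ^ card F * (\<Prod>i\<in>F. edge_mat p n y $$ (i, \<sigma> i))"
  have finV: "finite F" if "F \<in> Pow {0..<p + n}" for F
    using that finite_subset by blast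
  have fin: "finite ?S"
    by (intro finite_SigmaI) (auto intro: finite_permutations finV)
  have cardle: "(card \<circ> fst) x \<le> p + n" if "x \<in> ?S" for x
    using that card_mono[of "{0..<p + n}" "fst x"] by auto
  have "(\<Sum>F\<in>Pow {0..<p + n}. \<Sum>\<sigma> | \<sigma> permutes F.
      signof \<sigma> * h F * (- z) ^ card F * (\<Prod>i\<in>F. edge_mat p n y $$ (i, \<sigma> i))) = sum ?T ?S"
    by (subst sum.Sigma) (auto intro: finite_permutations finV)
  also have "\<dots> = (\<Sum>m\<le>p + n. sum ?T {x \<in> ?S. (card \<circ> fst) x = m})"
    by (rule sum_by_card[OF fin cardle])
  also have "\<dots> = (\<Sum>m\<le>p + n. (- z) ^ m * (\<Sum>(F, \<sigma>)\<in>alternating_perms p n m.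
        signof \<sigma> * h F * complex_of_real (\<Prod>e\<in>graph_of F \<sigma>. y e)))"
  proof (rule sum.cong[OF refl])
    fix m
    have sub: "alternating_perms p n m \<subseteq> {x \<in> ?S. (card \<circ> fst) x = m}"
      by (auto simp: alternating_perms_def)
    have pr: "(\<Prod>i\<in>F. edge_mat p n y $$ (i, \<sigma> i)) =
        (if \<forall>k\<in>F. (k < p) \<noteq> (\<sigma> k < p) then complex_of_real (\<Prod>e\<in>graph_of F \<sigma>. y e) else 0)"
      if "(F, \<sigma>) \<in> ?S" for F \<sigma>
    proof (rule prod_edge_mat)
      show "\<sigma> k < p + n" if "k \<in> F" for k
        using that \<open>(F, \<sigma>) \<in> ?S\<close> by (auto simp: permutes_in_image subset_iff)
    qed (use that in auto)
    have "sum ?T {x \<in> ?S. (card \<circ> fst) x = m} = sum ?T (alternating_perms p n m)"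
    proof (rule sum.mono_neutral_right[OF _ sub])
      show "\<forall>x\<in>{x \<in> ?S. (card \<circ> fst) x = m} - alternating_perms p n m. ?T x = 0"
      proof
        fix x assume x: "x \<in> {x \<in> ?S. (card \<circ> fst) x = m} - alternating_perms p n m"
        obtain F \<sigma> where xF: "x = (F, \<sigma>)" by (cases x)
        have "\<not> (\<forall>k\<in>F. (k < p) \<noteq> (\<sigma> k < p))" using x xF by (auto simp: alternating_perms_def)
        moreover have "(F, \<sigma>) \<in> ?S" using x xF by auto
        ultimately have "(\<Prod>i\<in>F. edge_mat p n y $$ (i, \<sigma> i)) = 0" using pr[of F \<sigma>] by (simp only: if_False)
        then show "?T x = 0" using xF by simp
      qed
    qed (use fin in auto)
    also have "\<dots> = (\<Sum>(F, \<sigma>)\<in>alternating_perms p n m.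
        (- z) ^ m * (signof \<sigma> * h F * complex_of_real (\<Prod>e\<in>graph_of F \<sigma>. y e)))"
    proof (rule sum.cong[OF refl], clarify)
      fix F \<sigma> assume x: "(F, \<sigma>) \<in> alternating_perms p n m"
      then have "(F, \<sigma>) \<in> ?S" and "\<forall>k\<in>F. (k < p) \<noteq> (\<sigma> k < p)" "card F = m"
        by (auto simp: alternating_perms_def)
      then show "signof \<sigma> * h F * (- z) ^ card F * (\<Prod>i\<in>F. edge_mat p n y $$ (i, \<sigma> i))
          = (- z) ^ m * (signof \<sigma> * h F * complex_of_real (\<Prod>e\<in>graph_of F \<sigma>. y e))"
        using pr[of F \<sigma>] by simp
    qed
    finally show "sum ?T {x \<in> ?S. (card \<circ> fst) x = m} = (- z) ^ m * (\<Sum>(F, \<sigma>)\<in>alternating_perms p n m.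
        signof \<sigma> * h F * complex_of_real (\<Prod>e\<in>graph_of F \<sigma>. y e))"
      by (simp add: sum_distrib_left case_prod_unfold)
  qed
  finally show ?thesis .
qed

lemma char_det_edge_mat:
  "char_det (edge_mat p n y) z = (\<Sum>m\<le>p + n. (- z) ^ m * complex_of_real (det_coeff p n y m))"
proof -
  let ?A = "edge_mat p n y"
  have "char_det ?A z = (\<Sum>F\<in>Pow ({0..<p + n} - {}). \<Sum>\<sigma> | \<sigma> permutes ({} \<union> F).
    signof \<sigma> * (\<Prod>i\<in>{}. (1\<^sub>m (dim_row ?A) - z \<cdot>\<^sub>m ?A) $$ (i, \<sigma> i)) * (- z) ^ card F * (\<Prod>i\<in>F. ?A $$ (i, \<sigma> i)))"
    by (rule det_rows_identity_minus) (auto simp: edge_mat_def)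
  also have "\<dots> = (\<Sum>m\<le>p + n. (- z) ^ m * complex_of_real (det_coeff p n y m))"
    using sum_perms_eq[where h = "\<lambda>_. 1" and p = p and n = n and z = z and y = y] unfolding det_coeff_def by (simp add: case_prod_unfold)
  finally show ?thesis .
qed

lemma sum_paths_eq:
  fixes a b :: "nat \<Rightarrow> real"
  shows "(\<Sum>j<p + n. complex_of_real (a j) * (\<Sum>F\<in>Pow ({0..<p + n} - {j}). \<Sum>\<sigma> | \<sigma> permutes insert j F \<and> \<sigma> j \<noteq> j.
      signof \<sigma> * complex_of_real (b (\<sigma> j)) * (- z) ^ card F * (\<Prod>i\<in>F. edge_mat p n y $$ (i, \<sigma> i))))
    = (\<Sum>m\<le>p + n. (- z) ^ m * complex_of_real (path_coeff p n y a b m))"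
proof -
  let ?W = "\<lambda>j. SIGMA F:Pow ({0..<p + n} - {j}). {\<sigma>. \<sigma> permutes insert j F \<and> \<sigma> j \<noteq> j}"
  let ?S = "SIGMA j:{..<p + n}. ?W j"
  let ?T = "\<lambda>(j, F, \<sigma>). complex_of_real (a j) * (signof \<sigma> * complex_of_real (b (\<sigma> j)) * (- z) ^ card F *
      (\<Prod>i\<in>F. edge_mat p n y $$ (i, \<sigma> i)))"
  have finP: "finite {\<sigma>. \<sigma> permutes insert j F \<and> \<sigma> j \<noteq> j}" if "F \<in> Pow ({0..<p + n} - {j})" for j F
  proof -
    have "finite F" using that finite_subset by blast
    then have "finite {\<sigma>. \<sigma> permutes insert j F}" by (simp add: finite_permutations)
    then show ?thesis by (rule rev_finite_subset) auto
  qed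
  have finW: "finite (?W j)" for j
    by (rule finite_SigmaI[OF _ finP]) simp_all
  have fin: "finite ?S"
    by (rule finite_SigmaI[OF _ finW]) simp
  have cardle: "(card \<circ> fst \<circ> snd) x \<le> p + n" if "x \<in> ?S" for x
  proof -
    have "fst (snd x) \<subseteq> {0..<p + n}" using that by auto
    then show ?thesis using card_mono[of "{0..<p + n}" "fst (snd x)"] by simp
  qed
  have "(\<Sum>j<p + n. complex_of_real (a j) * (\<Sum>F\<in>Pow ({0..<p + n} - {j}). \<Sum>\<sigma> | \<sigma> permutes insert j F \<and> \<sigma> j \<noteq> j.
      signof \<sigma> * complex_of_real (b (\<sigma> j)) * (- z) ^ card F * (\<Prod>i\<in>F. edge_mat p n y $$ (i, \<sigma> i))))
      = (\<Sum>j<p + n. \<Sum>x\<in>?W j. ?T (j, x))"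
    unfolding sum_distrib_left
    by (intro sum.cong refl, subst sum.Sigma) (auto intro: finP simp: case_prod_unfold)
  also have "\<dots> = sum ?T ?S"
    by (subst sum.Sigma) (auto intro: finW simp: case_prod_unfold)
  also have "\<dots> = (\<Sum>m\<le>p + n. sum ?T {x \<in> ?S. (card \<circ> fst \<circ> snd) x = m})"
    by (rule sum_by_card[OF fin cardle])
  also have "\<dots> = (\<Sum>m\<le>p + n. (- z) ^ m * complex_of_real (path_coeff p n y a b m))"
  proof (rule sum.cong[OF refl])
    fix m
    have sub: "open_paths p n m \<subseteq> {x \<in> ?S. (card \<circ> fst \<circ> snd) x = m}"
      by (auto simp: open_paths_def alternating_paths_def)
    have pr: "(\<Prod>i\<in>F. edge_mat p n y $$ (i, \<sigma> i)) =
        (if \<forall>k\<in>F. (k < p) \<noteq> (\<sigma> k < p) then complex_of_real (\<Prod>e\<in>graph_of F \<sigma>. y e) else 0)"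
      if x: "(j, F, \<sigma>) \<in> ?S" for j F \<sigma>
    proof (rule prod_edge_mat)
      show "\<sigma> k < p + n" if k: "k \<in> F" for k
      proof -
        have "\<sigma> permutes insert j F" using x by simp
        from permutes_in_image[OF this, of k] have "\<sigma> k \<in> insert j F" using k by simp
        then show ?thesis using x by auto
      qed
    qed (use x in auto)
    have "sum ?T {x \<in> ?S. (card \<circ> fst \<circ> snd) x = m} = sum ?T (open_paths p n m)"
    proof (rule sum.mono_neutral_right[OF _ sub])
      show "\<forall>x\<in>{x \<in> ?S. (card \<circ> fst \<circ> snd) x = m} - open_paths p n m. ?T x = 0"
      proof
        fix x assume x: "x \<in> {x \<in> ?S. (card \<circ> fst \<circ> snd) x = m} - open_paths p n m"
        obtain j F \<sigma> where xF: "x = (j, F, \<sigma>)" by (cases x)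
        have "\<not> (\<forall>k\<in>F. (k < p) \<noteq> (\<sigma> k < p))"
          using x xF by (auto simp: open_paths_def alternating_paths_def)
        moreover have "(j, F, \<sigma>) \<in> ?S" using x xF by auto
        ultimately have "(\<Prod>i\<in>F. edge_mat p n y $$ (i, \<sigma> i)) = 0" using pr[of j F \<sigma>] by (simp only: if_False)
        then show "?T x = 0" using xF by simp
      qed
    qed (use fin in auto)
    also have "\<dots> = (\<Sum>(j, F, \<sigma>)\<in>open_paths p n m.
        (- z) ^ m * (signof \<sigma> * complex_of_real (a j * b (\<sigma> j)) * complex_of_real (\<Prod>e\<in>graph_of F \<sigma>. y e)))"
    proof (rule sum.cong[OF refl], clarify)
      fix j F \<sigma> assume x: "(j, F, \<sigma>) \<in> open_paths p n m"
      then have "(j, F, \<sigma>) \<in> ?S" and "\<forall>k\<in>F. (k < p) \<noteq> (\<sigma> k < p)" "card F = m"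
        by (auto simp: open_paths_def alternating_paths_def)
      then show "complex_of_real (a j) * (signof \<sigma> * complex_of_real (b (\<sigma> j)) * (- z) ^ card F *
            (\<Prod>i\<in>F. edge_mat p n y $$ (i, \<sigma> i)))
          = (- z) ^ m * (signof \<sigma> * complex_of_real (a j * b (\<sigma> j)) * complex_of_real (\<Prod>e\<in>graph_of F \<sigma>. y e))"
        using pr[of j F \<sigma>] by simp
    qed
    also have "\<dots> = (- z) ^ m * complex_of_real (path_coeff p n y a b m)"
      unfolding path_coeff_def by (simp add: sum_distrib_left case_prod_unfold)
    finally show "sum ?T {x \<in> ?S. (card \<circ> fst \<circ> snd) x = m} = (- z) ^ m * complex_of_real (path_coeff p n y a b m)" .
  qed
  finally show ?thesis .
qed

text \<open>The sum over \<open>F\<close> without \<open>j\<close> is the sum over all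
  \<open>F\<close> minus the sum over those containing \<open>j\<close>. The full sum produces the
  inner product times the determinant, the deterministic part of the bilinear form.\<close>

lemma sum_cycles_eq:
  fixes a b :: "nat \<Rightarrow> real"
  shows "(\<Sum>j<p + n. complex_of_real (a j) * (\<Sum>F\<in>Pow ({0..<p + n} - {j}). \<Sum>\<sigma> | \<sigma> permutes F.
      signof \<sigma> * complex_of_real (b j) * (- z) ^ card F * (\<Prod>i\<in>F. edge_mat p n y $$ (i, \<sigma> i))))
    = complex_of_real (\<Sum>j<p + n. a j * b j) * char_det (edge_mat p n y) z
      - (\<Sum>m\<le>p + n. (- z) ^ m * complex_of_real (cycle_coeff p n y a b m))"
proof -
  let ?V = "{0..<p + n}"
  define T where "T F = (\<Sum>\<sigma> | \<sigma> permutes F.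
      signof \<sigma> * (- z) ^ card F * (\<Prod>i\<in>F. edge_mat p n y $$ (i, \<sigma> i)))" for F
  have det: "char_det (edge_mat p n y) z = (\<Sum>F\<in>Pow ?V. T F)"
    unfolding char_det_edge_mat T_def using sum_perms_eq[where h = "\<lambda>_. 1" and p = p and n = n and z = z and y = y]
    by (simp add: det_coeff_def case_prod_unfold)
  have split: "(\<Sum>F\<in>Pow (?V - {j}). T F) = (\<Sum>F\<in>Pow ?V. T F) - (\<Sum>F\<in>Pow ?V. if j \<in> F then T F else 0)" for j
  proof -
    have "(\<Sum>F\<in>Pow ?V. T F) = (\<Sum>F\<in>Pow ?V. (if j \<in> F then 0 else T F) + (if j \<in> F then T F else 0))"
      by (rule sum.cong) auto
    also have "\<dots> = (\<Sum>F\<in>Pow ?V. if j \<in> F then 0 else T F) + (\<Sum>F\<in>Pow ?V. if j \<in> F then T F else 0)"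
      by (rule sum.distrib)
    also have "(\<Sum>F\<in>Pow ?V. if j \<in> F then 0 else T F) = (\<Sum>F\<in>Pow (?V - {j}). T F)"
      by (rule sum.mono_neutral_cong_right) auto
    finally show ?thesis by simp
  qed
  have "(\<Sum>j<p + n. complex_of_real (a j) * (\<Sum>F\<in>Pow (?V - {j}). \<Sum>\<sigma> | \<sigma> permutes F.
      signof \<sigma> * complex_of_real (b j) * (- z) ^ card F * (\<Prod>i\<in>F. edge_mat p n y $$ (i, \<sigma> i))))
      = (\<Sum>j<p + n. complex_of_real (a j * b j) * (\<Sum>F\<in>Pow (?V - {j}). T F))"
    unfolding T_def by (simp add: sum_distrib_left mult_ac)
  also have "\<dots> = complex_of_real (\<Sum>j<p + n. a j * b j) * (\<Sum>F\<in>Pow ?V. T F)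
      - (\<Sum>j<p + n. complex_of_real (a j * b j) * (\<Sum>F\<in>Pow ?V. if j \<in> F then T F else 0))"
    unfolding split by (simp add: right_diff_distrib sum_subtractf sum_distrib_right)
  also have "(\<Sum>j<p + n. complex_of_real (a j * b j) * (\<Sum>F\<in>Pow ?V. if j \<in> F then T F else 0))
      = (\<Sum>F\<in>Pow ?V. \<Sum>j<p + n. complex_of_real (a j * b j) * (if j \<in> F then T F else 0))"
    unfolding sum_distrib_left by (rule sum.swap)
  also have "\<dots> = (\<Sum>F\<in>Pow ?V. complex_of_real (\<Sum>j\<in>F. a j * b j) * T F)"
  proof (rule sum.cong[OF refl])
    fix F assume F: "F \<in> Pow ?V"
    have "(\<Sum>j<p + n. complex_of_real (a j * b j) * (if j \<in> F then T F else 0))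
        = (\<Sum>j\<in>F. complex_of_real (a j * b j) * T F)"
      by (rule sum.mono_neutral_cong_right) (use F in auto)
    then show "(\<Sum>j<p + n. complex_of_real (a j * b j) * (if j \<in> F then T F else 0))
        = complex_of_real (\<Sum>j\<in>F. a j * b j) * T F"
      by (simp add: sum_distrib_right)
  qed
  also have "\<dots> = (\<Sum>F\<in>Pow ?V. \<Sum>\<sigma> | \<sigma> permutes F. signof \<sigma> * complex_of_real (\<Sum>j\<in>F. a j * b j) *
      (- z) ^ card F * (\<Prod>i\<in>F. edge_mat p n y $$ (i, \<sigma> i)))"
    unfolding T_def sum_distrib_left[of "complex_of_real _"] by (intro sum.cong refl) (simp only: mult_ac)
  also have "\<dots> = (\<Sum>m\<le>p + n. (- z) ^ m * complex_of_real (cycle_coeff p n y a b m))"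
    unfolding sum_perms_eq[where h = "\<lambda>F. complex_of_real (\<Sum>j\<in>F. a j * b j)"] cycle_coeff_def
    by (simp add: case_prod_unfold)
  finally show ?thesis unfolding det .
qed

text \<open>By \<open>det_replace_row\<close> the form is a sum over \<open>j\<close> of
  determinants with row \<open>j\<close> replaced by \<open>b\<close>; splitting at whether
  \<open>\<sigma> j = j\<close> leads to \<open>sum_cycles_eq\<close> and
  \<open>sum_paths_eq\<close>.\<close>

lemma bilinear_adj_edge_mat:
  fixes a b :: "nat \<Rightarrow> real" and p n :: nat and z :: complex and y :: "nat \<times> nat \<Rightarrow> real"
  defines "N \<equiv> p + n"
  defines "M \<equiv> 1\<^sub>m N - z \<cdot>\<^sub>m edge_mat p n y"
  shows "(\<Sum>i<N. \<Sum>j<N. complex_of_real (b i) * adj_mat M $$ (i, j) * complex_of_real (a j))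
    = complex_of_real (\<Sum>j<N. a j * b j) * char_det (edge_mat p n y) z
      + (\<Sum>m\<le>N. (- z) ^ m * complex_of_real (path_coeff p n y a b m - cycle_coeff p n y a b m))"
proof -
  let ?A = "edge_mat p n y" and ?V = "{0..<N}"
  have M: "M \<in> carrier_mat N N"
    unfolding M_def N_def by (intro minus_carrier_mat smult_carrier_mat) simp
  have row: "det (replace_row M j (\<lambda>l. complex_of_real (b l)))
      = (\<Sum>F\<in>Pow (?V - {j}). \<Sum>\<sigma> | \<sigma> permutes F.
          signof \<sigma> * complex_of_real (b j) * (- z) ^ card F * (\<Prod>i\<in>F. ?A $$ (i, \<sigma> i)))
      + (\<Sum>F\<in>Pow (?V - {j}). \<Sum>\<sigma> | \<sigma> permutes insert j F \<and> \<sigma> j \<noteq> j.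
          signof \<sigma> * complex_of_real (b (\<sigma> j)) * (- z) ^ card F * (\<Prod>i\<in>F. ?A $$ (i, \<sigma> i)))"
    if j: "j < N" for j
  proof -
    let ?R = "replace_row M j (\<lambda>l. complex_of_real (b l))"
    have R: "?R \<in> carrier_mat N N" using M by (auto simp: replace_row_def)
    have "det ?R = (\<Sum>F\<in>Pow (?V - {j}). \<Sum>\<sigma> | \<sigma> permutes ({j} \<union> F).
        signof \<sigma> * (\<Prod>i\<in>{j}. ?R $$ (i, \<sigma> i)) * (- z) ^ card F * (\<Prod>i\<in>F. ?A $$ (i, \<sigma> i)))"
      by (rule det_rows_identity_minus[OF R]) (use j in \<open>auto simp: replace_row_def M_def N_def edge_mat_def\<close>)
    also have "\<dots> = (\<Sum>F\<in>Pow (?V - {j}). (\<Sum>\<sigma> | \<sigma> permutes F.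
          signof \<sigma> * complex_of_real (b j) * (- z) ^ card F * (\<Prod>i\<in>F. ?A $$ (i, \<sigma> i)))
        + (\<Sum>\<sigma> | \<sigma> permutes insert j F \<and> \<sigma> j \<noteq> j.
          signof \<sigma> * complex_of_real (b (\<sigma> j)) * (- z) ^ card F * (\<Prod>i\<in>F. ?A $$ (i, \<sigma> i))))"
    proof (rule sum.cong[OF refl])
      fix F assume F: "F \<in> Pow (?V - {j})"
      then have finF: "finite F" and jF: "j \<notin> F" using finite_subset by auto
      let ?f = "\<lambda>\<sigma>. signof \<sigma> * complex_of_real (b (\<sigma> j)) * (- z) ^ card F * (\<Prod>i\<in>F. ?A $$ (i, \<sigma> i))"
      have fix_eq: "{\<sigma>. \<sigma> permutes insert j F \<and> \<sigma> j = j} = {\<sigma>. \<sigma> permutes F}"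
      proof (intro equalityI subsetI CollectI)
        fix \<sigma> assume \<sigma>: "\<sigma> \<in> {\<sigma>. \<sigma> permutes insert j F \<and> \<sigma> j = j}"
        show "\<sigma> permutes F" by (rule permutes_superset[of \<sigma> "insert j F"]) (use \<sigma> in auto)
      next
        fix \<sigma> assume "\<sigma> \<in> {\<sigma>. \<sigma> permutes F}"
        then have \<sigma>: "\<sigma> permutes F" by simp
        show "\<sigma> permutes insert j F \<and> \<sigma> j = j"
          using permutes_subset[OF \<sigma>, of "insert j F"] permutes_not_in[OF \<sigma> jF] by auto
      qed
      have fin: "finite {\<sigma>. \<sigma> permutes insert j F}" using finF by (simp add: finite_permutations)
      have "(\<Sum>\<sigma> | \<sigma> permutes ({j} \<union> F). signof \<sigma> * (\<Prod>i\<in>{j}. ?R $$ (i, \<sigma> i)) * (- z) ^ card F * (\<Prod>i\<in>F. ?A $$ (i, \<sigma> i)))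
          = (\<Sum>\<sigma> | \<sigma> permutes insert j F. ?f \<sigma>)"
      proof (rule sum.cong)
        fix \<sigma> assume "\<sigma> \<in> {\<sigma>. \<sigma> permutes insert j F}"
        then have "\<sigma> permutes insert j F" by simp
        from permutes_in_image[OF this, of j] have "\<sigma> j \<in> insert j F" by simp
        then have "\<sigma> j < N" using F j by auto
        then show "signof \<sigma> * (\<Prod>i\<in>{j}. ?R $$ (i, \<sigma> i)) * (- z) ^ card F * (\<Prod>i\<in>F. ?A $$ (i, \<sigma> i)) = ?f \<sigma>"
          using j M by (simp add: replace_row_def)
      qed simp
      also have "{\<sigma>. \<sigma> permutes insert j F}
          = {\<sigma>. \<sigma> permutes insert j F \<and> \<sigma> j = j} \<union> {\<sigma>. \<sigma> permutes insert j F \<and> \<sigma> j \<noteq> j}" by auto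
      also have "sum ?f \<dots> = sum ?f {\<sigma>. \<sigma> permutes insert j F \<and> \<sigma> j = j} + sum ?f {\<sigma>. \<sigma> permutes insert j F \<and> \<sigma> j \<noteq> j}"
        by (rule sum.union_disjoint) (auto intro: rev_finite_subset[OF fin])
      also have "sum ?f {\<sigma>. \<sigma> permutes insert j F \<and> \<sigma> j = j} = (\<Sum>\<sigma> | \<sigma> permutes F.
          signof \<sigma> * complex_of_real (b j) * (- z) ^ card F * (\<Prod>i\<in>F. ?A $$ (i, \<sigma> i)))"
        unfolding fix_eq by (rule sum.cong) (auto simp: permutes_not_in[OF _ jF])
      finally show "(\<Sum>\<sigma> | \<sigma> permutes ({j} \<union> F). signof \<sigma> * (\<Prod>i\<in>{j}. ?R $$ (i, \<sigma> i)) * (- z) ^ card F * (\<Prod>i\<in>F. ?A $$ (i, \<sigma> i)))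
        = (\<Sum>\<sigma> | \<sigma> permutes F.
          signof \<sigma> * complex_of_real (b j) * (- z) ^ card F * (\<Prod>i\<in>F. ?A $$ (i, \<sigma> i)))
        + (\<Sum>\<sigma> | \<sigma> permutes insert j F \<and> \<sigma> j \<noteq> j. ?f \<sigma>)" .
    qed
    finally show ?thesis by (simp only: sum.distrib)
  qed
  have "(\<Sum>i<N. \<Sum>j<N. complex_of_real (b i) * adj_mat M $$ (i, j) * complex_of_real (a j))
      = (\<Sum>j<N. complex_of_real (a j) * (\<Sum>i<N. complex_of_real (b i) * adj_mat M $$ (i, j)))"
    unfolding sum_distrib_left by (subst sum.swap) (simp add: mult_ac)
  also have "\<dots> = (\<Sum>j<N. complex_of_real (a j) * det (replace_row M j (\<lambda>l. complex_of_real (b l))))"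
    by (intro sum.cong refl) (simp add: det_replace_row[OF M])
  also have "\<dots> = (\<Sum>j<N. complex_of_real (a j) * (\<Sum>F\<in>Pow (?V - {j}). \<Sum>\<sigma> | \<sigma> permutes F.
          signof \<sigma> * complex_of_real (b j) * (- z) ^ card F * (\<Prod>i\<in>F. ?A $$ (i, \<sigma> i))))
      + (\<Sum>j<N. complex_of_real (a j) * (\<Sum>F\<in>Pow (?V - {j}). \<Sum>\<sigma> | \<sigma> permutes insert j F \<and> \<sigma> j \<noteq> j.
          signof \<sigma> * complex_of_real (b (\<sigma> j)) * (- z) ^ card F * (\<Prod>i\<in>F. ?A $$ (i, \<sigma> i))))"
    unfolding sum.distrib[symmetric] by (intro sum.cong refl) (simp add: row distrib_left)
  also have "\<dots> = complex_of_real (\<Sum>j<N. a j * b j) * char_det ?A z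
      + (\<Sum>m\<le>N. (- z) ^ m * complex_of_real (path_coeff p n y a b m - cycle_coeff p n y a b m))"
    unfolding N_def sum_paths_eq sum_cycles_eq
    by (simp add: sum_subtractf right_diff_distrib)
  finally show ?thesis .
qed

context prob_space
begin

lemma det_coeff_second_moment:
  fixes \<xi> :: "nat \<times> nat \<Rightarrow> 'a \<Rightarrow> real" and g :: "real \<Rightarrow> real"
  assumes indep: "indep_vars (\<lambda>_. borel) \<xi> (alternating_edges p n)" and gm: "g \<in> borel_measurable borel"
    and g: "\<And>e. e \<in> alternating_edges p n \<Longrightarrow> integrable M (\<lambda>\<omega>. (g (\<xi> e \<omega>))\<^sup>2)"
      "\<And>e. e \<in> alternating_edges p n \<Longrightarrow> expectation (\<lambda>\<omega>. g (\<xi> e \<omega>)) = 0"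
      "\<And>e. e \<in> alternating_edges p n \<Longrightarrow> expectation (\<lambda>\<omega>. (g (\<xi> e \<omega>))\<^sup>2) = \<tau>"
    and \<tau>: "0 \<le> \<tau>" "\<tau> \<le> 1 / real n"
    and n: "0 < n" "0 < \<kappa>" "real p \<le> \<kappa>\<^sup>2 * real n"
  shows "integrable M (\<lambda>\<omega>. (det_coeff p n (\<lambda>e. g (\<xi> e \<omega>)) m)\<^sup>2)"
    and "expectation (\<lambda>\<omega>. (det_coeff p n (\<lambda>e. g (\<xi> e \<omega>)) m)\<^sup>2) \<le> \<kappa> ^ m"
proof -
  let ?I = "alternating_perms p n m"
  have fam: "finite ((\<lambda>(F, \<sigma>). graph_of F \<sigma>) i) \<and> (\<lambda>(F, \<sigma>). graph_of F \<sigma>) i \<subseteq> alternating_edges p n" if "i \<in> ?I" for i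
    using that graph_of_perms by (cases i) auto
  note sm = second_moment_multiaffine[OF indep gm g finite_alternating_perms inj_graph_of_perms fam,
      where c = "\<lambda>(F, \<sigma>). signof \<sigma>"]
  have eq: "det_coeff p n (\<lambda>e. g (\<xi> e \<omega>)) m = (\<Sum>i\<in>?I. (case i of (F, \<sigma>) \<Rightarrow> signof \<sigma>) *
      (\<Prod>e\<in>(case i of (F, \<sigma>) \<Rightarrow> graph_of F \<sigma>). g (\<xi> e \<omega>)))" for \<omega>
    unfolding det_coeff_def by (simp add: case_prod_unfold)
  show "integrable M (\<lambda>\<omega>. (det_coeff p n (\<lambda>e. g (\<xi> e \<omega>)) m)\<^sup>2)"
    unfolding eq by (rule sm(1))
  have "expectation (\<lambda>\<omega>. (det_coeff p n (\<lambda>e. g (\<xi> e \<omega>)) m)\<^sup>2)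
      = (\<Sum>i\<in>?I. (case i of (F, \<sigma>) \<Rightarrow> signof \<sigma>)\<^sup>2 * \<tau> ^ card (case i of (F, \<sigma>) \<Rightarrow> graph_of F \<sigma>))"
    unfolding eq by (rule sm(2))
  also have "\<dots> = (\<Sum>i\<in>?I. \<tau> ^ m)"
    by (rule sum.cong[OF refl]) (auto simp: graph_of_perms(3) sign_def split: prod.splits)
  also have "\<dots> \<le> (\<Sum>i\<in>?I. (1 / real n) ^ m)"
    by (intro sum_mono power_mono \<tau>)
  also have "\<dots> \<le> \<kappa> ^ m"
    using alternating_perms_weight[OF n] by simp
  finally show "expectation (\<lambda>\<omega>. (det_coeff p n (\<lambda>e. g (\<xi> e \<omega>)) m)\<^sup>2) \<le> \<kappa> ^ m" .
qed

lemma det_coeff_diff_second_moment: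
  fixes \<xi> :: "nat \<times> nat \<Rightarrow> 'a \<Rightarrow> real" and g :: "real \<Rightarrow> real"
  assumes indep: "indep_vars (\<lambda>_. borel) \<xi> (alternating_edges p n)" and gm: "g \<in> borel_measurable borel"
    and g: "\<And>e. e \<in> alternating_edges p n \<Longrightarrow> integrable M (\<lambda>\<omega>. (g (\<xi> e \<omega>))\<^sup>2)"
      "\<And>e. e \<in> alternating_edges p n \<Longrightarrow> expectation (\<lambda>\<omega>. g (\<xi> e \<omega>)) = 0"
      "\<And>e. e \<in> alternating_edges p n \<Longrightarrow> expectation (\<lambda>\<omega>. (g (\<xi> e \<omega>))\<^sup>2) = \<tau> / real n"
    and x: "\<And>e. e \<in> alternating_edges p n \<Longrightarrow> integrable M (\<lambda>\<omega>. (\<xi> e \<omega>)\<^sup>2)"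
      "\<And>e. e \<in> alternating_edges p n \<Longrightarrow> expectation (\<lambda>\<omega>. \<xi> e \<omega>) = 0"
      "\<And>e. e \<in> alternating_edges p n \<Longrightarrow> expectation (\<lambda>\<omega>. (\<xi> e \<omega>)\<^sup>2) = 1 / real n"
    and xg: "\<And>e. e \<in> alternating_edges p n \<Longrightarrow> expectation (\<lambda>\<omega>. \<xi> e \<omega> * g (\<xi> e \<omega>)) = \<theta> / real n"
    and \<tau>: "0 \<le> \<tau>" "\<tau> \<le> \<theta>" "\<theta> \<le> 1"
    and n: "0 < n" "0 < \<kappa>" "real p \<le> \<kappa>\<^sup>2 * real n"
  shows "integrable M (\<lambda>\<omega>. (det_coeff p n (\<lambda>e. \<xi> e \<omega>) m - det_coeff p n (\<lambda>e. g (\<xi> e \<omega>)) m)\<^sup>2)"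
    and "expectation (\<lambda>\<omega>. (det_coeff p n (\<lambda>e. \<xi> e \<omega>) m - det_coeff p n (\<lambda>e. g (\<xi> e \<omega>)) m)\<^sup>2)
      \<le> real m * (1 - \<theta>) * \<kappa> ^ m"
proof -
  let ?I = "alternating_perms p n m"
  let ?G = "\<lambda>(F, \<sigma>). graph_of F \<sigma>"
  have fam: "finite (?G i) \<and> ?G i \<subseteq> alternating_edges p n" if "i \<in> ?I" for i
    using that graph_of_perms by (cases i) auto
  note sm = second_moment_multiaffine_diff[OF indep gm g x xg finite_alternating_perms inj_graph_of_perms fam,
      where c = "\<lambda>(F, \<sigma>). signof \<sigma>"]
  have eq: "det_coeff p n (\<lambda>e. \<xi> e \<omega>) m - det_coeff p n (\<lambda>e. g (\<xi> e \<omega>)) m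
      = (\<Sum>i\<in>?I. (case i of (F, \<sigma>) \<Rightarrow> signof \<sigma>) * ((\<Prod>e\<in>?G i. \<xi> e \<omega>) - (\<Prod>e\<in>?G i. g (\<xi> e \<omega>))))" for \<omega>
    unfolding det_coeff_def by (simp add: case_prod_unfold sum_subtractf right_diff_distrib)
  show "integrable M (\<lambda>\<omega>. (det_coeff p n (\<lambda>e. \<xi> e \<omega>) m - det_coeff p n (\<lambda>e. g (\<xi> e \<omega>)) m)\<^sup>2)"
    unfolding eq by (rule sm(1))
  \<comment> \<open>As \<open>\<tau> \<le> \<theta>\<close>, the quantity 1 - 2
    \<open>\<theta> ^ m\<close> + \<open>\<tau> ^ m\<close> is at most 1 -
    \<open>\<theta> ^ m\<close>, which Bernoulli makes linear in \<open>1 - \<theta>\<close>. That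
    is small for a high truncation level, whatever n is.\<close>
  have "1 + real m * (\<theta> - 1) \<le> (1 + (\<theta> - 1)) ^ m"
    using \<tau> by (intro Bernoulli_inequality) simp
  then have bern: "1 - \<theta> ^ m \<le> real m * (1 - \<theta>)" by (simp add: algebra_simps)
  have "\<tau> ^ m \<le> \<theta> ^ m" using \<tau> by (intro power_mono) auto
  then have le: "1 - 2 * \<theta> ^ m + \<tau> ^ m \<le> real m * (1 - \<theta>)" using bern by linarith
  have "expectation (\<lambda>\<omega>. (det_coeff p n (\<lambda>e. \<xi> e \<omega>) m - det_coeff p n (\<lambda>e. g (\<xi> e \<omega>)) m)\<^sup>2)
      = (\<Sum>i\<in>?I. (case i of (F, \<sigma>) \<Rightarrow> signof \<sigma>)\<^sup>2 *
          ((1 / real n) ^ card (?G i) - 2 * (\<theta> / real n) ^ card (?G i) + (\<tau> / real n) ^ card (?G i)))"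
    unfolding eq by (rule sm(2))
  also have "\<dots> = (\<Sum>i\<in>?I. (1 - 2 * \<theta> ^ m + \<tau> ^ m) * (1 / real n) ^ m)"
    by (rule sum.cong[OF refl])
      (auto simp: graph_of_perms(3) sign_def power_divide diff_divide_distrib add_divide_distrib split: prod.splits)
  also have "\<dots> = (1 - 2 * \<theta> ^ m + \<tau> ^ m) * (real (card ?I) * (1 / real n) ^ m)"
    by simp
  also have "\<dots> \<le> (real m * (1 - \<theta>)) * \<kappa> ^ m"
    using le alternating_perms_weight[OF n, of m] \<tau> by (intro mult_mono) auto
  finally show "expectation (\<lambda>\<omega>. (det_coeff p n (\<lambda>e. \<xi> e \<omega>) m - det_coeff p n (\<lambda>e. g (\<xi> e \<omega>)) m)\<^sup>2)
      \<le> real m * (1 - \<theta>) * \<kappa> ^ m" .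
qed

text \<open>Unlike in \<open>det_coeff\<close>, the vectors tie the weight of a monomial to one or
  two given vertices. The count through given vertices is smaller by a factor of order n, so the
  forms concentrate at their deterministic part.\<close>

lemma bilinear_coeff_second_moment:
  fixes \<xi> :: "nat \<times> nat \<Rightarrow> 'a \<Rightarrow> real" and a b :: "nat \<Rightarrow> real"
  assumes indep: "indep_vars (\<lambda>_. borel) \<xi> (alternating_edges p n)"
    and x: "\<And>e. e \<in> alternating_edges p n \<Longrightarrow> integrable M (\<lambda>\<omega>. (\<xi> e \<omega>)\<^sup>2)"
      "\<And>e. e \<in> alternating_edges p n \<Longrightarrow> expectation (\<lambda>\<omega>. \<xi> e \<omega>) = 0"
      "\<And>e. e \<in> alternating_edges p n \<Longrightarrow> expectation (\<lambda>\<omega>. (\<xi> e \<omega>)\<^sup>2) = 1 / real n"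
    and n: "0 < n" "0 < \<kappa>" "real p \<le> \<kappa>\<^sup>2 * real n"
  defines "c \<equiv> \<lambda>m \<omega>. path_coeff p n (\<lambda>e. \<xi> e \<omega>) a b m - cycle_coeff p n (\<lambda>e. \<xi> e \<omega>) a b m"
  shows "integrable M (\<lambda>\<omega>. (c m \<omega>)\<^sup>2)"
    and "expectation (\<lambda>\<omega>. (c m \<omega>)\<^sup>2) \<le>
      2 * (real m + 1) ^ 3 * \<kappa> ^ m * (1 + 1 / \<kappa>)\<^sup>2 / real n * ((\<Sum>j<p + n. (a j)\<^sup>2) * (\<Sum>j<p + n. (b j)\<^sup>2))"
proof -
  let ?I = "alternating_perms p n m" and ?R = "open_paths p n m" and ?N = "p + n"
  let ?G = "\<lambda>(F, \<sigma>). graph_of F \<sigma>" and ?H = "\<lambda>(j, F, \<sigma>). graph_of F \<sigma>"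
  define w where "w = (real m + 1)\<^sup>2 * \<kappa> ^ m * (1 + 1 / \<kappa>)\<^sup>2 / real n"
  define AB where "AB = (\<Sum>j<?N. (a j)\<^sup>2) * (\<Sum>j<?N. (b j)\<^sup>2)"
  have w0: "0 \<le> w" unfolding w_def using n by simp
  have famG: "finite (?G i) \<and> ?G i \<subseteq> alternating_edges p n" if "i \<in> ?I" for i
    using that graph_of_perms by (cases i) auto
  have famH: "finite (?H i) \<and> ?H i \<subseteq> alternating_edges p n" if "i \<in> ?R" for i
    using that graph_of_paths by (cases i) auto
  note smG = second_moment_multiaffine[OF indep measurable_ident_sets[OF refl] x finite_alternating_perms inj_graph_of_perms famG,
      where c = "\<lambda>(F, \<sigma>). signof \<sigma> * (\<Sum>j\<in>F. a j * b j)"]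
  note smH = second_moment_multiaffine[OF indep measurable_ident_sets[OF refl] x finite_open_paths inj_graph_of_paths famH,
      where c = "\<lambda>(j, F, \<sigma>). signof \<sigma> * (a j * b (\<sigma> j))"]
  have eqG: "cycle_coeff p n (\<lambda>e. \<xi> e \<omega>) a b m = (\<Sum>i\<in>?I. (case i of (F, \<sigma>) \<Rightarrow> signof \<sigma> * (\<Sum>j\<in>F. a j * b j)) *
      (\<Prod>e\<in>?G i. \<xi> e \<omega>))" for \<omega>
    unfolding cycle_coeff_def by (simp add: case_prod_unfold)
  have eqH: "path_coeff p n (\<lambda>e. \<xi> e \<omega>) a b m = (\<Sum>i\<in>?R. (case i of (j, F, \<sigma>) \<Rightarrow> signof \<sigma> * (a j * b (\<sigma> j))) *
      (\<Prod>e\<in>?H i. \<xi> e \<omega>))" for \<omega>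
    unfolding path_coeff_def by (simp add: case_prod_unfold)
  have intG: "integrable M (\<lambda>\<omega>. (cycle_coeff p n (\<lambda>e. \<xi> e \<omega>) a b m)\<^sup>2)"
    unfolding eqG by (rule smG(1))
  have intH: "integrable M (\<lambda>\<omega>. (path_coeff p n (\<lambda>e. \<xi> e \<omega>) a b m)\<^sup>2)"
    unfolding eqH by (rule smH(1))
  have AB1: "(\<Sum>j<?N. (a j * b j)\<^sup>2) \<le> AB"
  proof -
    have "(a j * b j)\<^sup>2 \<le> (a j)\<^sup>2 * (\<Sum>j<?N. (b j)\<^sup>2)" if "j \<in> {..<?N}" for j
      unfolding power_mult_distrib using that by (intro mult_left_mono member_le_sum) auto
    then have "(\<Sum>j<?N. (a j * b j)\<^sup>2) \<le> (\<Sum>j<?N. (a j)\<^sup>2 * (\<Sum>j<?N. (b j)\<^sup>2))"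
      by (rule sum_mono)
    then show ?thesis by (simp add: AB_def sum_distrib_right)
  qed
  have EG: "expectation (\<lambda>\<omega>. (cycle_coeff p n (\<lambda>e. \<xi> e \<omega>) a b m)\<^sup>2) \<le> real m * (w * AB)"
  proof -
    have "expectation (\<lambda>\<omega>. (cycle_coeff p n (\<lambda>e. \<xi> e \<omega>) a b m)\<^sup>2)
        = (\<Sum>i\<in>?I. (case i of (F, \<sigma>) \<Rightarrow> signof \<sigma> * (\<Sum>j\<in>F. a j * b j))\<^sup>2 * (1 / real n) ^ card (?G i))"
      unfolding eqG by (rule smG(2))
    also have "\<dots> = (\<Sum>i\<in>?I. (\<Sum>j\<in>fst i. a j * b j)\<^sup>2 * (1 / real n) ^ m)"
      by (rule sum.cong[OF refl]) (auto simp: graph_of_perms(3) sign_def split: prod.splits)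
    \<comment> \<open>Cauchy-Schwarz over the \<open>m\<close> vertices of \<open>F\<close>.
      Exchanging the sums then leaves, for each \<open>j\<close>, the number of permutations through
      \<open>j\<close>, which brings the factor 1 / n.\<close>
    also have "\<dots> \<le> (\<Sum>i\<in>?I. (\<Sum>j<?N. if j \<in> fst i then (a j * b j)\<^sup>2 else 0) * real m * (1 / real n) ^ m)"
    proof (intro sum_mono mult_right_mono)
      fix i assume i: "i \<in> ?I"
      then have F: "fst i \<subseteq> {..<?N}" "card (fst i) = m" by (auto simp: alternating_perms_def)
      have "(\<Sum>j\<in>fst i. a j * b j)\<^sup>2 \<le> (\<Sum>j\<in>fst i. (a j * b j)\<^sup>2) * real m"
        using sum_squared_le_sum_of_squares[of "\<lambda>j. a j * b j" "fst i"] F(2) by simp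
      also have "(\<Sum>j\<in>fst i. (a j * b j)\<^sup>2) = (\<Sum>j<?N. if j \<in> fst i then (a j * b j)\<^sup>2 else 0)"
        by (rule sum.mono_neutral_cong_left) (use F in auto)
      finally show "(\<Sum>j\<in>fst i. a j * b j)\<^sup>2 \<le> (\<Sum>j<?N. if j \<in> fst i then (a j * b j)\<^sup>2 else 0) * real m" .
    qed simp
    also have "\<dots> = real m * (\<Sum>i\<in>?I. \<Sum>j<?N. if j \<in> fst i then (a j * b j)\<^sup>2 * (1 / real n) ^ m else 0)"
      by (simp add: sum_distrib_left sum_distrib_right if_distrib if_distribR mult_ac cong: if_cong)
    finally have E1: "expectation (\<lambda>\<omega>. (cycle_coeff p n (\<lambda>e. \<xi> e \<omega>) a b m)\<^sup>2)
        \<le> real m * (\<Sum>i\<in>?I. \<Sum>j<?N. if j \<in> fst i then (a j * b j)\<^sup>2 * (1 / real n) ^ m else 0)" .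
    have "(\<Sum>i\<in>?I. \<Sum>j<?N. if j \<in> fst i then (a j * b j)\<^sup>2 * (1 / real n) ^ m else 0)
        = (\<Sum>j<?N. \<Sum>i\<in>?I. if j \<in> fst i then (a j * b j)\<^sup>2 * (1 / real n) ^ m else 0)"
      by (rule sum.swap)
    also have "\<dots> = (\<Sum>j<?N. (a j * b j)\<^sup>2 * (real (card {i \<in> ?I. j \<in> fst i}) * (1 / real n) ^ m))"
      by (rule sum.cong[OF refl]) (simp add: sum.inter_filter[symmetric] finite_alternating_perms)
    also have "\<dots> \<le> (\<Sum>j<?N. (a j * b j)\<^sup>2 * w)"
      using alternating_perms_weight_at[OF n] unfolding w_def by (intro sum_mono mult_left_mono) auto
    also have "\<dots> \<le> AB * w"
      unfolding sum_distrib_right[symmetric] using AB1 w0 by (rule mult_right_mono)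
    finally show ?thesis
      using order_trans[OF E1 mult_left_mono] by (simp only: mult.commute[of w] of_nat_0_le_iff)
  qed
  have EH: "expectation (\<lambda>\<omega>. (path_coeff p n (\<lambda>e. \<xi> e \<omega>) a b m)\<^sup>2) \<le> w * AB"
  proof -
    let ?P = "\<lambda>j i. alternating_paths p n m j i"
    let ?f = "\<lambda>(j, F, \<sigma>). (a j * b (\<sigma> j))\<^sup>2 * (1 / real n) ^ m"
    have "expectation (\<lambda>\<omega>. (path_coeff p n (\<lambda>e. \<xi> e \<omega>) a b m)\<^sup>2)
        = (\<Sum>i\<in>?R. (case i of (j, F, \<sigma>) \<Rightarrow> signof \<sigma> * (a j * b (\<sigma> j)))\<^sup>2 * (1 / real n) ^ card (?H i))"
      unfolding eqH by (rule smH(2))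
    also have "\<dots> = sum ?f ?R"
      by (rule sum.cong[OF refl]) (auto simp: graph_of_paths(3) sign_def split: prod.splits)
    \<comment> \<open>Grouping the open paths by their two ends separates the vector entries from
      the count; the squared entries then sum to the product of the squared norms.\<close>
    also have "\<dots> = (\<Sum>(j, i)\<in>{..<?N} \<times> {..<?N}. sum ?f {x \<in> ?R. (\<lambda>(j, F, \<sigma>). (j, \<sigma> j)) x = (j, i)})"
    proof -
      have "(\<lambda>(j, F, \<sigma>). (j, \<sigma> j)) ` ?R \<subseteq> {..<?N} \<times> {..<?N}"
      proof (rule image_subsetI, clarify)
        fix j F \<sigma> assume "(j, F, \<sigma>) \<in> ?R"
        then have x: "j < ?N" "\<sigma> permutes insert j F" "F \<subseteq> {0..<?N} - {j}"
          by (auto simp: open_paths_def alternating_paths_def)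
        have "\<sigma> permutes insert j F" by (rule x(2))
        from permutes_in_image[OF this, of j] have "\<sigma> j \<in> insert j F" by simp
        then have "\<sigma> j < ?N" using x by auto
        then show "j \<in> {..<?N} \<and> \<sigma> j \<in> {..<?N}" using x by simp
      qed
      from sum.group[OF finite_open_paths _ this, of ?f]
      have "sum ?f ?R = (\<Sum>y\<in>{..<?N} \<times> {..<?N}. sum ?f {x \<in> ?R. (\<lambda>(j, F, \<sigma>). (j, \<sigma> j)) x = y})"
        by (rule sym) simp
      also have "\<dots> = (\<Sum>(j, i)\<in>{..<?N} \<times> {..<?N}. sum ?f {x \<in> ?R. (\<lambda>(j, F, \<sigma>). (j, \<sigma> j)) x = (j, i)})"
        by (rule sum.cong) auto
      finally show ?thesis .
    qed
    also have "\<dots> \<le> (\<Sum>(j, i)\<in>{..<?N} \<times> {..<?N}. (a j)\<^sup>2 * (b i)\<^sup>2 * w)"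
    proof (rule sum_mono)
      fix y assume y: "y \<in> {..<?N} \<times> {..<?N}"
      obtain j i where yji: "y = (j, i)" by (cases y)
      then have ji: "j \<in> {..<?N}" "i \<in> {..<?N}" using y by auto
      let ?X = "{x \<in> ?R. (\<lambda>(j, F, \<sigma>). (j, \<sigma> j)) x = (j, i)}"
      have "sum ?f ?X = (\<Sum>x\<in>?X. (a j * b i)\<^sup>2 * (1 / real n) ^ m)"
        by (rule sum.cong) auto
      also have "\<dots> = (a j)\<^sup>2 * (b i)\<^sup>2 * (real (card ?X) * (1 / real n) ^ m)"
        by (simp add: power_mult_distrib)
      also have "\<dots> \<le> (a j)\<^sup>2 * (b i)\<^sup>2 * w"
      proof (intro mult_left_mono)
        show "real (card ?X) * (1 / real n) ^ m \<le> w"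
        proof (cases "i = j")
          case True
          then have "?X = {}" by (auto simp: open_paths_def)
          then have "card ?X = 0" by (simp only: card.empty)
          then show ?thesis using w0 by simp
        next
          case False
          have "card ?X \<le> card (?P j i)"
          proof (rule card_inj_on_le)
            show "inj_on snd ?X" by (auto simp: inj_on_def)
            show "snd ` ?X \<subseteq> ?P j i" by (auto simp: open_paths_def)
          qed (rule finite_alternating_paths)
          then have "real (card ?X) * (1 / real n) ^ m \<le> real (card (?P j i)) * (1 / real n) ^ m"
            by (intro mult_right_mono) auto
          also have "\<dots> \<le> w"
            unfolding w_def by (rule alternating_paths_weight[OF n False]) (use ji in simp)
          finally show ?thesis .
        qed
      qed simp
      finally show "(case y of (j, i) \<Rightarrow> sum ?f {x \<in> ?R. (\<lambda>(j, F, \<sigma>). (j, \<sigma> j)) x = (j, i)})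
          \<le> (case y of (j, i) \<Rightarrow> (a j)\<^sup>2 * (b i)\<^sup>2 * w)"
        unfolding yji prod.case .
    qed
    also have "\<dots> = w * AB"
      unfolding AB_def sum_product sum.cartesian_product[symmetric]
      by (simp add: sum_distrib_left sum_distrib_right mult_ac)
    finally show ?thesis .
  qed
  have le: "(s - t)\<^sup>2 \<le> 2 * s\<^sup>2 + 2 * t\<^sup>2" for s t :: real
  proof -
    have "0 \<le> (s + t)\<^sup>2" by simp
    then show ?thesis by (simp add: power2_sum power2_diff)
  qed
  have meas: "\<xi> e \<in> borel_measurable M" if "e \<in> alternating_edges p n" for e
    using indep that by (auto simp: indep_vars_def)
  have mG: "(\<lambda>\<omega>. cycle_coeff p n (\<lambda>e. \<xi> e \<omega>) a b m) \<in> borel_measurable M"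
    unfolding eqG using famG meas
    by (intro borel_measurable_sum borel_measurable_times borel_measurable_prod borel_measurable_const) blast
  have mH: "(\<lambda>\<omega>. path_coeff p n (\<lambda>e. \<xi> e \<omega>) a b m) \<in> borel_measurable M"
    unfolding eqH using famH meas
    by (intro borel_measurable_sum borel_measurable_times borel_measurable_prod borel_measurable_const) blast
  have intS: "integrable M (\<lambda>\<omega>. 2 * (path_coeff p n (\<lambda>e. \<xi> e \<omega>) a b m)\<^sup>2 + 2 * (cycle_coeff p n (\<lambda>e. \<xi> e \<omega>) a b m)\<^sup>2)"
    using intG intH by simp
  show int: "integrable M (\<lambda>\<omega>. (c m \<omega>)\<^sup>2)"
  proof (rule Bochner_Integration.integrable_bound[OF intS])
    show "(\<lambda>\<omega>. (c m \<omega>)\<^sup>2) \<in> borel_measurable M" unfolding c_def using mG mH by measurable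
  qed (auto intro!: AE_I2 simp: c_def le)
  have "expectation (\<lambda>\<omega>. (c m \<omega>)\<^sup>2) \<le>
      expectation (\<lambda>\<omega>. 2 * (path_coeff p n (\<lambda>e. \<xi> e \<omega>) a b m)\<^sup>2 + 2 * (cycle_coeff p n (\<lambda>e. \<xi> e \<omega>) a b m)\<^sup>2)"
    by (rule integral_mono[OF int intS]) (simp add: c_def le)
  also have "\<dots> = 2 * expectation (\<lambda>\<omega>. (path_coeff p n (\<lambda>e. \<xi> e \<omega>) a b m)\<^sup>2)
      + 2 * expectation (\<lambda>\<omega>. (cycle_coeff p n (\<lambda>e. \<xi> e \<omega>) a b m)\<^sup>2)"
    using intG intH by simp
  also have "\<dots> \<le> 2 * (w * AB) + 2 * (real m * (w * AB))" using EG EH by simp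
  also have "\<dots> = 2 * ((real m + 1) * w) * AB" by (simp add: distrib_right distrib_left)
  also have "(real m + 1) * w = (real m + 1) ^ 3 * \<kappa> ^ m * (1 + 1 / \<kappa>)\<^sup>2 / real n"
    unfolding w_def power3_eq_cube power2_eq_square[of "real m + 1"] by (simp only: mult.assoc times_divide_eq_right)
  finally have "expectation (\<lambda>\<omega>. (c m \<omega>)\<^sup>2) \<le>
      2 * ((real m + 1) ^ 3 * \<kappa> ^ m * (1 + 1 / \<kappa>)\<^sup>2 / real n) * AB" .
  also have "\<dots> = 2 * (real m + 1) ^ 3 * \<kappa> ^ m * (1 + 1 / \<kappa>)\<^sup>2 / real n * AB"
    by (simp only: mult.assoc times_divide_eq_right)
  finally show "expectation (\<lambda>\<omega>. (c m \<omega>)\<^sup>2) \<le>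
      2 * (real m + 1) ^ 3 * \<kappa> ^ m * (1 + 1 / \<kappa>)\<^sup>2 / real n * ((\<Sum>j<p + n. (a j)\<^sup>2) * (\<Sum>j<p + n. (b j)\<^sup>2))"
    unfolding AB_def .
qed

end

subsection \<open>Traces and closed walks\<close>

definition mat_trace :: "'a :: comm_monoid_add mat \<Rightarrow> 'a" where
  "mat_trace A = (\<Sum>i<dim_row A. A $$ (i, i))"

lemma mat_trace_mult_commute:
  fixes A B :: "'a :: comm_semiring_0 mat"
  assumes "A \<in> carrier_mat n n" "B \<in> carrier_mat n n"
  shows "mat_trace (A * B) = mat_trace (B * A)"
proof -
  have "mat_trace (A * B) = (\<Sum>i<n. \<Sum>k<n. A $$ (i, k) * B $$ (k, i))"
    using assms by (auto simp: mat_trace_def scalar_prod_def atLeast0LessThan intro!: sum.cong)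
  also have "\<dots> = (\<Sum>k<n. \<Sum>i<n. A $$ (i, k) * B $$ (k, i))" by (rule sum.swap)
  also have "\<dots> = mat_trace (B * A)"
    using assms by (auto simp: mat_trace_def scalar_prod_def atLeast0LessThan mult.commute intro!: sum.cong)
  finally show ?thesis .
qed

lemma upper_triangular_mult:
  fixes A B :: "'a :: comm_semiring_0 mat"
  assumes A: "A \<in> carrier_mat n n" "upper_triangular A" and B: "B \<in> carrier_mat n n" "upper_triangular B"
  shows "upper_triangular (A * B)" and "i < n \<Longrightarrow> (A * B) $$ (i, i) = A $$ (i, i) * B $$ (i, i)"
proof -
  have e: "(A * B) $$ (i, j) = (\<Sum>k\<in>{0..<n}. A $$ (i, k) * B $$ (k, j))" if "i < n" "j < n" for i j
    using that A B by (auto simp: scalar_prod_def intro!: sum.cong)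
  have z: "A $$ (i, k) * B $$ (k, j) = 0" if "i < n" "k < n" "k < i \<or> j < k" for i j k
    using that A B by (auto simp: upper_triangular_def)
  show "upper_triangular (A * B)"
  proof (rule upper_triangularI)
    fix i j assume ij: "j < i" "i < dim_row (A * B)"
    then have "i < n" "j < n" using A by auto
    then show "(A * B) $$ (i, j) = 0"
      unfolding e[OF \<open>i < n\<close> \<open>j < n\<close>] by (intro sum.neutral ballI z) (use ij in auto)
  qed
  show "(A * B) $$ (i, i) = A $$ (i, i) * B $$ (i, i)" if i: "i < n"
  proof -
    have "(A * B) $$ (i, i) = (\<Sum>k\<in>{0..<n}. if k = i then A $$ (i, i) * B $$ (i, i) else 0)"
      unfolding e[OF i i]
    proof (rule sum.cong[OF refl])
      fix k assume "k \<in> {0..<n}"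
      then show "A $$ (i, k) * B $$ (k, i) = (if k = i then A $$ (i, i) * B $$ (i, i) else 0)"
        using z[OF i, of k i] nat_neq_iff[of k i] by auto
    qed
    then show ?thesis using i by simp
  qed
qed

lemma upper_triangular_pow:
  fixes A :: "'a :: comm_semiring_1 mat"
  assumes A: "A \<in> carrier_mat n n" "upper_triangular A"
  shows "upper_triangular (A ^\<^sub>m k) \<and> (\<forall>i<n. (A ^\<^sub>m k) $$ (i, i) = A $$ (i, i) ^ k)"
proof (induction k)
  case 0
  then show ?case using A by (auto simp: upper_triangular_def)
next
  case (Suc k)
  have "A ^\<^sub>m k \<in> carrier_mat n n" using A by simp
  with Suc show ?case
    using upper_triangular_mult[of "A ^\<^sub>m k" n A] A by (simp add: mult.commute)
qed

text \<open>One list has to serve determinant, traces and characteristic polynomial together, so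
  that bounds on traces say something about the determinant. A triangular form provides it, since
  similarity preserves all three.\<close>

lemma eigenvalue_list_exists:
  fixes A :: "complex mat"
  assumes A: "A \<in> carrier_mat n n"
  shows "\<exists>vs. char_poly A = (\<Prod>\<nu>\<leftarrow>vs. [:- \<nu>, 1:]) \<and> (\<forall>z. det (1\<^sub>m n - z \<cdot>\<^sub>m A) = (\<Prod>\<nu>\<leftarrow>vs. 1 - z * \<nu>)) \<and>
    (\<forall>k. mat_trace (A ^\<^sub>m k) = (\<Sum>\<nu>\<leftarrow>vs. \<nu> ^ k))"
proof -
  obtain es where es: "char_poly A = (\<Prod>a\<leftarrow>es. [:- a, 1:])"
    using char_poly_factorized[OF A] by blast
  obtain B where B: "B \<in> carrier_mat n n" "upper_triangular B" and "similar_mat A B"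
    using schur_decomposition_exists[OF A es] by blast
  obtain P Q where wit: "similar_mat_wit A B P Q"
    using \<open>similar_mat A B\<close> by (auto simp: similar_mat_def)
  note D = similar_mat_witD2[OF A wit]
  define vs where "vs = diag_mat B"
  have "char_poly A = (\<Prod>\<nu>\<leftarrow>vs. [:- \<nu>, 1:])"
    unfolding vs_def char_poly_similar[OF \<open>similar_mat A B\<close>] by (rule char_poly_upper_triangular[OF B])
  moreover have "det (1\<^sub>m n - z \<cdot>\<^sub>m A) = (\<Prod>\<nu>\<leftarrow>vs. 1 - z * \<nu>)" for z
  proof -
    have c: "z \<cdot>\<^sub>m B \<in> carrier_mat n n" "1\<^sub>m n - z \<cdot>\<^sub>m B \<in> carrier_mat n n"
      using B minus_carrier_mat[of "z \<cdot>\<^sub>m B" n n] by auto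
    have "P * (1\<^sub>m n - z \<cdot>\<^sub>m B) = P * 1\<^sub>m n - P * (z \<cdot>\<^sub>m B)"
      by (rule mult_minus_distrib_mat[OF D(6) _ c(1)]) simp
    also have "\<dots> = P - z \<cdot>\<^sub>m (P * B)" using D B by (simp add: mult_smult_distrib)
    finally have "P * (1\<^sub>m n - z \<cdot>\<^sub>m B) * Q = (P - z \<cdot>\<^sub>m (P * B)) * Q" by simp
    also have "\<dots> = P * Q - z \<cdot>\<^sub>m (P * B) * Q"
      by (rule minus_mult_distrib_mat[of _ n n]) (use D B in auto)
    also have "z \<cdot>\<^sub>m (P * B) * Q = z \<cdot>\<^sub>m (P * B * Q)"
      by (rule mult_smult_assoc_mat[of _ n n]) (use D B in auto)
    finally have eq: "1\<^sub>m n - z \<cdot>\<^sub>m A = P * (1\<^sub>m n - z \<cdot>\<^sub>m B) * Q" using D(1,3) by simp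
    have "similar_mat (1\<^sub>m n - z \<cdot>\<^sub>m A) (1\<^sub>m n - z \<cdot>\<^sub>m B)"
    proof (rule similar_matI[OF _ D(1,2) eq])
      show "{1\<^sub>m n - z \<cdot>\<^sub>m A, 1\<^sub>m n - z \<cdot>\<^sub>m B, P, Q} \<subseteq> carrier_mat n n"
        using c D(6,7) minus_carrier_mat[OF smult_carrier_mat[OF A]] by auto
    qed
    then have "det (1\<^sub>m n - z \<cdot>\<^sub>m A) = det (1\<^sub>m n - z \<cdot>\<^sub>m B)" by (rule det_similar)
    also have "\<dots> = prod_list (diag_mat (1\<^sub>m n - z \<cdot>\<^sub>m B))"
      by (rule det_upper_triangular[OF _ c(2)]) (use B in \<open>auto simp: upper_triangular_def\<close>)
    also have "diag_mat (1\<^sub>m n - z \<cdot>\<^sub>m B) = map (\<lambda>\<nu>. 1 - z * \<nu>) vs"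
      unfolding vs_def diag_mat_def using B by auto
    finally show ?thesis .
  qed
  moreover have "mat_trace (A ^\<^sub>m k) = (\<Sum>\<nu>\<leftarrow>vs. \<nu> ^ k)" for k
  proof -
    have Bk: "B ^\<^sub>m k \<in> carrier_mat n n" using B by simp
    have "A ^\<^sub>m k = P * B ^\<^sub>m k * Q" by (rule similar_mat_wit_pow_id[OF wit])
    also have "\<dots> = P * (B ^\<^sub>m k * Q)" using D Bk by (intro assoc_mult_mat) auto
    also have "mat_trace \<dots> = mat_trace (B ^\<^sub>m k * Q * P)"
      by (rule mat_trace_mult_commute[of _ n]) (use D(6,7) Bk in auto)
    also have "B ^\<^sub>m k * Q * P = B ^\<^sub>m k * (Q * P)" using D Bk by (intro assoc_mult_mat) auto
    also have "\<dots> = B ^\<^sub>m k" using D Bk by simp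
    also have "mat_trace (B ^\<^sub>m k) = (\<Sum>i<n. B $$ (i, i) ^ k)"
      unfolding mat_trace_def using upper_triangular_pow[OF B] Bk by auto
    also have "\<dots> = (\<Sum>\<nu>\<leftarrow>vs. \<nu> ^ k)"
      unfolding vs_def diag_mat_def using B by (simp add: sum_list_sum_nth atLeast0LessThan)
    finally show ?thesis .
  qed
  ultimately show ?thesis by blast
qed

lemma sum_PiE_insert:
  assumes "x \<notin> S"
  shows "(\<Sum>f\<in>PiE (insert x S) T. h f) = (\<Sum>y\<in>T x. \<Sum>g\<in>PiE S T. h (g(x := y)))"
proof -
  have "(\<Sum>f\<in>PiE (insert x S) T. h f) = (\<Sum>(y, g)\<in>T x \<times> PiE S T. h (g(x := y)))"
    unfolding PiE_insert_eq by (subst sum.reindex[OF inj_combinator[OF assms]]) (simp add: case_prod_unfold)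
  then show ?thesis by (simp add: sum.cartesian_product)
qed

lemma mat_pow_walks:
  fixes A :: "'a :: comm_semiring_1 mat"
  assumes A: "A \<in> carrier_mat N N" and "i < N" "j < N"
  shows "(A ^\<^sub>m m) $$ (i, j) = (\<Sum>f\<in>{..m} \<rightarrow>\<^sub>E {..<N}. if f 0 = i \<and> f m = j then \<Prod>k<m. A $$ (f k, f (Suc k)) else 0)"
  using assms(2,3)
proof (induction m arbitrary: j)
  case 0
  have "(\<Sum>f\<in>{..0} \<rightarrow>\<^sub>E {..<N}. if f 0 = i \<and> f 0 = j then \<Prod>k<0. A $$ (f k, f (Suc k)) else 0)
      = (\<Sum>f\<in>insert 0 {} \<rightarrow>\<^sub>E {..<N}. if f (0::nat) = i \<and> f 0 = j then 1 else 0 :: 'a)"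
    by (simp cong: if_cong)
  also have "\<dots> = (\<Sum>y<N. if y = i \<and> y = j then 1 else 0)"
    by (subst sum_PiE_insert) auto
  also have "\<dots> = (\<Sum>y<N. if y = i then (if i = j then 1 else 0) else 0)"
    by (rule sum.cong) auto
  also have "\<dots> = (if i = j then 1 else 0)" using 0 by simp
  finally show ?case using 0 A by simp
next
  case (Suc m)
  have Am: "A ^\<^sub>m m \<in> carrier_mat N N" using A by simp
  have "(A ^\<^sub>m Suc m) $$ (i, j) = (\<Sum>l<N. (A ^\<^sub>m m) $$ (i, l) * A $$ (l, j))"
    using Suc.prems A Am by (simp add: scalar_prod_def atLeast0LessThan)
  also have "\<dots> = (\<Sum>l<N. \<Sum>f\<in>{..m} \<rightarrow>\<^sub>E {..<N}. if l = f m then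
      (if f 0 = i then (\<Prod>k<m. A $$ (f k, f (Suc k))) * A $$ (f m, j) else 0) else 0)"
    by (intro sum.cong refl) (auto simp: Suc.IH[OF Suc.prems(1)] sum_distrib_right intro!: sum.cong)
  also have "\<dots> = (\<Sum>f\<in>{..m} \<rightarrow>\<^sub>E {..<N}. \<Sum>l<N. if l = f m then
      (if f 0 = i then (\<Prod>k<m. A $$ (f k, f (Suc k))) * A $$ (f m, j) else 0) else 0)"
    by (rule sum.swap)
  also have "\<dots> = (\<Sum>f\<in>{..m} \<rightarrow>\<^sub>E {..<N}.
      if f 0 = i then (\<Prod>k<m. A $$ (f k, f (Suc k))) * A $$ (f m, j) else 0)"
  proof (rule sum.cong[OF refl])
    fix f assume "f \<in> {..m} \<rightarrow>\<^sub>E {..<N}"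
    then have "f m < N" by auto
    then show "(\<Sum>l<N. if l = f m then
      (if f 0 = i then (\<Prod>k<m. A $$ (f k, f (Suc k))) * A $$ (f m, j) else 0) else 0)
      = (if f 0 = i then (\<Prod>k<m. A $$ (f k, f (Suc k))) * A $$ (f m, j) else 0)"
      by (simp only: sum.delta finite_lessThan lessThan_iff if_True)
  qed
  also have "\<dots> = (\<Sum>y<N. \<Sum>f\<in>{..m} \<rightarrow>\<^sub>E {..<N}. if y = j then
      (if f 0 = i then (\<Prod>k<m. A $$ (f k, f (Suc k))) * A $$ (f m, j) else 0) else 0)"
    using Suc.prems(2) by (subst sum.swap) simp
  also have "\<dots> = (\<Sum>y<N. \<Sum>f\<in>{..m} \<rightarrow>\<^sub>E {..<N}. if (f(Suc m := y)) 0 = i \<and> (f(Suc m := y)) (Suc m) = j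
      then \<Prod>k<Suc m. A $$ ((f(Suc m := y)) k, (f(Suc m := y)) (Suc k)) else 0)"
    by (intro sum.cong refl) auto
  also have "\<dots> = (\<Sum>f\<in>{..Suc m} \<rightarrow>\<^sub>E {..<N}. if f 0 = i \<and> f (Suc m) = j
      then \<Prod>k<Suc m. A $$ (f k, f (Suc k)) else 0)"
    unfolding atMost_Suc by (rule sum_PiE_insert[symmetric]) simp
  finally show ?case .
qed

text \<open>The repeated endpoint of a closed walk is dropped: positions live in
  \<open>{..<m}\<close> and the next position is taken modulo \<open>m\<close>, which later makes
  rotations of walks easy to express.\<close>

lemma mat_trace_pow_closed_walks:
  fixes A :: "'a :: comm_semiring_1 mat"
  assumes A: "A \<in> carrier_mat N N" and m: "0 < m"
  shows "mat_trace (A ^\<^sub>m m) = (\<Sum>f\<in>{..<m} \<rightarrow>\<^sub>E {..<N}. \<Prod>k<m. A $$ (f k, f (Suc k mod m)))"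
proof -
  have "mat_trace (A ^\<^sub>m m) = (\<Sum>i<N. (A ^\<^sub>m m) $$ (i, i))"
    using A by (simp add: mat_trace_def)
  also have "\<dots> = (\<Sum>i<N. \<Sum>f\<in>{..m} \<rightarrow>\<^sub>E {..<N}. if i = f 0 then (if f m = f 0 then \<Prod>k<m. A $$ (f k, f (Suc k)) else 0) else 0)"
    by (intro sum.cong refl) (auto simp: mat_pow_walks[OF A] intro!: sum.cong)
  also have "\<dots> = (\<Sum>f\<in>{..m} \<rightarrow>\<^sub>E {..<N}. \<Sum>i<N. if i = f 0 then (if f m = f 0 then \<Prod>k<m. A $$ (f k, f (Suc k)) else 0) else 0)"
    by (rule sum.swap)
  also have "\<dots> = (\<Sum>f\<in>{..m} \<rightarrow>\<^sub>E {..<N}. if f m = f 0 then \<Prod>k<m. A $$ (f k, f (Suc k)) else 0)"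
  proof (rule sum.cong[OF refl])
    fix f assume "f \<in> {..m} \<rightarrow>\<^sub>E {..<N}"
    then have "f 0 < N" by auto
    then show "(\<Sum>i<N. if i = f 0 then (if f m = f 0 then \<Prod>k<m. A $$ (f k, f (Suc k)) else 0) else 0)
        = (if f m = f 0 then \<Prod>k<m. A $$ (f k, f (Suc k)) else 0)"
      by (simp only: sum.delta finite_lessThan lessThan_iff if_True)
  qed
  also have "\<dots> = (\<Sum>f\<in>insert m {..<m} \<rightarrow>\<^sub>E {..<N}. if f m = f 0 then \<Prod>k<m. A $$ (f k, f (Suc k)) else 0)"
    by (simp only: ivl_disj_un_singleton lessThan_Suc[symmetric] lessThan_Suc_atMost)
  also have "\<dots> = (\<Sum>y<N. \<Sum>f\<in>{..<m} \<rightarrow>\<^sub>E {..<N}. if (f(m := y)) m = (f(m := y)) 0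
      then \<Prod>k<m. A $$ ((f(m := y)) k, (f(m := y)) (Suc k)) else 0)"
    by (rule sum_PiE_insert) simp
  also have "\<dots> = (\<Sum>f\<in>{..<m} \<rightarrow>\<^sub>E {..<N}. \<Sum>y<N. if y = f 0
      then \<Prod>k<m. A $$ (f k, f (Suc k mod m)) else 0)"
  proof (subst sum.swap, intro sum.cong refl)
    fix f y
    have "(\<Prod>k<m. A $$ ((f(m := y)) k, (f(m := y)) (Suc k))) = (\<Prod>k<m. A $$ (f k, f (Suc k mod m)))"
      if "y = f 0"
    proof (rule prod.cong[OF refl])
      fix k assume "k \<in> {..<m}"
      then show "A $$ ((f(m := y)) k, (f(m := y)) (Suc k)) = A $$ (f k, f (Suc k mod m))"
        using that by (cases "Suc k = m") auto
    qed
    then show "(if (f(m := y)) m = (f(m := y)) 0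
      then \<Prod>k<m. A $$ ((f(m := y)) k, (f(m := y)) (Suc k)) else 0) =
      (if y = f 0 then \<Prod>k<m. A $$ (f k, f (Suc k mod m)) else 0)"
      using m by simp
  qed
  also have "\<dots> = (\<Sum>f\<in>{..<m} \<rightarrow>\<^sub>E {..<N}. \<Prod>k<m. A $$ (f k, f (Suc k mod m)))"
  proof (rule sum.cong[OF refl])
    fix f assume "f \<in> {..<m} \<rightarrow>\<^sub>E {..<N}"
    then have "f 0 < N" using m by auto
    then show "(\<Sum>y<N. if y = f 0 then \<Prod>k<m. A $$ (f k, f (Suc k mod m)) else 0)
        = (\<Prod>k<m. A $$ (f k, f (Suc k mod m)))"
      by (simp only: sum.delta finite_lessThan lessThan_iff if_True)
  qed
  finally show ?thesis .
qed

section \<open>Counting closed walks and pairs of them\<close>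

definition closed_walks :: "nat \<Rightarrow> nat \<Rightarrow> nat \<Rightarrow> (nat \<Rightarrow> nat) set" where
  "closed_walks p n m = {f \<in> {..<m} \<rightarrow>\<^sub>E {..<p + n}. \<forall>k<m. (f k < p) \<noteq> (f (Suc k mod m) < p)}"

definition trace_coeff :: "nat \<Rightarrow> nat \<Rightarrow> (nat \<times> nat \<Rightarrow> real) \<Rightarrow> nat \<Rightarrow> real" where
  "trace_coeff p n y m = (\<Sum>f\<in>closed_walks p n m. \<Prod>k<m. y (f k, f (Suc k mod m)))"

lemma closed_walksD:
  assumes "f \<in> closed_walks p n m"
  shows "f \<in> {..<m} \<rightarrow>\<^sub>E {..<p + n}" and "k < m \<Longrightarrow> (f k < p) \<noteq> (f (Suc k mod m) < p)"
  using assms unfolding closed_walks_def by blast+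

lemma finite_closed_walks: "finite (closed_walks p n m)"
  unfolding closed_walks_def by (rule finite_subset[OF _ finite_PiE[of "{..<m}" "\<lambda>_. {..<p + n}"]]) auto

lemma mat_trace_edge_mat_pow:
  assumes m: "0 < m"
  shows "mat_trace (edge_mat p n y ^\<^sub>m m) = complex_of_real (trace_coeff p n y m)"
proof -
  have "mat_trace (edge_mat p n y ^\<^sub>m m)
      = (\<Sum>f\<in>{..<m} \<rightarrow>\<^sub>E {..<p + n}. \<Prod>k<m. edge_mat p n y $$ (f k, f (Suc k mod m)))"
    by (rule mat_trace_pow_closed_walks[OF _ m]) simp
  also have "\<dots> = (\<Sum>f\<in>closed_walks p n m. \<Prod>k<m. complex_of_real (y (f k, f (Suc k mod m))))"
  proof (rule sum.mono_neutral_cong_right)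
    have lt: "f k < p + n" "f (Suc k mod m) < p + n" if "f \<in> {..<m} \<rightarrow>\<^sub>E {..<p + n}" "k < m" for f k
      using PiE_mem[OF that(1), of k] PiE_mem[OF that(1), of "Suc k mod m"] that(2) m by simp_all
    show "\<forall>f\<in>({..<m} \<rightarrow>\<^sub>E {..<p + n}) - closed_walks p n m. (\<Prod>k<m. edge_mat p n y $$ (f k, f (Suc k mod m))) = 0"
    proof
      fix f assume f: "f \<in> ({..<m} \<rightarrow>\<^sub>E {..<p + n}) - closed_walks p n m"
      then obtain k where k: "k < m" "(f k < p) = (f (Suc k mod m) < p)"
        unfolding closed_walks_def by blast
      have "edge_mat p n y $$ (f k, f (Suc k mod m)) = 0"
        using lt[of f k] f k by (auto simp: edge_mat_def)
      then show "(\<Prod>k<m. edge_mat p n y $$ (f k, f (Suc k mod m))) = 0"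
        using k(1) by (intro prod_zero) auto
    qed
    show "(\<Prod>k<m. edge_mat p n y $$ (f k, f (Suc k mod m))) = (\<Prod>k<m. complex_of_real (y (f k, f (Suc k mod m))))"
      if "f \<in> closed_walks p n m" for f
    proof (rule prod.cong[OF refl])
      fix k assume "k \<in> {..<m}"
      then show "edge_mat p n y $$ (f k, f (Suc k mod m)) = complex_of_real (y (f k, f (Suc k mod m)))"
        using closed_walksD(2)[OF that, of k] lt[OF closed_walksD(1)[OF that], of k] by (simp add: edge_mat_def)
    qed
    show "closed_walks p n m \<subseteq> {..<m} \<rightarrow>\<^sub>E {..<p + n}" using closed_walksD(1) by blast
  qed (simp add: finite_PiE)
  finally show ?thesis by (simp add: trace_coeff_def)
qed

lemma closed_walks_parity:
  assumes "f \<in> closed_walks p n m" "k < m"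
  shows "(f k < p) = ((f 0 < p) = even k)"
  using assms(2)
proof (induction k)
  case (Suc k)
  have "(f k < p) \<noteq> (f (Suc k) < p)"
    using closed_walksD(2)[OF assms(1), of k] Suc.prems by simp
  then show ?case using Suc by auto
qed simp

lemma card_closed_walks:
  shows "odd m \<Longrightarrow> closed_walks p n m = {}"
    and "card (closed_walks p n (2 * l)) \<le> 2 * (p ^ l * n ^ l)"
proof -
  show "closed_walks p n m = {}" if m: "odd m"
  proof (rule ccontr)
    assume "closed_walks p n m \<noteq> {}"
    then obtain f where f: "f \<in> closed_walks p n m" by blast
    have m0: "0 < m" using m by (cases m) auto
    have "(f (m - 1) < p) = (f 0 < p)"
      using closed_walks_parity[OF f, of "m - 1"] m m0 by auto
    moreover have "(f (m - 1) < p) \<noteq> (f (Suc (m - 1) mod m) < p)"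
      using closed_walksD(2)[OF f, of "m - 1"] m0 by simp
    ultimately show False using m0 by simp
  qed
  let ?T = "\<lambda>b k. if even k = b then {..<p} else {p..<p + n}"
  \<comment> \<open>The block of the starting vertex determines the block at every position, which
    leaves two products of free choices.\<close>
  have sub: "closed_walks p n (2 * l) \<subseteq> PiE {..<2 * l} (?T True) \<union> PiE {..<2 * l} (?T False)"
  proof
    fix f assume f: "f \<in> closed_walks p n (2 * l)"
    have "f k \<in> ?T (f 0 < p) k" if "k < 2 * l" for k
      using closed_walks_parity[OF f that] PiE_mem[OF closed_walksD(1)[OF f], of k] that by auto
    moreover have "f \<in> extensional {..<2 * l}" using closed_walksD(1)[OF f] by (simp add: PiE_iff)
    ultimately have "f \<in> PiE {..<2 * l} (?T (f 0 < p))" by (auto simp: PiE_iff)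
    then show "f \<in> PiE {..<2 * l} (?T True) \<union> PiE {..<2 * l} (?T False)" by (cases "f 0 < p") simp_all
  qed
  have card: "card (PiE {..<2 * l} (?T b)) = p ^ l * n ^ l" for b
  proof -
    have "card (PiE {..<2 * l} (?T b)) = (\<Prod>k<2 * l. if even k = b then p else n)"
      by (subst card_PiE) (auto intro!: prod.cong)
    also have "\<dots> = p ^ l * n ^ l"
      by (induction l) (auto simp: mult_ac)
    finally show ?thesis .
  qed
  have "card (closed_walks p n (2 * l)) \<le> card (PiE {..<2 * l} (?T True) \<union> PiE {..<2 * l} (?T False))"
    by (rule card_mono[OF _ sub]) (auto intro!: finite_PiE)
  also have "\<dots> \<le> card (PiE {..<2 * l} (?T True)) + card (PiE {..<2 * l} (?T False))"
    by (rule card_Un_le)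
  finally show "card (closed_walks p n (2 * l)) \<le> 2 * (p ^ l * n ^ l)"
    unfolding card by simp
qed

lemma closed_walks_weight:
  assumes "0 < n" "0 < \<kappa>" "real p \<le> \<kappa>\<^sup>2 * real n"
  shows "real (card (closed_walks p n m)) * (1 / real n) ^ m \<le> 2 * \<kappa> ^ m"
proof (cases "even m")
  case True
  then obtain l where m: "m = 2 * l" by blast
  have "real (card (closed_walks p n m)) \<le> real (2 * (p ^ l * n ^ l))"
    using card_closed_walks(2)[of p n l] unfolding m by (simp only: of_nat_le_iff)
  also have "\<dots> \<le> 2 * ((\<kappa>\<^sup>2 * real n) ^ l * real n ^ l)"
    using assms(3) by (auto intro!: mult_right_mono power_mono)
  finally have "real (card (closed_walks p n m)) * (1 / real n) ^ m
      \<le> 2 * ((\<kappa>\<^sup>2 * real n) ^ l * real n ^ l) * (1 / real n) ^ m"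
    by (intro mult_right_mono) auto
  also have "\<dots> = 2 * \<kappa> ^ m"
    using assms(1) unfolding m power_mult by (simp add: power_mult_distrib power_divide power2_eq_square field_simps)
  finally show ?thesis .
qed (use assms in \<open>simp add: card_closed_walks(1)\<close>)

text \<open>
  Two closed walks \<open>f\<close>, \<open>g\<close> of length \<open>m\<close> whose steps are all repeated: since every visited vertex
  is the source of a step, there are at most \<open>m\<close> vertices, and in case of equality the
  next vertex is a function of the current one. Then \<open>g\<close> is a rotation of \<open>f\<close>, or both run
  twice through a cycle of length \<open>m / 2\<close>.
\<close>

lemma repeated_steps:
  fixes f g :: "nat \<Rightarrow> nat" and m :: nat
  defines "K \<equiv> (UNIV :: bool set) \<times> {..<m}"
  defines "h \<equiv> \<lambda>(b, k). if b then g k else f k"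
  defines "e \<equiv> \<lambda>(b, k). (h (b, k), h (b, Suc k mod m))"
  assumes m: "0 < m"
    and rep: "\<And>x. x \<in> K \<Longrightarrow> 2 \<le> card {x' \<in> K. e x' = e x}"
    and many: "m \<le> card (h ` K)"
  shows "\<And>x. x \<in> K \<Longrightarrow> card {x' \<in> K. e x' = e x} = 2"
    and "(\<exists>s<m. \<forall>k<m. g k = f ((k + s) mod m)) \<or>
      (\<exists>q. m = 2 * q \<and> 0 < q \<and> (\<forall>k<q. f (k + q) = f k \<and> g (k + q) = g k))"
proof -
  have finK: "finite K" and cardK: "card K = 2 * m" by (auto simp: K_def)
  have rep': "2 \<le> card {x \<in> K. e x = y}" if "y \<in> e ` K" for y using that rep by auto
  have sumK: "(\<Sum>y\<in>e ` K. card {x \<in> K. e x = y}) = 2 * m"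
    using sum.group[OF finK, of "e ` K" e "\<lambda>_. 1 :: nat"] finK cardK by simp
  \<comment> \<open>The 2m steps fall into classes of size at least 2, so there are at most
    \<open>m\<close> different steps. Vertices are sources of steps and there are at least
    \<open>m\<close> of them; hence equality holds throughout, and a vertex determines the step
    leaving it.\<close>
  have "(\<Sum>y\<in>e ` K. 2) \<le> (\<Sum>y\<in>e ` K. card {x \<in> K. e x = y})"
    by (rule sum_mono) (rule rep')
  then have le: "card (e ` K) \<le> m" unfolding sumK by simp
  have "fst (e x) = h x" for x by (cases x) (simp add: e_def)
  then have fst: "fst ` e ` K = h ` K" by (simp add: image_image)
  then have "card (h ` K) \<le> card (e ` K)"
    using card_image_le[of "e ` K" fst] finK by simp
  then have ce: "card (e ` K) = m" and ch: "card (h ` K) = m" using many le by auto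
  have inj: "inj_on fst (e ` K)"
    by (rule eq_card_imp_inj_on) (use finK fst ce ch in auto)
  show two: "card {x' \<in> K. e x' = e x} = 2" if x: "x \<in> K" for x
  proof (rule ccontr)
    assume "card {x' \<in> K. e x' = e x} \<noteq> 2"
    then have "2 < card {x' \<in> K. e x' = e x}" using rep[OF x] by simp
    then have "(\<Sum>y\<in>e ` K. 2) < (\<Sum>y\<in>e ` K. card {x \<in> K. e x = y})"
      using x finK rep' by (intro sum_strict_mono_ex1) auto
    then show False unfolding sumK using ce by simp
  qed
  have he: "e x = e x'" if "x \<in> K" "x' \<in> K" "h x = h x'" for x x'
  proof -
    have "fst (e x) = fst (e x')" using that(3) by (cases x; cases x') (simp add: e_def)
    then show ?thesis using inj_onD[OF inj] that(1,2) by blast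
  qed
  \<comment> \<open>Since a vertex determines the step leaving it, two positions at the same vertex
    stay together at all later times.\<close>
  have step: "h (b, (k + t) mod m) = h (b', (k' + t) mod m)" if "k < m" "k' < m" "h (b, k) = h (b', k')" for b b' k k' t
  proof (induction t)
    case (Suc t)
    have "e (b, (k + t) mod m) = e (b', (k' + t) mod m)"
      by (rule he[OF _ _ Suc]) (use m in \<open>auto simp: K_def\<close>)
    then show ?case by (simp add: e_def mod_Suc_eq)
  qed (use that in simp)
  have fibre: "card {x' \<in> K. h x' = h x} = 2" if x: "x \<in> K" for x
  proof -
    have "{x' \<in> K. h x' = h x} = {x' \<in> K. e x' = e x}"
    proof (intro Collect_cong conj_cong refl iffI)
      fix x' assume "x' \<in> K"
      show "e x' = e x" if "h x' = h x" using he \<open>x' \<in> K\<close> x that by blast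
      show "h x' = h x" if "e x' = e x"
      proof -
        have "fst (e x') = fst (e x)" using that by simp
        then show ?thesis by (cases x; cases x') (simp add: e_def)
      qed
    qed
    then show ?thesis using two[OF x] by simp
  qed
  have partner: "\<exists>b' s. s < m \<and> (b', s) \<noteq> (b, 0) \<and> {x' \<in> K. h x' = h (b, 0)} = {(b, 0), (b', s)}" for b
  proof -
    have b0: "(b, 0) \<in> K" using m by (simp add: K_def)
    obtain x y where xy: "{x' \<in> K. h x' = h (b, 0)} = {x, y}" "x \<noteq> y"
      using fibre[OF b0] unfolding card_2_iff by blast
    have "(b, 0) \<in> {x' \<in> K. h x' = h (b, 0)}" using b0 by simp
    then have "(b, 0) = x \<or> (b, 0) = y" unfolding xy(1) by simp
    then obtain z where z: "{x, y} = {(b, 0), z}" "z \<noteq> (b, 0)" using xy(2) by (metis insert_commute)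
    have "z \<in> {x, y}" unfolding z(1) by simp
    then have "z \<in> K" unfolding xy(1)[symmetric] by simp
    obtain b' s where zz: "z = (b', s)" by (cases z)
    have "s < m" using \<open>z \<in> K\<close> zz by (simp add: K_def)
    moreover have "{x' \<in> K. h x' = h (b, 0)} = {(b, 0), (b', s)}" unfolding xy(1) z(1) zz ..
    ultimately show ?thesis using z(2) zz by blast
  qed
  \<comment> \<open>Shifting twice by \<open>s\<close> again shows the vertex at position 0. Its
    fibre consists of the positions 0 and \<open>s\<close> of the same walk, so \<open>s + s\<close>
    is 0 or \<open>s\<close> modulo \<open>m\<close>, and this forces
    \<open>m = 2 * s\<close>.\<close>
  have half: "m = 2 * s \<and> 0 < s \<and> (\<forall>k<s. h (b, k + s) = h (b, k))"
    if s: "s < m" "(b, s) \<noteq> (b, 0)" and fib: "{x' \<in> K. h x' = h (b, 0)} = {(b, 0), (b, s)}" for b s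
  proof -
    have s0: "0 < s" using s(2) by (cases s) auto
    have "(b, s) \<in> {x' \<in> K. h x' = h (b, 0)}" unfolding fib by simp
    then have hs: "h (b, s) = h (b, 0)" by simp
    have per: "h (b, (s + t) mod m) = h (b, t mod m)" for t
      using step[OF s(1) m hs, of t] by simp
    have "h (b, (s + s) mod m) = h (b, 0)" using per[of s] s(1) hs by simp
    then have "(b, (s + s) mod m) \<in> {x' \<in> K. h x' = h (b, 0)}" using m by (simp add: K_def)
    then have c: "(s + s) mod m = 0 \<or> (s + s) mod m = s" unfolding fib by simp
    have ms: "m = 2 * s"
    proof (cases "s + s < m")
      case True
      then show ?thesis using c s0 by simp
    next
      case False
      then have "(s + s) mod m = s + s - m" using s(1) by (simp add: mod_if)
      then show ?thesis using c False s by auto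
    qed
    have "h (b, k + s) = h (b, k)" if "k < s" for k
      using per[of k] that ms by (simp add: add.commute)
    then show ?thesis using ms s0 by blast
  qed
  \<comment> \<open>From a common vertex on the two walks agree. The shift is the difference of the
    two positions modulo \<open>m\<close>, with \<open>m - s\<close> in place of a negative
    \<open>s\<close>.\<close>
  have rot: "\<exists>s<m. \<forall>k<m. g k = f ((k + s) mod m)" if "s < m" "s' < m" "g s = f s'" for s s'
  proof (intro exI conjI allI impI)
    show "(s' + (m - s)) mod m < m" using m by simp
    fix k assume k: "k < m"
    have "h (True, (s + (k + (m - s))) mod m) = h (False, (s' + (k + (m - s))) mod m)"
      by (rule step) (use that in \<open>auto simp: h_def\<close>)
    moreover have "(s + (k + (m - s))) mod m = k" using that(1) k by simp
    moreover have "(s' + (k + (m - s))) mod m = (k + (s' + (m - s)) mod m) mod m"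
      by (simp add: mod_add_right_eq add.left_commute)
    ultimately show "g k = f ((k + (s' + (m - s)) mod m) mod m)" by (simp add: h_def)
  qed
  obtain b s where bs: "s < m" "(b, s) \<noteq> (False, 0)" "{x' \<in> K. h x' = h (False, 0)} = {(False, 0), (b, s)}"
    using partner[of False] by (elim exE conjE) (rule that; assumption)
  obtain b' s' where bs': "s' < m" "(b', s') \<noteq> (True, 0)" "{x' \<in> K. h x' = h (True, 0)} = {(True, 0), (b', s')}"
    using partner[of True] by (elim exE conjE) (rule that; assumption)
  have e1: "h (b, s) = f 0"
  proof -
    have "(b, s) \<in> {x' \<in> K. h x' = h (False, 0)}" unfolding bs(3) by simp
    then show ?thesis by (simp add: h_def)
  qed
  have e2: "h (b', s') = g 0"
  proof -
    have "(b', s') \<in> {x' \<in> K. h x' = h (True, 0)}" unfolding bs'(3) by simp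
    then show ?thesis by (simp add: h_def)
  qed
  show "(\<exists>s<m. \<forall>k<m. g k = f ((k + s) mod m)) \<or>
      (\<exists>q. m = 2 * q \<and> 0 < q \<and> (\<forall>k<q. f (k + q) = f k \<and> g (k + q) = g k))"
  \<comment> \<open>The starting vertex of each walk has exactly one other occurrence. If for one of
    the walks it lies on the other walk, the two are rotations of each other; otherwise both run
    twice through a half.\<close>
  proof (cases "b = True \<or> b' = False")
    case True
    then show ?thesis
    proof
      assume "b = True"
      then have "g s = f 0" using e1 by (simp add: h_def)
      then show ?thesis using rot[OF bs(1) m] by blast
    next
      assume "b' = False"
      then have "g 0 = f s'" using e2 by (simp add: h_def)
      then show ?thesis using rot[OF m bs'(1)] by blast
    qed
  next
    case False
    then have b: "b = False" "b' = True" by auto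
    note h1 = half[OF bs(1), of False] and h2 = half[OF bs'(1), of True]
    have "m = 2 * s \<and> 0 < s \<and> (\<forall>k<s. h (False, k + s) = h (False, k))"
      using bs b by (intro h1) auto
    moreover have "m = 2 * s' \<and> 0 < s' \<and> (\<forall>k<s'. h (True, k + s') = h (True, k))"
      using bs' b by (intro h2) auto
    ultimately have "m = 2 * s \<and> 0 < s \<and> (\<forall>k<s. f (k + s) = f k \<and> g (k + s) = g k)"
      by (auto simp: h_def)
    then show ?thesis by blast
  qed
qed

definition tied_walks :: "nat \<Rightarrow> nat \<Rightarrow> nat \<Rightarrow> ((nat \<Rightarrow> nat) \<times> (nat \<Rightarrow> nat)) set" where
  "tied_walks p n m = {(f, g) \<in> closed_walks p n m \<times> closed_walks p n m.
     (\<exists>s<m. \<forall>k<m. g k = f ((k + s) mod m)) \<or>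
     (\<exists>q. m = 2 * q \<and> 0 < q \<and> (\<forall>k<q. f (k + q) = f k \<and> g (k + q) = g k))}"

text \<open>A rotated pair is fixed by \<open>f\<close> and the shift. In a pair of the periodic
  kind each walk is fixed by its first half, itself a closed walk of length
  \<open>m div 2\<close>.\<close>

lemma card_tied_walks:
  "card (tied_walks p n m) \<le> m * card (closed_walks p n m) + (card (closed_walks p n (m div 2)))\<^sup>2"
proof -
  let ?W = "closed_walks p n m" and ?V = "closed_walks p n (m div 2)"
  let ?A = "{(f, g) \<in> ?W \<times> ?W. \<exists>s<m. \<forall>k<m. g k = f ((k + s) mod m)}"
  let ?B = "{(f, g) \<in> ?W \<times> ?W. \<exists>q. m = 2 * q \<and> 0 < q \<and> (\<forall>k<q. f (k + q) = f k \<and> g (k + q) = g k)}"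
  have fin: "finite ?W" "finite ?V" by (auto simp: finite_closed_walks)
  have "?A \<subseteq> (\<lambda>(s, f). (f, \<lambda>k\<in>{..<m}. f ((k + s) mod m))) ` ({..<m} \<times> ?W)"
  proof clarify
    fix f g s assume x: "f \<in> ?W" "g \<in> ?W" "s < m" "\<forall>k<m. g k = f ((k + s) mod m)"
    have "g = (\<lambda>k\<in>{..<m}. f ((k + s) mod m))"
      using closed_walksD(1)[OF x(2)] x(4) by (intro ext) (auto simp: PiE_iff extensional_def restrict_def)
    then show "(f, g) \<in> (\<lambda>(s, f). (f, \<lambda>k\<in>{..<m}. f ((k + s) mod m))) ` ({..<m} \<times> ?W)"
      using x by (intro image_eqI[of _ _ "(s, f)"]) auto
  qed
  then have A: "card ?A \<le> m * card ?W"
    using surj_card_le[of "{..<m} \<times> ?W" ?A] fin by (simp add: card_cartesian_product)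
  have B: "card ?B \<le> (card ?V)\<^sup>2"
  proof -
    let ?r = "\<lambda>f. restrict f {..<m div 2}"
    have "card ?B \<le> card (?V \<times> ?V)"
    proof (rule card_inj_on_le)
      have ext: "f = f'" if f: "f \<in> ?W" "f' \<in> ?W" "m = 2 * q" "\<forall>k<q. f (k + q) = f k" "\<forall>k<q. f' (k + q) = f' k"
        and r: "?r f = ?r f'" for f f' q
      proof
        fix k
        have lt: "f k = f' k" if "k < q" for k
          using fun_cong[OF r, of k] that f(3) by simp
        consider "k < q" | "q \<le> k" "k < m" | "m \<le> k" by linarith
        then show "f k = f' k"
        proof cases
          case 2
          then have "k - q < q" "k = (k - q) + q" using f(3) by auto
          then show ?thesis using f(4,5) lt[of "k - q"] by metis
        next
          case 3
          then show ?thesis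
            using closed_walksD(1)[OF f(1)] closed_walksD(1)[OF f(2)] by (simp add: PiE_iff extensional_def)
        qed (rule lt)
      qed
      show "inj_on (map_prod ?r ?r) ?B"
      proof (rule inj_onI)
        fix x1 x2 assume x12: "x1 \<in> ?B" "x2 \<in> ?B" "map_prod ?r ?r x1 = map_prod ?r ?r x2"
        obtain f g f' g' where xs: "x1 = (f, g)" "x2 = (f', g')" by (cases x1; cases x2) auto
        obtain q where q1: "f \<in> ?W" "g \<in> ?W" "m = 2 * q" "\<forall>k<q. f (k + q) = f k \<and> g (k + q) = g k"
          using x12(1) unfolding xs by blast
        obtain q' where q2: "f' \<in> ?W" "g' \<in> ?W" "m = 2 * q'" "\<forall>k<q'. f' (k + q') = f' k \<and> g' (k + q') = g' k"
          using x12(2) unfolding xs by blast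
        have x: "f \<in> ?W" "g \<in> ?W" "f' \<in> ?W" "g' \<in> ?W" "m = 2 * q" "m = 2 * q'"
          and per: "\<forall>k<q. f (k + q) = f k \<and> g (k + q) = g k" "\<forall>k<q'. f' (k + q') = f' k \<and> g' (k + q') = g' k"
          and eq: "map_prod ?r ?r (f, g) = map_prod ?r ?r (f', g')"
          by (rule q1 q2 x12(3)[unfolded xs])+
        have q: "q' = q" using x by simp
        have "f = f' \<and> g = g'"
          using ext[of f f' q] ext[of g g' q] x per eq unfolding q by simp
        then show "x1 = x2" unfolding xs by simp
      qed
      have mem: "?r f \<in> ?V" if f: "f \<in> ?W" "m = 2 * q" "0 < q" "\<forall>k<q. f (k + q) = f k" for f q
      proof -
        have q: "m div 2 = q" using f(2) by simp
        have alt: "(f k < p) \<noteq> (f (Suc k mod q) < p)" if k: "k < q" for k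
        proof -
          have "(f k < p) \<noteq> (f (Suc k mod m) < p)" using closed_walksD(2)[OF f(1), of k] f(2) k by simp
          moreover have "f (Suc k mod m) = f (Suc k mod q)"
          proof (cases "Suc k = q")
            case True
            then have "f (Suc k mod m) = f (0 + q)" using f(2,3) by simp
            moreover have "f (0 + q) = f 0" using f(3,4) by blast
            ultimately show ?thesis using True by simp
          qed (use k f(2) in simp)
          ultimately show ?thesis by simp
        qed
        show ?thesis unfolding q closed_walks_def
        proof (intro CollectI conjI allI impI)
          show "restrict f {..<q} \<in> {..<q} \<rightarrow>\<^sub>E {..<p + n}"
            using PiE_mem[OF closed_walksD(1)[OF f(1)]] f(2) by auto
          fix k assume k: "k < q"
          have "Suc k mod q < q" using f(3) by simp
          then show "(restrict f {..<q} k < p) \<noteq> (restrict f {..<q} (Suc k mod q) < p)"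
            using alt[OF k] k by simp
        qed
      qed
      show "map_prod ?r ?r ` ?B \<subseteq> ?V \<times> ?V"
      proof (rule image_subsetI)
        fix x assume x: "x \<in> ?B"
        obtain f g where fg: "x = (f, g)" by (cases x)
        obtain q where q: "f \<in> ?W" "g \<in> ?W" "m = 2 * q" "0 < q" "\<forall>k<q. f (k + q) = f k \<and> g (k + q) = g k"
          using x unfolding fg by blast
        have "?r f \<in> ?V" "?r g \<in> ?V" by (rule mem[OF _ q(3,4)]; use q in blast)+
        then show "map_prod ?r ?r x \<in> ?V \<times> ?V" unfolding fg by simp
      qed
    qed (use fin in simp)
    then show ?thesis by (simp add: card_cartesian_product power2_eq_square)
  qed
  have "tied_walks p n m = ?A \<union> ?B" unfolding tied_walks_def by auto
  then have "card (tied_walks p n m) \<le> card ?A + card ?B" by (simp only: card_Un_le)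
  then show ?thesis using A B by linarith
qed

lemma tied_walks_weight:
  assumes n: "0 < n" "0 < \<kappa>" "real p \<le> \<kappa>\<^sup>2 * real n" and "0 < m"
  shows "real (card (tied_walks p n m)) * (1 / real n) ^ m \<le> (2 * real m + 4) * \<kappa> ^ m"
proof (cases "even m")
  case False
  have "tied_walks p n m = {}" unfolding tied_walks_def card_closed_walks(1)[OF False] by auto
  then show ?thesis using n by simp
next
  case True
  then obtain q where m: "m = 2 * q" by blast
  let ?W = "card (closed_walks p n m)" and ?V = "card (closed_walks p n q)"
  have V0: "0 \<le> real ?V * (1 / real n) ^ q" by simp
  have "real (card (tied_walks p n m)) \<le> real (m * ?W + ?V\<^sup>2)"
    using card_tied_walks[of p n m] m by (simp only: of_nat_le_iff) simp
  then have "real (card (tied_walks p n m)) * (1 / real n) ^ m \<le> real (m * ?W + ?V\<^sup>2) * (1 / real n) ^ m"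
    by (rule mult_right_mono) simp
  also have "\<dots> = real m * (real ?W * (1 / real n) ^ m) + (real ?V * (1 / real n) ^ q)\<^sup>2"
    unfolding m by (simp add: power_mult distrib_right power_mult_distrib power_divide power_even_eq add_divide_distrib mult_ac)
  also have "\<dots> \<le> real m * (2 * \<kappa> ^ m) + (2 * \<kappa> ^ q)\<^sup>2"
    using closed_walks_weight[OF n, of m] closed_walks_weight[OF n, of q] V0
    by (intro add_mono mult_left_mono power_mono) auto
  also have "\<dots> = (2 * real m + 4) * \<kappa> ^ m"
    unfolding m by (simp add: power_mult_distrib power_even_eq distrib_right)
  finally show ?thesis .
qed

text \<open>Encode a pair by a list \<open>w\<close> of its vertices and two words of places in that
  list. With fewer than \<open>m\<close> vertices the list costs only N^(m-1), one power less than
  the tied pairs may cost, which makes these pairs negligible for bounded entries.\<close>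

lemma card_few_vertices:
  assumes m: "0 < m"
  shows "card {(f, g) \<in> ({..<m} \<rightarrow>\<^sub>E {..<N}) \<times> ({..<m} \<rightarrow>\<^sub>E {..<N}). card (f ` {..<m} \<union> g ` {..<m}) < m}
    \<le> N ^ (m - 1) * ((m - 1) ^ m * (m - 1) ^ m)"
proof -
  let ?S = "{..<m} \<rightarrow>\<^sub>E {..<m - 1}" and ?F = "{..<m} \<rightarrow>\<^sub>E {..<N}"
  let ?X = "{(f, g) \<in> ?F \<times> ?F. card (f ` {..<m} \<union> g ` {..<m}) < m}"
  let ?D = "({..<m - 1} \<rightarrow>\<^sub>E {..<N}) \<times> (?S \<times> ?S)"
  let ?c = "\<lambda>(w, (a, b)). (\<lambda>k\<in>{..<m}. w (a k), \<lambda>k\<in>{..<m}. w (b k))"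
  have "?X \<subseteq> ?c ` ?D"
  proof clarify
    fix f g assume f: "f \<in> ?F" and g: "g \<in> ?F" and c: "card (f ` {..<m} \<union> g ` {..<m}) < m"
    let ?U = "f ` {..<m} \<union> g ` {..<m}"
    have U: "finite ?U" "?U \<subseteq> {..<N}" "?U \<noteq> {}" using f g m by auto
    define u where "u = card ?U"
    have u: "u \<le> m - 1" "0 < u" using c U by (auto simp: u_def card_gt_0_iff)
    obtain \<phi> where \<phi>: "bij_betw \<phi> {0..<u} ?U" using ex_bij_betw_nat_finite[OF U(1)] u_def by blast
    define \<psi> where "\<psi> = inv_into {0..<u} \<phi>"
    have \<psi>: "\<psi> x < u" "\<phi> (\<psi> x) = x" if "x \<in> ?U" for x
    proof -
      have "x \<in> \<phi> ` {0..<u}" using that \<phi> by (simp add: bij_betw_def)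
      then show "\<psi> x < u" "\<phi> (\<psi> x) = x"
        unfolding \<psi>_def using inv_into_into[of x \<phi> "{0..<u}"] f_inv_into_f[of x \<phi> "{0..<u}"] by auto
    qed
    \<comment> \<open>The list has the fixed length \<open>m - 1\<close>; places beyond the actual
      number \<open>u\<close> of vertices are filled with a vertex that occurs.\<close>
    define w where "w = (\<lambda>k\<in>{..<m - 1}. if k < u then \<phi> k else \<phi> 0)"
    have "\<phi> k < N" if "k < u" for k
    proof -
      have "\<phi> k \<in> ?U" using bij_betwE[OF \<phi>] that by simp
      then show ?thesis using U(2) by blast
    qed
    then have w: "w \<in> {..<m - 1} \<rightarrow>\<^sub>E {..<N}" using u(2) by (auto simp: w_def)
    have wr: "w (\<psi> x) = x" if "x \<in> ?U" for x
      using \<psi>[OF that] u(1) by (simp add: w_def)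
    define a b where "a = (\<lambda>k\<in>{..<m}. \<psi> (f k))" and "b = (\<lambda>k\<in>{..<m}. \<psi> (g k))"
    have "\<psi> (f k) < m - 1" "\<psi> (g k) < m - 1" if "k < m" for k
      using \<psi>(1)[of "f k"] \<psi>(1)[of "g k"] u(1) that by (auto intro: less_le_trans)
    then have "a \<in> ?S" "b \<in> ?S" unfolding a_def b_def by auto
    moreover have "f = (\<lambda>k\<in>{..<m}. w (a k))" "g = (\<lambda>k\<in>{..<m}. w (b k))"
      using f g wr by (auto simp: a_def b_def fun_eq_iff PiE_iff extensional_def)
    ultimately show "(f, g) \<in> ?c ` ?D"
      using w by (intro image_eqI[of _ _ "(w, (a, b))"]) auto
  qed
  moreover have fin: "finite ?D" by (intro finite_cartesian_product finite_PiE) auto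
  ultimately have "card ?X \<le> card ?D" by (rule surj_card_le[rotated])
  also have "\<dots> = N ^ (m - 1) * ((m - 1) ^ m * (m - 1) ^ m)"
    by (simp add: card_cartesian_product card_PiE)
  finally show ?thesis .
qed

context prob_space
begin

lemma expectation_prod_repeated:
  fixes Y :: "'e \<Rightarrow> 'a \<Rightarrow> real"
  assumes indep: "indep_vars (\<lambda>_. borel) Y E" and K: "finite K" "e ` K \<subseteq> E"
    and bound: "\<And>x \<omega>. x \<in> E \<Longrightarrow> \<omega> \<in> space M \<Longrightarrow> \<bar>Y x \<omega>\<bar> \<le> b"
  shows "integrable M (\<lambda>\<omega>. \<Prod>k\<in>K. Y (e k) \<omega>)"
    and "expectation (\<lambda>\<omega>. \<Prod>k\<in>K. Y (e k) \<omega>) = (\<Prod>x\<in>e ` K. expectation (\<lambda>\<omega>. Y x \<omega> ^ card {k \<in> K. e k = x}))"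
    and "\<bar>expectation (\<lambda>\<omega>. \<Prod>k\<in>K. Y (e k) \<omega>)\<bar> \<le> b ^ card K"
proof -
  let ?c = "\<lambda>x. card {k \<in> K. e k = x}"
  have meas: "Y x \<in> borel_measurable M" if "x \<in> E" for x
    using indep that by (auto simp: indep_vars_def)
  have eq: "(\<Prod>k\<in>K. Y (e k) \<omega>) = (\<Prod>x\<in>e ` K. Y x \<omega> ^ ?c x)" for \<omega>
  proof -
    have "(\<Prod>k\<in>K. Y (e k) \<omega>) = (\<Prod>x\<in>e ` K. \<Prod>k\<in>{k \<in> K. e k = x}. Y (e k) \<omega>)"
      using prod.group[OF K(1), of "e ` K" e "\<lambda>k. Y (e k) \<omega>"] K(1) by simp
    also have "\<dots> = (\<Prod>x\<in>e ` K. Y x \<omega> ^ ?c x)"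
      by (rule prod.cong) auto
    finally show ?thesis .
  qed
  have ind: "indep_vars (\<lambda>_. borel) (\<lambda>x \<omega>. Y x \<omega> ^ ?c x) (e ` K)"
    using indep_vars_compose2[OF indep_vars_subset[OF indep K(2)], of "\<lambda>x t. t ^ ?c x" "\<lambda>_. borel"] by simp
  have int: "integrable M (\<lambda>\<omega>. Y x \<omega> ^ ?c x)" if "x \<in> e ` K" for x
  proof (rule integrable_const_bound[where B = "b ^ ?c x"])
    have x: "x \<in> E" using that K(2) by blast
    show "AE \<omega> in M. norm (Y x \<omega> ^ ?c x) \<le> b ^ ?c x"
      using bound[OF x] by (intro AE_I2) (auto simp: power_abs intro!: power_mono)
    show "(\<lambda>\<omega>. Y x \<omega> ^ ?c x) \<in> borel_measurable M" using meas[OF x] by measurable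
  qed
  show I: "integrable M (\<lambda>\<omega>. \<Prod>k\<in>K. Y (e k) \<omega>)"
    unfolding eq by (rule indep_vars_integrable[OF _ ind int]) (use K in auto)
  show "expectation (\<lambda>\<omega>. \<Prod>k\<in>K. Y (e k) \<omega>) = (\<Prod>x\<in>e ` K. expectation (\<lambda>\<omega>. Y x \<omega> ^ ?c x))"
    unfolding eq by (rule indep_vars_lebesgue_integral[OF _ ind int]) (use K in auto)
  have le: "\<bar>\<Prod>k\<in>K. Y (e k) \<omega>\<bar> \<le> b ^ card K" if "\<omega> \<in> space M" for \<omega>
  proof -
    have "\<bar>\<Prod>k\<in>K. Y (e k) \<omega>\<bar> = (\<Prod>k\<in>K. \<bar>Y (e k) \<omega>\<bar>)" by (rule abs_prod)
    also have "\<dots> \<le> (\<Prod>k\<in>K. b)"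
      using bound[OF _ that] K(2) by (intro prod_mono) auto
    finally show ?thesis by simp
  qed
  have "\<bar>expectation (\<lambda>\<omega>. \<Prod>k\<in>K. Y (e k) \<omega>)\<bar> \<le> expectation (\<lambda>\<omega>. \<bar>\<Prod>k\<in>K. Y (e k) \<omega>\<bar>)"
    by (rule integral_abs_bound)
  also have "\<dots> \<le> expectation (\<lambda>\<omega>. b ^ card K)"
    by (rule integral_mono) (use I le in auto)
  finally show "\<bar>expectation (\<lambda>\<omega>. \<Prod>k\<in>K. Y (e k) \<omega>)\<bar> \<le> b ^ card K"
    by (simp add: prob_space)
qed

text \<open>The square is a sum over pairs of walks. A step used once gives expectation 0; a pair
  with fewer than \<open>m\<close> vertices is bounded crudely through \<open>b\<close>; any other
  pair is tied, and its \<open>m\<close> different steps occur twice each, giving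
  \<open>\<tau> ^ m\<close>. With \<open>b\<close> of order 1 / sqrt n the crude term is O(1 /
  n).\<close>

lemma trace_coeff_second_moment:
  fixes Y :: "nat \<times> nat \<Rightarrow> 'a \<Rightarrow> real"
  assumes indep: "indep_vars (\<lambda>_. borel) Y (alternating_edges p n)"
    and Y: "\<And>x. x \<in> alternating_edges p n \<Longrightarrow> expectation (Y x) = 0"
      "\<And>x. x \<in> alternating_edges p n \<Longrightarrow> expectation (\<lambda>\<omega>. (Y x \<omega>)\<^sup>2) = \<tau>"
    and bound: "\<And>x \<omega>. x \<in> alternating_edges p n \<Longrightarrow> \<omega> \<in> space M \<Longrightarrow> \<bar>Y x \<omega>\<bar> \<le> b"
    and \<tau>: "0 \<le> \<tau>" "\<tau> \<le> 1 / real n" and b: "0 \<le> b"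
    and n: "0 < n" "0 < \<kappa>" "real p \<le> \<kappa>\<^sup>2 * real n" and m: "0 < m"
  shows "integrable M (\<lambda>\<omega>. (trace_coeff p n (\<lambda>x. Y x \<omega>) m)\<^sup>2)"
    and "expectation (\<lambda>\<omega>. (trace_coeff p n (\<lambda>x. Y x \<omega>) m)\<^sup>2) \<le> (2 * real m + 4) * \<kappa> ^ m
      + real ((p + n) ^ (m - 1) * ((m - 1) ^ m * (m - 1) ^ m)) * b ^ (2 * m)"
proof -
  let ?W = "closed_walks p n m" and ?F = "{..<m} \<rightarrow>\<^sub>E {..<p + n}"
  let ?K = "(UNIV :: bool set) \<times> {..<m}"
  define h where "h f g = (\<lambda>(b, k). if b then g k else f k)" for f g :: "nat \<Rightarrow> nat"
  define e where "e f g = (\<lambda>(b, k). (h f g (b, k), h f g (b, Suc k mod m)))" for f g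
  let ?few = "{(f, g) \<in> ?F \<times> ?F. card (f ` {..<m} \<union> g ` {..<m}) < m}"
  have eq: "(trace_coeff p n (\<lambda>x. Y x \<omega>) m)\<^sup>2 = (\<Sum>f\<in>?W. \<Sum>g\<in>?W. \<Prod>x\<in>?K. Y (e f g x) \<omega>)" for \<omega>
  proof -
    have "(\<Prod>x\<in>?K. Y (e f g x) \<omega>) = (\<Prod>b\<in>UNIV. \<Prod>k<m. Y (e f g (b, k)) \<omega>)" for f g
      using prod.cartesian_product[of "\<lambda>b k. Y (e f g (b, k)) \<omega>" "{..<m}" UNIV] by simp
    then have "(\<Prod>x\<in>?K. Y (e f g x) \<omega>)
        = (\<Prod>k<m. Y (f k, f (Suc k mod m)) \<omega>) * (\<Prod>k<m. Y (g k, g (Suc k mod m)) \<omega>)" for f g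
      by (simp add: UNIV_bool e_def h_def)
    then show ?thesis
      unfolding trace_coeff_def power2_eq_square sum_product by simp
  qed
  have eE: "e f g ` ?K \<subseteq> alternating_edges p n" if fg: "f \<in> ?W" "g \<in> ?W" for f g
  proof -
    have "(f k, f (Suc k mod m)) \<in> alternating_edges p n" if f: "f \<in> ?W" and k: "k < m" for f k
    proof -
      have "f k < p + n" "f (Suc k mod m) < p + n"
        using PiE_mem[OF closed_walksD(1)[OF f]] k m by simp_all
      then show ?thesis using closed_walksD(2)[OF f k] by (simp add: alternating_edges_def)
    qed
    then show ?thesis using fg by (auto simp: e_def h_def)
  qed
  note rep = expectation_prod_repeated[OF indep _ eE bound]
  have intK: "integrable M (\<lambda>\<omega>. \<Prod>x\<in>?K. Y (e f g x) \<omega>)" if "f \<in> ?W" "g \<in> ?W" for f g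
    by (rule rep(1)) (use that in simp_all)
  show "integrable M (\<lambda>\<omega>. (trace_coeff p n (\<lambda>x. Y x \<omega>) m)\<^sup>2)"
    unfolding eq by (intro Bochner_Integration.integrable_sum intK)
  have bd: "expectation (\<lambda>\<omega>. \<Prod>x\<in>?K. Y (e f g x) \<omega>)
      \<le> (if (f, g) \<in> tied_walks p n m then (1 / real n) ^ m else 0) + (if (f, g) \<in> ?few then b ^ (2 * m) else 0)"
    (is "?E \<le> ?A + ?B") if fg: "f \<in> ?W" "g \<in> ?W" for f g
  proof -
    have AB: "0 \<le> ?A" "0 \<le> ?B" using b by auto
    have finK: "finite ?K" by simp
    have Eeq: "?E = (\<Prod>y\<in>e f g ` ?K. expectation (\<lambda>\<omega>. Y y \<omega> ^ card {x \<in> ?K. e f g x = y}))"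
      by (rule rep(2)[OF finK fg]) simp_all
    have Ele: "\<bar>?E\<bar> \<le> b ^ card ?K"
      by (rule rep(3)[OF finK fg]) simp_all
    have cardK: "card ?K = 2 * m" by simp
    show ?thesis
    proof (cases "\<forall>x\<in>?K. 2 \<le> card {x' \<in> ?K. e f g x' = e f g x}")
      case False
      then obtain x where x: "x \<in> ?K" "card {x' \<in> ?K. e f g x' = e f g x} < 2" by fastforce
      have "x \<in> {x' \<in> ?K. e f g x' = e f g x}" using x(1) by simp
      then have "0 < card {x' \<in> ?K. e f g x' = e f g x}" using finK by (subst card_gt_0_iff) auto
      then have one: "card {x' \<in> ?K. e f g x' = e f g x} = 1" using x(2) by simp
      have "expectation (\<lambda>\<omega>. Y (e f g x) \<omega> ^ card {x' \<in> ?K. e f g x' = e f g x}) = 0"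
        unfolding one using Y(1)[of "e f g x"] eE[OF fg] x(1) by auto
      then have "?E = 0" unfolding Eeq using x(1) finK by (intro prod_zero) auto
      then show ?thesis using AB by simp
    next
      case True
      have hK: "h f g ` ?K = f ` {..<m} \<union> g ` {..<m}"
      proof -
        have "?K = Pair False ` {..<m} \<union> Pair True ` {..<m}"
          using UNIV_bool by auto
        then show ?thesis by (simp add: image_Un image_image h_def)
      qed
      show ?thesis
      proof (cases "card (h f g ` ?K) < m")
        case True
        then have "(f, g) \<in> ?few"
          using closed_walksD(1)[OF fg(1)] closed_walksD(1)[OF fg(2)] unfolding hK by simp
        then have "?B = b ^ (2 * m)" by (simp only: if_True)
        then show ?thesis using AB Ele unfolding cardK by linarith
      next
        case many: False
        have r2: "2 \<le> card {x' \<in> ?K. e f g x' = e f g x}" if "x \<in> ?K" for x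
          using True that by (rule bspec)
        have mh: "m \<le> card (h f g ` ?K)" using many by simp
        have two: "card {x' \<in> ?K. e f g x' = e f g x} = 2" if "x \<in> ?K" for x
          using repeated_steps(1)[OF m r2[unfolded e_def h_def] mh[unfolded h_def] that, folded h_def, folded e_def] .
        have "(\<exists>s<m. \<forall>k<m. g k = f ((k + s) mod m)) \<or>
            (\<exists>q. m = 2 * q \<and> 0 < q \<and> (\<forall>k<q. f (k + q) = f k \<and> g (k + q) = g k))"
          by (rule repeated_steps(2)[OF m r2[unfolded e_def h_def] mh[unfolded h_def]])
        then have "(f, g) \<in> tied_walks p n m"
          using fg unfolding tied_walks_def by blast
        then have A: "?A = (1 / real n) ^ m" by simp
        have "?E = (\<Prod>y\<in>e f g ` ?K. \<tau>)"
          unfolding Eeq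
        proof (rule prod.cong[OF refl])
          fix y assume y: "y \<in> e f g ` ?K"
          then obtain x where x: "x \<in> ?K" "y = e f g x" by blast
          show "expectation (\<lambda>\<omega>. Y y \<omega> ^ card {x \<in> ?K. e f g x = y}) = \<tau>"
            unfolding x(2) two[OF x(1)] using Y(2) eE[OF fg] x by blast
        qed
        also have "\<dots> = \<tau> ^ card (e f g ` ?K)" by simp
        also have "card (e f g ` ?K) = m"
        proof -
          have "(\<Sum>y\<in>e f g ` ?K. card {x \<in> ?K. e f g x = y}) = 2 * m"
            using sum.group[OF finK, of "e f g ` ?K" "e f g" "\<lambda>_. 1 :: nat"] finK cardK by simp
          moreover have "(\<Sum>y\<in>e f g ` ?K. card {x \<in> ?K. e f g x = y}) = (\<Sum>y\<in>e f g ` ?K. 2)"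
            by (rule sum.cong) (use two in auto)
          ultimately show ?thesis by simp
        qed
        also have "\<tau> ^ m \<le> (1 / real n) ^ m" using \<tau> by (intro power_mono) auto
        finally show ?thesis using A AB by linarith
      qed
    qed
  qed
  have tsub: "tied_walks p n m \<subseteq> ?W \<times> ?W" unfolding tied_walks_def by blast
  have finW: "finite (?W \<times> ?W)" by (simp add: finite_closed_walks)
  have "expectation (\<lambda>\<omega>. (trace_coeff p n (\<lambda>x. Y x \<omega>) m)\<^sup>2)
      = (\<Sum>f\<in>?W. \<Sum>g\<in>?W. expectation (\<lambda>\<omega>. \<Prod>x\<in>?K. Y (e f g x) \<omega>))"
    unfolding eq
  proof (rule trans[OF Bochner_Integration.integral_sum])
    show "integrable M (\<lambda>\<omega>. \<Sum>g\<in>?W. \<Prod>x\<in>?K. Y (e f g x) \<omega>)" if "f \<in> ?W" for f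
      by (rule Bochner_Integration.integrable_sum) (rule intK[OF that])
    show "(\<Sum>f\<in>?W. expectation (\<lambda>\<omega>. \<Sum>g\<in>?W. \<Prod>x\<in>?K. Y (e f g x) \<omega>))
        = (\<Sum>f\<in>?W. \<Sum>g\<in>?W. expectation (\<lambda>\<omega>. \<Prod>x\<in>?K. Y (e f g x) \<omega>))"
      by (rule sum.cong[OF refl], rule Bochner_Integration.integral_sum, rule intK)
  qed
  also have "\<dots> \<le> (\<Sum>f\<in>?W. \<Sum>g\<in>?W. (if (f, g) \<in> tied_walks p n m then (1 / real n) ^ m else 0)
      + (if (f, g) \<in> ?few then b ^ (2 * m) else 0))"
    by (intro sum_mono bd)
  also have "\<dots> = (\<Sum>x\<in>?W \<times> ?W. (if x \<in> tied_walks p n m then (1 / real n) ^ m else 0)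
      + (if x \<in> ?few then b ^ (2 * m) else 0))"
  proof -
    have "(\<Sum>f\<in>?W. \<Sum>g\<in>?W. G (f, g)) = (\<Sum>x\<in>?W \<times> ?W. G x)" for G :: "_ \<Rightarrow> real"
      by (simp add: sum.cartesian_product)
    from this[of "\<lambda>x. (if x \<in> tied_walks p n m then (1 / real n) ^ m else 0)
      + (if x \<in> ?few then b ^ (2 * m) else 0)"] show ?thesis .
  qed
  also have "\<dots> = (\<Sum>x\<in>?W \<times> ?W. if x \<in> tied_walks p n m then (1 / real n) ^ m else 0)
      + (\<Sum>x\<in>?W \<times> ?W. if x \<in> ?few then b ^ (2 * m) else 0)"
    by (rule sum.distrib)
  also have "(\<Sum>x\<in>?W \<times> ?W. if x \<in> tied_walks p n m then (1 / real n) ^ m else 0)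
      = real (card (tied_walks p n m)) * (1 / real n) ^ m"
  proof -
    have "?W \<times> ?W \<inter> tied_walks p n m = tied_walks p n m" using tsub by blast
    then show ?thesis using finW by (simp add: sum.If_cases)
  qed
  also have "\<dots> \<le> (2 * real m + 4) * \<kappa> ^ m" by (rule tied_walks_weight[OF n m])
  also have "(\<Sum>x\<in>?W \<times> ?W. if x \<in> ?few then b ^ (2 * m) else 0) \<le>
      real ((p + n) ^ (m - 1) * ((m - 1) ^ m * (m - 1) ^ m)) * b ^ (2 * m)"
  proof -
    have fin: "finite ?few"
      by (rule finite_subset[of _ "?F \<times> ?F"]) (auto intro!: finite_PiE)
    have "(\<Sum>x\<in>?W \<times> ?W. if x \<in> ?few then b ^ (2 * m) else 0) = real (card (?W \<times> ?W \<inter> ?few)) * b ^ (2 * m)"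
      using finW by (simp add: sum.If_cases)
    also have "card (?W \<times> ?W \<inter> ?few) \<le> card ?few"
      by (rule card_mono[OF fin]) blast
    then have "card (?W \<times> ?W \<inter> ?few) \<le> (p + n) ^ (m - 1) * ((m - 1) ^ m * (m - 1) ^ m)"
      using card_few_vertices[OF m, of "p + n"] by (rule le_trans)
    then have "real (card (?W \<times> ?W \<inter> ?few)) * b ^ (2 * m) \<le> real ((p + n) ^ (m - 1) * ((m - 1) ^ m * (m - 1) ^ m)) * b ^ (2 * m)"
      using b by (intro mult_right_mono) (simp_all only: of_nat_le_iff zero_le_power)
    finally show ?thesis .
  qed
  finally show "expectation (\<lambda>\<omega>. (trace_coeff p n (\<lambda>x. Y x \<omega>) m)\<^sup>2) \<le> (2 * real m + 4) * \<kappa> ^ m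
      + real ((p + n) ^ (m - 1) * ((m - 1) ^ m * (m - 1) ^ m)) * b ^ (2 * m)"
    by simp
qed

end

subsection \<open>Locating the eigenvalues\<close>

lemma char_det_eigenvalue_listing:
  fixes Y :: "real mat"
  assumes Y: "Y \<in> carrier_mat (p + n) (p + n)" and lam: "eigenvalue_listing p n Y lam"
  shows "det (1\<^sub>m (p + n) - z \<cdot>\<^sub>m map_mat complex_of_real Y) = (\<Prod>i=1..min n p. (1 - z * lam i) * (1 + z * lam i))"
proof -
  let ?A = "map_mat complex_of_real Y"
  obtain vs where vs: "char_poly ?A = (\<Prod>\<nu>\<leftarrow>vs. [:- \<nu>, 1:])"
    "det (1\<^sub>m (p + n) - z \<cdot>\<^sub>m ?A) = (\<Prod>\<nu>\<leftarrow>vs. 1 - z * \<nu>)"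
    using eigenvalue_list_exists[of ?A "p + n"] Y by auto
  have "proots (\<Prod>\<nu>\<leftarrow>us. [:- \<nu>, 1:]) = mset us" for us :: "complex list"
  proof (induction us)
    case (Cons a us)
    have "(\<Prod>\<nu>\<leftarrow>us. [:- \<nu>, 1:]) \<noteq> 0" by (auto simp: prod_list_zero_iff)
    then have "proots ([:- a, 1:] * (\<Prod>\<nu>\<leftarrow>us. [:- \<nu>, 1:])) = proots [:- a, 1:] + proots (\<Prod>\<nu>\<leftarrow>us. [:- \<nu>, 1:])"
      by (rule proots_mult[rotated]) simp
    then show ?case using Cons by (simp del: mult_pCons_left)
  qed simp
  then have "proots (char_poly ?A) = mset vs" unfolding vs(1) .
  then have ms: "mset vs = (\<Sum>i\<in>{1..min n p}. {#lam i, - lam i#}) + replicate_mset (p + n - 2 * min n p) 0"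
    using conjunct1[OF lam[unfolded eigenvalue_listing_def]] by (simp only: eigenvalue_mset_def)
  have "(\<Prod>\<nu>\<leftarrow>vs. 1 - z * \<nu>) = (\<Prod>\<nu>\<in>#mset vs. 1 - z * \<nu>)"
    by (metis mset_map prod_mset_prod_list)
  also have "\<dots> = (\<Prod>\<nu>\<in>#(\<Sum>i\<in>{1..min n p}. {#lam i, - lam i#}). 1 - z * \<nu>)"
    unfolding ms by simp
  also have "\<dots> = (\<Prod>i=1..min n p. (1 - z * lam i) * (1 + z * lam i))"
  proof -
    have "(\<Prod>\<nu>\<in>#(\<Sum>i\<in>I. {#lam i, - lam i#}). 1 - z * \<nu>) = (\<Prod>i\<in>I. (1 - z * lam i) * (1 + z * lam i))"
      if "finite I" for I
      using that by (induction I) (auto simp: mult_ac)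
    then show ?thesis by blast
  qed
  finally show ?thesis using vs(2) by simp
qed

text \<open>Normalised to 1 at 0, with roots 1 / \<open>a i\<close> and - 1 / \<open>a i\<close>; a
  vanishing \<open>a i\<close> contributes the factor 1. It represents det (1 - z Y) as well as the
  limit D.\<close>

definition pair_poly :: "nat \<Rightarrow> (nat \<Rightarrow> complex) \<Rightarrow> complex poly" where
  "pair_poly q a = (\<Prod>i=1..q. [:1, - a i:] * [:1, a i:])"

lemma poly_pair_poly: "poly (pair_poly q a) z = (\<Prod>i=1..q. (1 - z * a i) * (1 + z * a i))"
  unfolding pair_poly_def poly_prod poly_mult by (rule prod.cong) simp_all

lemma pair_poly_nonzero: "pair_poly q a \<noteq> 0"
  unfolding pair_poly_def by (simp add: prod_zero_iff)

lemma proots_one_linear: "proots [:1, a:] = (if a = 0 then {#} else {#- 1 / a#})" for a :: complex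
proof (cases "a = 0")
  case False
  have "[:1, a:] = Polynomial.smult a [:1 / a, 1:]" using False by simp
  then have "proots [:1, a:] = proots (Polynomial.smult a [:1 / a, 1:])" by simp
  also have "\<dots> = {#- (1 / a)#}" using False by (simp only: proots_smult proots_linear_factor not_False_eq_True)
  finally show ?thesis using False by simp
qed simp

lemma count_proots_pair_poly:
  assumes \<tau>: "0 < \<tau>"
  shows "size (filter_mset (\<lambda>z. cmod z < 1 / \<tau>) (proots (pair_poly q a))) = 2 * card {i \<in> {1..q}. \<tau> < cmod (a i)}"
proof -
  have lin: "size (filter_mset (\<lambda>z. cmod z < 1 / \<tau>) (proots [:1, b:])) = (if \<tau> < cmod b then 1 else 0)" for b :: complex
  proof (cases "b = 0")
    case False
    then have "cmod (- 1 / b) < 1 / \<tau> \<longleftrightarrow> \<tau> < cmod b"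
      using \<tau> by (simp add: norm_divide field_simps)
    then show ?thesis using False by (simp add: proots_one_linear)
  qed (use \<tau> in simp)
  have nz: "[:1, - a i:] * [:1, a i:] \<noteq> 0" for i by simp
  have "proots (pair_poly q a) = (\<Sum>i=1..q. proots [:1, - a i:] + proots [:1, a i:])"
  proof -
    have "proots (pair_poly q a) = (\<Sum>i=1..q. proots ([:1, - a i:] * [:1, a i:]))"
      unfolding pair_poly_def using nz by (intro proots_prod) auto
    also have "\<dots> = (\<Sum>i=1..q. proots [:1, - a i:] + proots [:1, a i:])"
      by (rule sum.cong[OF refl], rule proots_mult) simp_all
    finally show ?thesis .
  qed
  also have "size (filter_mset (\<lambda>z. cmod z < 1 / \<tau>) \<dots>) = (\<Sum>i=1..q. 2 * (if \<tau> < cmod (a i) then 1 else 0))"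
  proof -
    have "size (filter_mset P (\<Sum>i\<in>I. proots [:1, - a i:] + proots [:1, a i:]))
        = (\<Sum>i\<in>I. size (filter_mset P (proots [:1, - a i:])) + size (filter_mset P (proots [:1, a i:])))"
      if "finite I" for I P
      using that by (induction I) auto
    then show ?thesis using lin by (simp add: sum_distrib_left[symmetric] mult_2)
  qed
  also have "\<dots> = 2 * card {i \<in> {1..q}. \<tau> < cmod (a i)}"
    by (simp add: sum_distrib_left[symmetric] sum.If_cases Int_def conj_commute)
  finally show ?thesis .
qed

text \<open>Pigeonhole: with \<open>\<sigma> = \<epsilon> / (2 * (real k + 1))\<close> there is room
  for \<open>k + 1\<close> points at mutual distance at least \<open>2 * \<sigma>\<close>. Each
  \<open>d j\<close> comes closer than \<open>\<sigma>\<close> to at most one of them, so some point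
  stays clear of all.\<close>

lemma ex_gap:
  fixes d :: "nat \<Rightarrow> real"
  assumes "0 < \<epsilon>"
  shows "\<exists>\<tau>. a < \<tau> \<and> \<tau> < a + \<epsilon> \<and> (\<forall>j\<in>{1..k}. \<epsilon> / (2 * (real k + 1)) \<le> \<bar>\<tau> - d j\<bar>)"
proof (rule ccontr)
  define \<sigma> where "\<sigma> = \<epsilon> / (2 * (real k + 1))"
  have \<sigma>: "0 < \<sigma>" "2 * \<sigma> * (real k + 1) = \<epsilon>" using assms by (auto simp: \<sigma>_def field_simps)
  define t where "t l = a + \<sigma> * (2 * real l + 1)" for l :: nat
  have tl: "a < t l" "t l < a + \<epsilon>" if "l \<le> k" for l
  proof -
    show "a < t l" using \<sigma>(1) by (simp add: t_def)
    have "\<sigma> * (2 * real l + 1) < \<sigma> * (2 * (real k + 1))"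
      using \<sigma>(1) that by (intro mult_strict_left_mono) auto
    then show "t l < a + \<epsilon>" using \<sigma>(2) by (simp add: t_def mult_ac)
  qed
  assume "\<not> (\<exists>\<tau>. a < \<tau> \<and> \<tau> < a + \<epsilon> \<and> (\<forall>j\<in>{1..k}. \<epsilon> / (2 * (real k + 1)) \<le> \<bar>\<tau> - d j\<bar>))"
  then have "\<forall>l\<in>{..k}. \<exists>j\<in>{1..k}. \<bar>t l - d j\<bar> < \<sigma>"
    using tl unfolding \<sigma>_def by (meson atMost_iff not_le)
  then obtain J where J: "\<And>l. l \<in> {..k} \<Longrightarrow> J l \<in> {1..k} \<and> \<bar>t l - d (J l)\<bar> < \<sigma>"
    by metis
  have "inj_on J {..k}"
  proof (rule inj_onI)
    fix l l' assume l: "l \<in> {..k}" "l' \<in> {..k}" "J l = J l'"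
    have "\<bar>t l - d (J l)\<bar> < \<sigma>" "\<bar>t l' - d (J l)\<bar> < \<sigma>"
      using J[OF l(1)] J[OF l(2)] l(3) by metis+
    then have "\<bar>t l - t l'\<bar> < 2 * \<sigma>" by linarith
    moreover have "t l - t l' = \<sigma> * (2 * (real l - real l'))" by (simp add: t_def algebra_simps)
    ultimately have "\<sigma> * (2 * \<bar>real l - real l'\<bar>) < \<sigma> * 2" using \<sigma>(1) by (simp add: abs_mult)
    then have "\<bar>real l - real l'\<bar> < 1" using \<sigma>(1) by simp
    then show "l = l'" by linarith
  qed
  then have "card {..k} \<le> card {1..k}"
  proof (rule card_inj_on_le)
    show "J ` {..k} \<subseteq> {1..k}" using J by blast
  qed simp
  then show False by simp
qed

text \<open>On the circle of radius 1 / \<open>\<tau>\<close> each factor of D is at least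
  \<open>\<bar>\<tau> - d j\<bar> * (\<tau> + d j) / \<tau>\<^sup>2\<close>, hence at least
  \<open>\<sigma> / R\<close>. So D dominates the error \<open>\<eta>\<close>, and Rouche compares
  det (1 - z Y) with Q D. As \<open>Q\<close> has no zero in the disc, the counts for
  \<open>lam\<close> and \<open>d\<close> agree, both doubled by the sign symmetry.\<close>

lemma spike_count:
  fixes d :: "nat \<Rightarrow> real" and Q :: "complex poly" and D' :: "complex \<Rightarrow> complex"
  assumes r: "0 < r" and \<tau>: "1 / r < \<tau>" "\<tau> \<le> R" and \<sigma>: "0 < \<sigma>"
    and gap: "\<And>j. j \<in> {1..k} \<Longrightarrow> \<sigma> \<le> \<bar>\<tau> - d j\<bar>" and d: "\<And>j. j \<in> {1..k} \<Longrightarrow> 0 \<le> d j"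
    and Q: "\<And>z. cmod z \<le> r \<Longrightarrow> poly Q z \<noteq> 0"
    and P: "\<And>z. cmod z \<le> r \<Longrightarrow> poly (pair_poly q lam) z = poly Q z * D' z"
    and D': "\<And>z. cmod z \<le> r \<Longrightarrow> cmod (D' z - poly (pair_poly k (\<lambda>j. complex_of_real (d j))) z) \<le> \<eta>"
    and \<eta>: "\<eta> < (\<sigma> / R) ^ k"
  shows "card {i \<in> {1..q}. \<tau> < cmod (lam i)} = card {j \<in> {1..k}. \<tau> < d j}"
proof -
  let ?D = "pair_poly k (\<lambda>j. complex_of_real (d j))"
  have \<tau>0: "0 < \<tau>" using r \<tau> less_trans[of 0 "1 / r" \<tau>] by simp
  have zr: "1 / \<tau> < r" using r \<tau> \<tau>0 by (simp add: field_simps)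
  have less: "cmod (poly (pair_poly q lam) z - poly (Q * ?D) z) < cmod (poly (Q * ?D) z)" if z: "cmod z = 1 / \<tau>" for z
  proof -
    have zle: "cmod z \<le> r" using z zr by simp
    have fac: "\<sigma> / R \<le> cmod ((1 - z * complex_of_real (d j)) * (1 + z * complex_of_real (d j)))" if j: "j \<in> {1..k}" for j
    proof -
      have "(1 - z * complex_of_real (d j)) * (1 + z * complex_of_real (d j)) = 1 - z\<^sup>2 * complex_of_real ((d j)\<^sup>2)"
        by (simp add: algebra_simps power2_eq_square)
      moreover have "\<bar>1 - (d j)\<^sup>2 / \<tau>\<^sup>2\<bar> \<le> cmod (1 - z\<^sup>2 * complex_of_real ((d j)\<^sup>2))"
        using norm_triangle_ineq3[of 1 "z\<^sup>2 * complex_of_real ((d j)\<^sup>2)"] z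
        by (simp add: norm_mult norm_power power_divide)
      moreover have "\<bar>1 - (d j)\<^sup>2 / \<tau>\<^sup>2\<bar> = \<bar>\<tau> - d j\<bar> * ((\<tau> + d j) / \<tau>) / \<tau>"
      proof -
        have "1 - (d j)\<^sup>2 / \<tau>\<^sup>2 = (\<tau> - d j) * ((\<tau> + d j) / \<tau> / \<tau>)"
          using \<tau>0 by (simp add: field_simps power2_eq_square)
        then show ?thesis using \<tau>0 d[OF j] by (simp add: abs_mult)
      qed
      moreover have "\<sigma> * 1 / R \<le> \<bar>\<tau> - d j\<bar> * ((\<tau> + d j) / \<tau>) / \<tau>"
        using gap[OF j] \<sigma> \<tau>0 \<tau>(2) d[OF j] by (intro frac_le mult_mono) auto
      ultimately show ?thesis by simp
    qed
    have "(\<sigma> / R) ^ k = (\<Prod>j=1..k. \<sigma> / R)" by simp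
    also have "\<dots> \<le> (\<Prod>j=1..k. cmod ((1 - z * complex_of_real (d j)) * (1 + z * complex_of_real (d j))))"
      using fac \<sigma> \<tau>0 \<tau>(2) by (intro prod_mono) auto
    also have "\<dots> = cmod (poly ?D z)" by (simp only: poly_pair_poly prod_norm)
    finally have "cmod (D' z - poly ?D z) < cmod (poly ?D z)" using D'[OF zle] \<eta> by simp
    then have "cmod (poly Q z) * cmod (D' z - poly ?D z) < cmod (poly Q z) * cmod (poly ?D z)"
      using Q[OF zle] by (intro mult_strict_left_mono) auto
    then show ?thesis
      unfolding P[OF zle] poly_mult norm_mult[symmetric] by (simp add: right_diff_distrib)
  qed
  have Q0: "Q \<noteq> 0" using Q[of 0] r by auto
  have "size (filter_mset (\<lambda>z. cmod z < 1 / \<tau>) (proots (pair_poly q lam)))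
      = size (filter_mset (\<lambda>z. cmod z < 1 / \<tau>) (proots (Q * ?D)))"
    by (rule rouche_proots[OF _ less]) (use \<tau>0 in auto)
  also have "proots (Q * ?D) = proots Q + proots ?D"
    by (rule proots_mult[OF Q0 pair_poly_nonzero])
  also have "filter_mset (\<lambda>z. cmod z < 1 / \<tau>) (proots Q) = {#}"
  proof -
    have "\<not> cmod z < 1 / \<tau>" if "z \<in># proots Q" for z
      using that Q0 Q[of z] zr by auto
    then have "filter_mset (\<lambda>z. cmod z < 1 / \<tau>) (proots Q) = filter_mset (\<lambda>_. False) (proots Q)"
      by (intro filter_mset_cong) auto
    then show ?thesis by simp
  qed
  then have "filter_mset (\<lambda>z. cmod z < 1 / \<tau>) (proots Q + proots ?D) = filter_mset (\<lambda>z. cmod z < 1 / \<tau>) (proots ?D)"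
    by simp
  finally have "2 * card {i \<in> {1..q}. \<tau> < cmod (lam i)} = 2 * card {j \<in> {1..k}. \<tau> < cmod (complex_of_real (d j))}"
    unfolding count_proots_pair_poly[OF \<tau>0] .
  moreover have "{j \<in> {1..k}. \<tau> < cmod (complex_of_real (d j))} = {j \<in> {1..k}. \<tau> < d j}"
    using d by auto
  ultimately show ?thesis by simp
qed

lemma eigenvalue_near_spike:
  fixes d :: "nat \<Rightarrow> real" and Q :: "complex poly" and D' :: "complex \<Rightarrow> complex"
  assumes r: "0 < r" and i: "1 \<le> i" "i \<le> k" and \<epsilon>: "0 < \<epsilon>" "\<epsilon> \<le> 1" "1 / r + \<epsilon> < d i"
    and d: "\<And>j. j \<in> {1..k} \<Longrightarrow> 0 \<le> d j \<and> d j < C"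
    and mono: "\<And>j l. j \<in> {1..k} \<Longrightarrow> l \<in> {1..k} \<Longrightarrow> j \<le> l \<Longrightarrow> d l \<le> d j"
    and arg: "\<And>j. j \<in> {1..q} \<Longrightarrow> - pi / 2 < Arg (lam j) \<and> Arg (lam j) \<le> pi / 2"
    and sorted: "\<And>j l. j \<in> {1..q} \<Longrightarrow> l \<in> {1..q} \<Longrightarrow> j \<le> l \<Longrightarrow> cmod (lam l) \<le> cmod (lam j)"
    and Q: "\<And>z. cmod z \<le> r \<Longrightarrow> poly Q z \<noteq> 0"
    and P: "\<And>z. cmod z \<le> r \<Longrightarrow> poly (pair_poly q lam) z = poly Q z * D' z"
    and D': "\<And>z. cmod z \<le> r \<Longrightarrow> cmod (D' z - poly (pair_poly k (\<lambda>j. complex_of_real (d j))) z) \<le> \<eta>"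
    and \<eta>: "\<eta> < (\<epsilon> / (2 * (real k + 1)) / (C + 1)) ^ k"
  shows "i \<le> q \<and> cmod (lam i - complex_of_real (d i)) \<le> 3 * \<epsilon>"
proof -
  define \<sigma> where "\<sigma> = \<epsilon> / (2 * (real k + 1))"
  have \<sigma>: "0 < \<sigma>" "\<sigma> \<le> \<epsilon>" using \<epsilon>(1) by (auto simp: \<sigma>_def divide_le_eq)
  have di: "0 \<le> d i" "d i < C" using d i by auto
  have dpos: "\<And>j. j \<in> {1..k} \<Longrightarrow> 0 \<le> d j" using d by blast
  note count = spike_count[OF r _ _ \<sigma>(1) _ dpos Q P D' \<eta>[folded \<sigma>_def]]
  \<comment> \<open>Two radii bracket \<open>d i\<close>: fewer than \<open>i\<close> eigenvalues
    exceed \<open>\<tau>\<close> in modulus and at least \<open>i\<close> exceed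
    \<open>\<tau>'\<close>, which pins down the modulus of the \<open>i\<close>-th.\<close>
  obtain \<tau> where \<tau>: "d i < \<tau>" "\<tau> < d i + \<epsilon>" "\<forall>j\<in>{1..k}. \<sigma> \<le> \<bar>\<tau> - d j\<bar>"
    using ex_gap[OF \<epsilon>(1), of "d i" k d] unfolding \<sigma>_def by blast
  obtain \<tau>' where \<tau>': "d i - \<epsilon> < \<tau>'" "\<tau>' < d i" "\<forall>j\<in>{1..k}. \<sigma> \<le> \<bar>\<tau>' - d j\<bar>"
    using ex_gap[OF \<epsilon>(1), of "d i - \<epsilon>" k d] unfolding \<sigma>_def by auto
  have c1: "card {l \<in> {1..q}. \<tau> < cmod (lam l)} = card {j \<in> {1..k}. \<tau> < d j}"
    by (rule count) (use \<tau> \<epsilon> di in auto)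
  have c2: "card {l \<in> {1..q}. \<tau>' < cmod (lam l)} = card {j \<in> {1..k}. \<tau>' < d j}"
    by (rule count) (use \<tau>' \<epsilon> di in auto)
  have "{1..i} \<subseteq> {j \<in> {1..k}. \<tau>' < d j}"
  proof
    fix j assume j: "j \<in> {1..i}"
    then have "d i \<le> d j" using i by (intro mono) auto
    then show "j \<in> {j \<in> {1..k}. \<tau>' < d j}" using j i \<tau>'(2) by auto
  qed
  then have "card {1..i} \<le> card {j \<in> {1..k}. \<tau>' < d j}" by (intro card_mono) auto
  then have ge: "i \<le> card {l \<in> {1..q}. \<tau>' < cmod (lam l)}" using c2 by simp
  also have "\<dots> \<le> card {1..q}" by (intro card_mono) auto
  finally have iq: "i \<le> q" by simp
  have lower: "\<tau>' < cmod (lam i)"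
  proof (rule ccontr)
    assume n: "\<not> \<tau>' < cmod (lam i)"
    have "{l \<in> {1..q}. \<tau>' < cmod (lam l)} \<subseteq> {1..<i}"
    proof
      fix l assume l: "l \<in> {l \<in> {1..q}. \<tau>' < cmod (lam l)}"
      have "\<not> i \<le> l"
      proof
        assume "i \<le> l"
        then have "cmod (lam l) \<le> cmod (lam i)" using l i iq by (intro sorted) auto
        then show False using l n by auto
      qed
      then show "l \<in> {1..<i}" using l by auto
    qed
    then have "card {l \<in> {1..q}. \<tau>' < cmod (lam l)} \<le> card {1..<i}" by (intro card_mono) auto
    then show False using ge i by simp
  qed
  have upper: "cmod (lam i) \<le> \<tau>"
  proof (rule ccontr)
    assume n: "\<not> cmod (lam i) \<le> \<tau>"
    have "{1..i} \<subseteq> {l \<in> {1..q}. \<tau> < cmod (lam l)}"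
    proof
      fix l assume l: "l \<in> {1..i}"
      then have "cmod (lam i) \<le> cmod (lam l)" using i iq by (intro sorted) auto
      then show "l \<in> {l \<in> {1..q}. \<tau> < cmod (lam l)}" using l iq n by auto
    qed
    then have "card {1..i} \<le> card {l \<in> {1..q}. \<tau> < cmod (lam l)}" by (intro card_mono) auto
    moreover have "{j \<in> {1..k}. \<tau> < d j} \<subseteq> {1..<i}"
    proof
      fix j assume j: "j \<in> {j \<in> {1..k}. \<tau> < d j}"
      have "\<not> i \<le> j"
      proof
        assume "i \<le> j"
        then have "d j \<le> d i" using j i by (intro mono) auto
        then show False using j \<tau>(1) by auto
      qed
      then show "j \<in> {1..<i}" using j by auto
    qed
    then have "card {j \<in> {1..k}. \<tau> < d j} \<le> card {1..<i}" by (intro card_mono) auto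
    ultimately show False using c1 i by simp
  qed
  have pos: "1 / r < cmod (lam i)" using lower \<tau>'(1) \<epsilon>(3) by linarith
  then have nz: "0 < cmod (lam i)" using r by (meson less_trans zero_less_divide_1_iff)
  define z where "z = 1 / lam i"
  have zr: "cmod z \<le> r"
    using pos nz r by (simp add: z_def norm_divide field_simps)
  have "poly (pair_poly q lam) z = 0"
    unfolding poly_pair_poly using i iq nz by (intro prod_zero bexI[of _ i]) (auto simp: z_def)
  then have "D' z = 0" using P[OF zr] Q[OF zr] by simp
  then have "cmod (poly (pair_poly k (\<lambda>j. complex_of_real (d j))) z) < (\<sigma> / (C + 1)) ^ k"
    using D'[OF zr] \<eta> unfolding \<sigma>_def by simp
  then have small: "(\<Prod>j=1..k. cmod ((1 - z * complex_of_real (d j)) * (1 + z * complex_of_real (d j)))) < (\<Prod>j=1..k. \<sigma> / (C + 1))"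
    by (simp add: poly_pair_poly prod_norm norm_mult)
  \<comment> \<open>The point 1 / \<open>lam i\<close> is a zero of \<open>D'\<close>, so the
    product for D is below the \<open>k\<close>-th power of \<open>\<sigma> / (C + 1)\<close> there,
    and some factor must be below \<open>\<sigma> / (C + 1)\<close>.\<close>
  obtain j where j: "j \<in> {1..k}"
    and jl: "cmod ((1 - z * complex_of_real (d j)) * (1 + z * complex_of_real (d j))) < \<sigma> / (C + 1)"
  proof (rule ccontr)
    assume "\<not> thesis"
    then have "\<And>j. j \<in> {1..k} \<Longrightarrow> \<sigma> / (C + 1) \<le> cmod ((1 - z * complex_of_real (d j)) * (1 + z * complex_of_real (d j)))"
      using that by (meson not_le)
    then have "(\<Prod>j=1..k. \<sigma> / (C + 1)) \<le> (\<Prod>j=1..k. cmod ((1 - z * complex_of_real (d j)) * (1 + z * complex_of_real (d j))))"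
      using \<sigma>(1) di by (intro prod_mono) auto
    then show False using small by simp
  qed
  have re: "0 \<le> Re (lam i)"
  proof -
    have "\<bar>Arg (lam i)\<bar> \<le> pi / 2" using arg[of i] i iq by auto
    then have "0 \<le> cos (Arg (lam i))" by (intro cos_ge_zero) auto
    moreover have "Re (lam i) = cmod (lam i) * cos (Arg (lam i))"
      by (metis Re_rcis rcis_cmod_Arg)
    ultimately show ?thesis by simp
  qed
  \<comment> \<open>As \<open>Re (lam i)\<close> and \<open>d j\<close> are nonnegative, adding
    \<open>d j\<close> does not decrease the modulus, so the smallness of the factor has to come
    from \<open>lam i\<close> minus \<open>d j\<close>.\<close>
  have plus: "cmod (lam i) \<le> cmod (lam i + complex_of_real (d j))"
  proof -
    have "(Re (lam i))\<^sup>2 \<le> (Re (lam i) + d j)\<^sup>2" using re d[OF j] by (intro power_mono) auto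
    then show ?thesis unfolding cmod_def by (intro real_sqrt_le_mono) simp
  qed
  have "(1 - z * complex_of_real (d j)) * (1 + z * complex_of_real (d j))
      = (lam i - complex_of_real (d j)) * (lam i + complex_of_real (d j)) / (lam i * lam i)"
    using nz unfolding z_def by (simp add: field_simps)
  then have "cmod (lam i - complex_of_real (d j)) * cmod (lam i + complex_of_real (d j)) < \<sigma> / (C + 1) * (cmod (lam i) * cmod (lam i))"
    using jl nz by (simp add: norm_mult norm_divide pos_divide_less_eq)
  moreover have "cmod (lam i - complex_of_real (d j)) * cmod (lam i) \<le> cmod (lam i - complex_of_real (d j)) * cmod (lam i + complex_of_real (d j))"
    using plus by (intro mult_left_mono) auto
  ultimately have "cmod (lam i - complex_of_real (d j)) * cmod (lam i) < \<sigma> / (C + 1) * cmod (lam i) * cmod (lam i)"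
    by (simp only: mult.assoc)
  then have "cmod (lam i - complex_of_real (d j)) < \<sigma> / (C + 1) * cmod (lam i)"
    using nz by (simp only: mult_less_cancel_right_pos)
  also have "\<dots> \<le> \<sigma> / (C + 1) * (C + 1)"
    using upper \<tau>(2) di \<epsilon> \<sigma>(1) by (intro mult_left_mono) auto
  also have "\<dots> \<le> \<epsilon>" using \<sigma>(2) di by simp
  finally have lj: "cmod (lam i - complex_of_real (d j)) < \<epsilon>" .
  \<comment> \<open>The index \<open>j\<close> found need not be \<open>i\<close>, but
    \<open>d j\<close> and \<open>d i\<close> are both near \<open>cmod (lam i)\<close>. The final 3
    is 1 for the distance to \<open>d j\<close> and 2 for that from \<open>d j\<close> to
    \<open>d i\<close>.\<close>
  have "\<bar>cmod (lam i) - d j\<bar> \<le> cmod (lam i - complex_of_real (d j))"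
    using norm_triangle_ineq3[of "lam i" "complex_of_real (d j)"] d[OF j] by simp
  moreover have "\<bar>cmod (lam i) - d i\<bar> \<le> \<epsilon>" using lower upper \<tau>(2) \<tau>'(1) by simp
  ultimately have "\<bar>d j - d i\<bar> \<le> 2 * \<epsilon>" using lj by linarith
  moreover have "cmod (lam i - complex_of_real (d i)) \<le> cmod (lam i - complex_of_real (d j)) + \<bar>d j - d i\<bar>"
  proof -
    have "lam i - complex_of_real (d i) = (lam i - complex_of_real (d j)) + complex_of_real (d j - d i)" by simp
    then show ?thesis by (metis norm_of_real norm_triangle_ineq)
  qed
  ultimately show ?thesis using lj iq by linarith
qed

subsection \<open>The signal as a low-rank perturbation\<close>

text \<open>
  The \<open>2k\<close> padded vectors: index \<open>t < k\<close> stands for \<open>u (t + 1)\<close> in the first block and \<open>k + t\<close> for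
  \<open>v (t + 1)\<close> in the second, and the dilated signal couples \<open>t\<close> with \<open>swap_index k t\<close>.
\<close>

definition spike_vec :: "nat \<Rightarrow> nat \<Rightarrow> (nat \<Rightarrow> real Matrix.vec) \<Rightarrow> (nat \<Rightarrow> real Matrix.vec) \<Rightarrow> nat \<Rightarrow> nat \<Rightarrow> real" where
  "spike_vec p k u v t i = (if t < k then (if i < p then vec_index (u (t + 1)) i else 0)
     else (if i < p then 0 else vec_index (v (t - k + 1)) (i - p)))"

definition swap_index :: "nat \<Rightarrow> nat \<Rightarrow> nat" where
  "swap_index k t = (if t < k then t + k else t - k)"

definition spike_index :: "nat \<Rightarrow> nat \<Rightarrow> nat" where
  "spike_index k t = (if t < k then t + 1 else t - k + 1)"

text \<open>The lower left block is the transpose of the second matrix, hence the exchanged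
  indices.\<close>

definition entry_fun :: "nat \<Rightarrow> real mat \<Rightarrow> real mat \<Rightarrow> nat \<times> nat \<Rightarrow> real" where
  "entry_fun p X1 X2 = (\<lambda>(i, j). if i < p then X1 $$ (i, j - p) else X2 $$ (j, i - p))"

lemma sum_split_block:
  fixes f :: "nat \<Rightarrow> 'a :: comm_monoid_add"
  shows "(\<Sum>i<p + n. f i) = (\<Sum>i<p. f i) + (\<Sum>i<n. f (p + i))"
  using sum.nat_group[of f 1] by (induction n) (simp_all add: add.assoc)

lemma spike_vec_orthonormal:
  assumes "orthonormal_family p k u" "orthonormal_family n k v" and st: "s < 2 * k" "t < 2 * k"
  shows "(\<Sum>i<p + n. spike_vec p k u v s i * spike_vec p k u v t i) = (if s = t then 1 else 0)"
proof -
  have u: "(\<Sum>i<p. vec_index (u a) i * vec_index (u b) i) = (if a = b then 1 else 0)"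
    if "a \<in> {1..k}" "b \<in> {1..k}" for a b
  proof -
    have "u b \<in> carrier_vec p" "scalar_prod (u a) (u b) = (if a = b then 1 else 0)"
      using assms(1) that by (auto simp: orthonormal_family_def)
    then show ?thesis by (auto simp: scalar_prod_def atLeast0LessThan)
  qed
  have v: "(\<Sum>i<n. vec_index (v a) i * vec_index (v b) i) = (if a = b then 1 else 0)"
    if "a \<in> {1..k}" "b \<in> {1..k}" for a b
  proof -
    have "v b \<in> carrier_vec n" "scalar_prod (v a) (v b) = (if a = b then 1 else 0)"
      using assms(2) that by (auto simp: orthonormal_family_def)
    then show ?thesis by (auto simp: scalar_prod_def atLeast0LessThan)
  qed
  show ?thesis
    unfolding sum_split_block
  proof (cases "s < k"; cases "t < k")
    assume *: "s < k" "t < k"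
    then show "(\<Sum>i<p. spike_vec p k u v s i * spike_vec p k u v t i) +
        (\<Sum>i<n. spike_vec p k u v s (p + i) * spike_vec p k u v t (p + i)) = (if s = t then 1 else 0)"
      using u[of "s + 1" "t + 1"] by (simp add: spike_vec_def)
  next
    assume *: "\<not> s < k" "\<not> t < k"
    then have "s - k + 1 \<in> {1..k}" "t - k + 1 \<in> {1..k}" "(s - k + 1 = t - k + 1) = (s = t)" using st by auto
    then show "(\<Sum>i<p. spike_vec p k u v s i * spike_vec p k u v t i) +
        (\<Sum>i<n. spike_vec p k u v s (p + i) * spike_vec p k u v t (p + i)) = (if s = t then 1 else 0)"
      using * v[of "s - k + 1" "t - k + 1"] by (simp add: spike_vec_def)
  qed (auto simp: spike_vec_def)
qed

lemma dilation_decomposition: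
  fixes u v :: "nat \<Rightarrow> real Matrix.vec" and d :: "nat \<Rightarrow> real" and k :: nat
  assumes X: "X1 \<in> carrier_mat p n" "X2 \<in> carrier_mat p n"
  defines "S \<equiv> signal_matrix p n k d u v"
  defines "A \<equiv> Matrix.mat (p + n) (2 * k) (\<lambda>(i, t). complex_of_real (d (spike_index k t) * spike_vec p k u v t i))"
  defines "B \<equiv> Matrix.mat (2 * k) (p + n) (\<lambda>(s, i). complex_of_real (spike_vec p k u v (swap_index k s) i))"
  shows "map_mat complex_of_real (asymmetric_dilation p n (S + X1) (S + X2)) = edge_mat p n (entry_fun p X1 X2) + A * B"
proof (rule eq_matI)
  have S: "S \<in> carrier_mat p n" by (simp add: S_def signal_matrix_def)
  fix i j assume "i < dim_row (edge_mat p n (entry_fun p X1 X2) + A * B)" "j < dim_col (edge_mat p n (entry_fun p X1 X2) + A * B)"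
  then have ij: "i < p + n" "j < p + n" by (auto simp: A_def B_def)
  have "(A * B) $$ (i, j) = (\<Sum>t<2 * k. complex_of_real (d (spike_index k t) * spike_vec p k u v t i * spike_vec p k u v (swap_index k t) j))"
    using ij by (simp add: A_def B_def scalar_prod_def atLeast0LessThan)
  also have "\<dots> = complex_of_real ((\<Sum>t<k. d (t + 1) * spike_vec p k u v t i * spike_vec p k u v (t + k) j)
      + (\<Sum>t<k. d (t + 1) * spike_vec p k u v (k + t) i * spike_vec p k u v t j))"
    unfolding mult_2 sum_split_block of_real_add of_real_sum
    by (intro arg_cong2[of _ _ _ _ plus] sum.cong) (auto simp: spike_index_def swap_index_def)
  finally have AB: "(A * B) $$ (i, j) = complex_of_real ((\<Sum>t<k. d (t + 1) * spike_vec p k u v t i * spike_vec p k u v (t + k) j)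
      + (\<Sum>t<k. d (t + 1) * spike_vec p k u v (k + t) i * spike_vec p k u v t j))" .
  have Sij: "S $$ (a, b) = (\<Sum>t<k. d (t + 1) * vec_index (u (t + 1)) a * vec_index (v (t + 1)) b)" if "a < p" "b < n" for a b
    using that unfolding S_def signal_matrix_def
    by (simp add: sum.atLeast1_atMost_eq[of _ k] atLeast0LessThan)
  have Y: "asymmetric_dilation p n (S + X1) (S + X2) $$ (i, j) =
      (if i < p then (if j < p then 0 else S $$ (i, j - p) + X1 $$ (i, j - p))
       else (if j < p then S $$ (j, i - p) + X2 $$ (j, i - p) else 0))"
    using ij X S unfolding asymmetric_dilation_def by (subst index_mat_four_block) auto
  have "asymmetric_dilation p n (S + X1) (S + X2) \<in> carrier_mat (p + n) (p + n)"
    using X S unfolding asymmetric_dilation_def by (intro four_block_carrier_mat) auto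
  then have "map_mat complex_of_real (asymmetric_dilation p n (S + X1) (S + X2)) $$ (i, j)
      = complex_of_real (asymmetric_dilation p n (S + X1) (S + X2) $$ (i, j))"
    using ij by auto
  also have "\<dots> = edge_mat p n (entry_fun p X1 X2) $$ (i, j) + (A * B) $$ (i, j)"
    unfolding Y AB using ij Sij[of i "j - p"] Sij[of j "i - p"]
    by (cases "i < p"; cases "j < p") (auto simp: edge_mat_def entry_fun_def spike_vec_def mult_ac)
  finally show "map_mat complex_of_real (asymmetric_dilation p n (S + X1) (S + X2)) $$ (i, j)
      = (edge_mat p n (entry_fun p X1 X2) + A * B) $$ (i, j)"
    using ij by (simp add: A_def B_def edge_mat_def)
qed (auto simp: asymmetric_dilation_def edge_mat_def A_def B_def)

text \<open>This is the limit of det (1 - z G), with the forms replaced by inner products of the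
  orthonormal family: identity blocks on the diagonal, the same diagonal matrix twice off it, hence
  det (1 - \<open>?\<Delta>\<close>^2).\<close>

lemma det_swap_spikes:
  fixes d :: "nat \<Rightarrow> real"
  shows "det (Matrix.mat (2 * k) (2 * k) (\<lambda>(s, t). (if s = t then 1 else 0)
      - z * complex_of_real (d (spike_index k t)) * (if swap_index k s = t then 1 else 0)))
    = poly (pair_poly k (\<lambda>j. complex_of_real (d j))) z" (is "det ?E = _")
proof -
  let ?\<Delta> = "Matrix.mat k k (\<lambda>(s, t). if s = t then - z * complex_of_real (d (t + 1)) else 0)"
  have E: "?E = four_block_mat (1\<^sub>m k) ?\<Delta> ?\<Delta> (1\<^sub>m k)"
    by (intro eq_matI) (auto simp: spike_index_def swap_index_def)
  have "det ?E = det (1\<^sub>m k * 1\<^sub>m k - ?\<Delta> * ?\<Delta>)"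
    unfolding E by (rule det_four_block_mat) auto
  also have "1\<^sub>m k * 1\<^sub>m k - ?\<Delta> * ?\<Delta> = Matrix.mat k k (\<lambda>(s, t). if s = t
      then (1 - z * complex_of_real (d (t + 1))) * (1 + z * complex_of_real (d (t + 1))) else 0)"
  proof (rule eq_matI)
    fix s t
    assume "s < dim_row (Matrix.mat k k (\<lambda>(s, t). if s = t
      then (1 - z * complex_of_real (d (t + 1))) * (1 + z * complex_of_real (d (t + 1))) else 0))"
      "t < dim_col (Matrix.mat k k (\<lambda>(s, t). if s = t
      then (1 - z * complex_of_real (d (t + 1))) * (1 + z * complex_of_real (d (t + 1))) else 0))"
    then have st: "s < k" "t < k" by auto
    have "(?\<Delta> * ?\<Delta>) $$ (s, t) = (\<Sum>a<k. (if s = a then - z * complex_of_real (d (a + 1)) else 0) *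
        (if a = t then - z * complex_of_real (d (t + 1)) else 0))"
      using st by (simp add: scalar_prod_def atLeast0LessThan)
    also have "\<dots> = (\<Sum>a<k. if a = s then (if s = t then (z * complex_of_real (d (t + 1)))\<^sup>2 else 0) else 0)"
      by (rule sum.cong[OF refl]) (auto simp: power2_eq_square)
    also have "\<dots> = (if s = t then (z * complex_of_real (d (t + 1)))\<^sup>2 else 0)"
      using st by (simp only: sum.delta finite_lessThan lessThan_iff if_True)
    finally show "(1\<^sub>m k * 1\<^sub>m k - ?\<Delta> * ?\<Delta>) $$ (s, t) = Matrix.mat k k (\<lambda>(s, t). if s = t
      then (1 - z * complex_of_real (d (t + 1))) * (1 + z * complex_of_real (d (t + 1))) else 0) $$ (s, t)"
      using st by (simp add: power2_eq_square algebra_simps)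
  qed auto
  also have "det \<dots> = (\<Prod>t<k. (1 - z * complex_of_real (d (t + 1))) * (1 + z * complex_of_real (d (t + 1))))"
    by (subst det_upper_triangular[of _ k])
      (auto simp: upper_triangular_def prod_list_diag_prod atLeast0LessThan intro!: prod.cong)
  also have "\<dots> = poly (pair_poly k (\<lambda>j. complex_of_real (d j))) z"
    unfolding poly_pair_poly by (simp add: prod.atLeast1_atMost_eq[of _ k] atLeast0LessThan)
  finally show ?thesis .
qed

text \<open>\<open>E\<close> is the small matrix of the low-rank formula and \<open>E'\<close> the
  same with exact inner products. The remainder \<open>\<eta>1\<close> of the forms, divided by the
  lower bound \<open>\<eta>0\<close> on the determinant, bounds the entries of the
  difference.\<close>

lemma det_dilation_factor:
  fixes u v :: "nat \<Rightarrow> real Matrix.vec" and d :: "nat \<Rightarrow> real" and k :: nat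
  assumes X: "X1 \<in> carrier_mat p n" "X2 \<in> carrier_mat p n"
    and ortho: "orthonormal_family p k u" "orthonormal_family n k v"
    and d: "\<And>j. j \<in> {1..k} \<Longrightarrow> 0 \<le> d j \<and> d j < C" and C: "0 < C"
    and z: "cmod z \<le> r" and \<eta>: "0 < \<eta>0" "0 \<le> \<eta>1" "\<eta>1 \<le> \<eta>0"
  defines "y \<equiv> entry_fun p X1 X2"
  defines "w \<equiv> spike_vec p k u v"
  assumes Q: "\<eta>0 \<le> cmod (char_det (edge_mat p n y) z)"
    and small: "\<And>s t. s < 2 * k \<Longrightarrow> t < 2 * k \<Longrightarrow>
      (\<Sum>m\<le>p + n. cmod z ^ m * \<bar>path_coeff p n y (w t) (w s) m - cycle_coeff p n y (w t) (w s) m\<bar>) \<le> \<eta>1"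
  shows "\<exists>D'. det (1\<^sub>m (p + n) - z \<cdot>\<^sub>m map_mat complex_of_real (asymmetric_dilation p n
        (signal_matrix p n k d u v + X1) (signal_matrix p n k d u v + X2))) = char_det (edge_mat p n y) z * D' \<and>
      cmod (D' - poly (pair_poly k (\<lambda>j. complex_of_real (d j))) z)
        \<le> fact (2 * k) * ((1 + 2 * r * C) ^ (2 * k) * (real (2 * k) * (r * C * (\<eta>1 / \<eta>0))))"
proof -
  let ?N = "p + n"
  let ?q = "char_det (edge_mat p n y) z"
  define A where "A = Matrix.mat ?N (2 * k) (\<lambda>(i, t). complex_of_real (d (spike_index k t) * w t i))"
  define B where "B = Matrix.mat (2 * k) ?N (\<lambda>(s, i). complex_of_real (w (swap_index k s) i))"
  define M where "M = 1\<^sub>m ?N - z \<cdot>\<^sub>m edge_mat p n y"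
  have A: "A \<in> carrier_mat ?N (2 * k)" and B: "B \<in> carrier_mat (2 * k) ?N" by (auto simp: A_def B_def)
  have M: "M \<in> carrier_mat ?N ?N"
    unfolding M_def by (intro minus_carrier_mat smult_carrier_mat) simp
  have q: "?q = det M" by (simp add: M_def edge_mat_def)
  have q0: "det M \<noteq> 0" using Q \<eta>(1) unfolding q by auto
  have r: "0 \<le> r" using z norm_ge_zero order_trans by blast
  have zA: "z \<cdot>\<^sub>m A \<in> carrier_mat ?N (2 * k)" using A by simp
  have AB: "A * B \<in> carrier_mat ?N ?N" using A B by simp
  have "1\<^sub>m ?N - z \<cdot>\<^sub>m (edge_mat p n y + A * B) = M - (z \<cdot>\<^sub>m A) * B"
  proof -
    have "(z \<cdot>\<^sub>m A) * B = z \<cdot>\<^sub>m (A * B)" by (rule mult_smult_assoc_mat[OF A B])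
    moreover have "1\<^sub>m ?N - z \<cdot>\<^sub>m (F + G) = 1\<^sub>m ?N - z \<cdot>\<^sub>m F - z \<cdot>\<^sub>m G"
      if "F \<in> carrier_mat ?N ?N" "G \<in> carrier_mat ?N ?N" for F G :: "complex mat"
      using that by (intro eq_matI) (auto simp: algebra_simps)
    ultimately show ?thesis unfolding M_def using AB by simp
  qed
  then have eq: "1\<^sub>m ?N - z \<cdot>\<^sub>m map_mat complex_of_real (asymmetric_dilation p n
        (signal_matrix p n k d u v + X1) (signal_matrix p n k d u v + X2)) = M - (z \<cdot>\<^sub>m A) * B"
    unfolding dilation_decomposition[OF X] y_def A_def B_def w_def by simp
  define E where "E = 1\<^sub>m (2 * k) - (1 / det M) \<cdot>\<^sub>m (B * (adj_mat M * (z \<cdot>\<^sub>m A)))"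
  define E' where "E' = Matrix.mat (2 * k) (2 * k) (\<lambda>(s, t). (if s = t then 1 else 0)
      - z * complex_of_real (d (spike_index k t)) * (if swap_index k s = t then 1 else 0 :: complex))"
  define G where "G s t = (\<Sum>i<?N. \<Sum>j<?N. complex_of_real (w (swap_index k s) i) * adj_mat M $$ (i, j) * complex_of_real (w t j))" for s t
  have adj: "adj_mat M \<in> carrier_mat ?N ?N" by (rule adj_mat(1)[OF M])
  have E: "E \<in> carrier_mat (2 * k) (2 * k)"
    unfolding E_def using A B adj zA by (intro minus_carrier_mat smult_carrier_mat mult_carrier_mat)
  have Est: "E $$ (s, t) = (if s = t then 1 else 0) - z * complex_of_real (d (spike_index k t)) * (G s t / det M)"
    if st: "s < 2 * k" "t < 2 * k" for s t
  proof -
    have "(B * (adj_mat M * (z \<cdot>\<^sub>m A))) $$ (s, t) = (\<Sum>i<?N. B $$ (s, i) * (adj_mat M * (z \<cdot>\<^sub>m A)) $$ (i, t))"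
      using st A B adj zA by (simp add: scalar_prod_def atLeast0LessThan)
    also have "\<dots> = (\<Sum>i<?N. B $$ (s, i) * (\<Sum>j<?N. adj_mat M $$ (i, j) * (z * A $$ (j, t))))"
      by (rule sum.cong[OF refl]) (use st A adj zA in \<open>simp add: scalar_prod_def atLeast0LessThan\<close>)
    also have "\<dots> = z * complex_of_real (d (spike_index k t)) * G s t"
      using st unfolding G_def A_def B_def by (simp add: sum_distrib_left mult_ac)
    finally have BA: "(B * (adj_mat M * (z \<cdot>\<^sub>m A))) $$ (s, t) = z * complex_of_real (d (spike_index k t)) * G s t" .
    have W: "B * (adj_mat M * (z \<cdot>\<^sub>m A)) \<in> carrier_mat (2 * k) (2 * k)"
      using A B adj zA by (intro mult_carrier_mat)
    have "(1\<^sub>m (2 * k) - c \<cdot>\<^sub>m W) $$ (s, t) = (if s = t then 1 else 0) - c * W $$ (s, t)"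
      if "W \<in> carrier_mat (2 * k) (2 * k)" for c and W :: "complex mat"
      using that st by auto
    from this[OF W, of "1 / det M"] show ?thesis unfolding E_def BA by simp
  qed
  have swap: "swap_index k s < 2 * k" if "s < 2 * k" for s using that by (auto simp: swap_index_def)
  have idx: "spike_index k t \<in> {1..k}" if "t < 2 * k" for t using that by (auto simp: spike_index_def)
  have Gst: "cmod (G s t / det M - (if swap_index k s = t then 1 else 0)) \<le> \<eta>1 / \<eta>0" if st: "s < 2 * k" "t < 2 * k" for s t
  proof -
    have "(\<Sum>j<?N. w t j * w (swap_index k s) j) = (if swap_index k s = t then 1 else 0)"
      using spike_vec_orthonormal[OF ortho st(2) swap[OF st(1)]] unfolding w_def by auto
    then have "G s t = (if swap_index k s = t then 1 else 0) * det M + (\<Sum>m\<le>?N. (- z) ^ m *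
        complex_of_real (path_coeff p n y (w t) (w (swap_index k s)) m - cycle_coeff p n y (w t) (w (swap_index k s)) m))"
      unfolding G_def M_def bilinear_adj_edge_mat q[unfolded M_def] by simp
    then have "G s t / det M - (if swap_index k s = t then 1 else 0) = (\<Sum>m\<le>?N. (- z) ^ m *
        complex_of_real (path_coeff p n y (w t) (w (swap_index k s)) m - cycle_coeff p n y (w t) (w (swap_index k s)) m)) / det M"
      using q0 by (simp add: add_divide_distrib)
    also have "cmod \<dots> \<le> \<eta>1 / \<eta>0"
      unfolding norm_divide
    proof (rule frac_le)
      show "\<eta>0 \<le> cmod (det M)" using Q unfolding q .
      have "cmod (\<Sum>m\<le>?N. (- z) ^ m *
        complex_of_real (path_coeff p n y (w t) (w (swap_index k s)) m - cycle_coeff p n y (w t) (w (swap_index k s)) m))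
        \<le> (\<Sum>m\<le>?N. cmod z ^ m * \<bar>path_coeff p n y (w t) (w (swap_index k s)) m - cycle_coeff p n y (w t) (w (swap_index k s)) m\<bar>)"
        by (rule sum_norm_le) (simp only: norm_mult norm_power norm_minus_cancel norm_of_real order_refl)
      also have "\<dots> \<le> \<eta>1" by (rule small[OF swap[OF st(1)] st(2)])
      finally show "cmod (\<Sum>m\<le>?N. (- z) ^ m *
        complex_of_real (path_coeff p n y (w t) (w (swap_index k s)) m - cycle_coeff p n y (w t) (w (swap_index k s)) m)) \<le> \<eta>1" .
    qed (use \<eta> in auto)
    finally show ?thesis .
  qed
  have zd: "cmod (z * complex_of_real (d (spike_index k t))) \<le> r * C" if "t < 2 * k" for t
    using d[OF idx[OF that]] z r by (auto simp: norm_mult intro!: mult_mono)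
  have rC: "0 \<le> r * C" "0 \<le> C * r" using r C by simp_all
  have le1: "\<eta>1 / \<eta>0 \<le> 1" "0 \<le> \<eta>1 / \<eta>0" using \<eta> by auto
  have E'b: "cmod (E' $$ (s, t)) \<le> 1 + r * C" if st: "s < 2 * k" "t < 2 * k" for s t
  proof -
    have "cmod (E' $$ (s, t)) \<le> cmod (if s = t then 1 else 0 :: complex)
        + cmod (z * complex_of_real (d (spike_index k t)) * (if swap_index k s = t then 1 else 0))"
      unfolding E'_def using st by (simp add: norm_triangle_ineq4)
    also have "\<dots> \<le> 1 + r * C" using zd[OF st(2)] rC by auto
    finally show ?thesis .
  qed
  have diff: "cmod (E $$ (s, t) - E' $$ (s, t)) \<le> r * C * (\<eta>1 / \<eta>0)" if st: "s < 2 * k" "t < 2 * k" for s t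
  proof -
    have "E $$ (s, t) - E' $$ (s, t) = - (z * complex_of_real (d (spike_index k t))) * (G s t / det M - (if swap_index k s = t then 1 else 0))"
      unfolding Est[OF st] E'_def using st by (simp add: right_diff_distrib)
    then show ?thesis
      using mult_mono[OF zd[OF st(2)] Gst[OF st] rC(1) norm_ge_zero] by (simp only: norm_mult norm_minus_cancel)
  qed
  have "cmod (det E - det E') \<le> fact (2 * k) * ((1 + 2 * r * C) ^ (2 * k) * (real (2 * k) * (r * C * (\<eta>1 / \<eta>0))))"
  proof (rule det_diff_le[OF E])
    show "E' \<in> carrier_mat (2 * k) (2 * k)" by (simp add: E'_def)
    \<comment> \<open>The entries of \<open>E'\<close> are at most \<open>1 + r * C\<close>, and
      those of \<open>E\<close> differ by at most \<open>r * C\<close> because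
      \<open>\<eta>1 \<le> \<eta>0\<close>; this explains the common bound.\<close>
    show "1 \<le> 1 + 2 * r * C" using rC by simp
    show "cmod (E' $$ (s, t)) \<le> 1 + 2 * r * C" if "s < 2 * k" "t < 2 * k" for s t
      using E'b[OF that] rC by simp
    show "cmod (E $$ (s, t)) \<le> 1 + 2 * r * C" if "s < 2 * k" "t < 2 * k" for s t
    proof -
      have "cmod (E $$ (s, t)) \<le> cmod (E' $$ (s, t)) + cmod (E $$ (s, t) - E' $$ (s, t))"
        using norm_triangle_ineq[of "E' $$ (s, t)" "E $$ (s, t) - E' $$ (s, t)"] by simp
      moreover have "r * C * (\<eta>1 / \<eta>0) \<le> r * C * 1" using le1 rC by (intro mult_left_mono) auto
      ultimately show ?thesis using E'b[OF that] diff[OF that] by simp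
    qed
  qed (rule diff)
  moreover have "det E' = poly (pair_poly k (\<lambda>j. complex_of_real (d j))) z"
    unfolding E'_def by (rule det_swap_spikes)
  moreover have "det (M - (z \<cdot>\<^sub>m A) * B) = det M * det E"
    unfolding E_def by (rule det_low_rank_perturbation[OF M zA B q0])
  ultimately show ?thesis unfolding eq q by (intro exI[of _ "det E"]) simp
qed

subsection \<open>The noise\<close>

context prob_space
begin

lemma expectation_abs_le_sqrt:
  fixes Z :: "'a \<Rightarrow> real"
  assumes Z: "Z \<in> borel_measurable M" "integrable M (\<lambda>\<omega>. (Z \<omega>)\<^sup>2)" and V: "expectation (\<lambda>\<omega>. (Z \<omega>)\<^sup>2) \<le> V"
  shows "integrable M Z" and "expectation (\<lambda>\<omega>. \<bar>Z \<omega>\<bar>) \<le> sqrt V"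
proof -
  show int: "integrable M Z" by (rule square_integrable_imp_integrable[OF Z])
  have "0 \<le> variance (\<lambda>\<omega>. \<bar>Z \<omega>\<bar>)" by (rule variance_positive)
  also have "\<dots> = expectation (\<lambda>\<omega>. \<bar>Z \<omega>\<bar>\<^sup>2) - (expectation (\<lambda>\<omega>. \<bar>Z \<omega>\<bar>))\<^sup>2"
    by (rule variance_eq) (use int Z(2) in auto)
  finally have "(expectation (\<lambda>\<omega>. \<bar>Z \<omega>\<bar>))\<^sup>2 \<le> V" using V by simp
  then show "expectation (\<lambda>\<omega>. \<bar>Z \<omega>\<bar>) \<le> sqrt V" by (rule real_le_rsqrt)
qed

text \<open>A random polynomial is bounded on a whole disc by the weighted sum of the absolute
  values of its coefficients, so uniform control in z needs only one application of Markov's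
  inequality.\<close>

lemma markov_weighted_sum:
  fixes Z :: "'i \<Rightarrow> 'a \<Rightarrow> real"
  assumes I: "finite I" and Z: "\<And>i. i \<in> I \<Longrightarrow> Z i \<in> borel_measurable M"
    "\<And>i. i \<in> I \<Longrightarrow> integrable M (\<lambda>\<omega>. (Z i \<omega>)\<^sup>2)" "\<And>i. i \<in> I \<Longrightarrow> expectation (\<lambda>\<omega>. (Z i \<omega>)\<^sup>2) \<le> V i"
    and w: "\<And>i. i \<in> I \<Longrightarrow> 0 \<le> w i" and L: "0 < L" and K: "(\<Sum>i\<in>I. w i * sqrt (V i)) \<le> K"
  shows "{\<omega> \<in> space M. L < (\<Sum>i\<in>I. w i * \<bar>Z i \<omega>\<bar>)} \<in> events \<and>
    prob {\<omega> \<in> space M. L < (\<Sum>i\<in>I. w i * \<bar>Z i \<omega>\<bar>)} \<le> K / L"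
proof -
  note est = expectation_abs_le_sqrt[OF Z]
  let ?S = "\<lambda>\<omega>. \<Sum>i\<in>I. w i * \<bar>Z i \<omega>\<bar>"
  have int: "integrable M ?S"
    by (intro Bochner_Integration.integrable_sum integrable_mult_right integrable_abs est(1))
  have meas: "?S \<in> borel_measurable M" using int by (rule borel_measurable_integrable)
  have ev: "{\<omega> \<in> space M. L < ?S \<omega>} \<in> events" using meas by measurable
  have nonneg: "0 \<le> ?S \<omega>" for \<omega> using w by (intro sum_nonneg) auto
  have "prob {\<omega> \<in> space M. L < ?S \<omega>} \<le> prob {\<omega> \<in> space M. L \<le> ?S \<omega>}"
    by (rule finite_measure_mono) (use meas in \<open>auto\<close>)
  also have "\<dots> \<le> expectation ?S / L"
    by (rule integral_Markov_inequality_measure[OF int sets.top]) (use nonneg L in auto)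
  also have "expectation ?S = (\<Sum>i\<in>I. w i * expectation (\<lambda>\<omega>. \<bar>Z i \<omega>\<bar>))"
    by (subst Bochner_Integration.integral_sum) (auto intro!: integrable_mult_right integrable_abs est(1))
  also have "(\<Sum>i\<in>I. w i * expectation (\<lambda>\<omega>. \<bar>Z i \<omega>\<bar>)) / L \<le> K / L"
  proof (rule divide_right_mono)
    have "(\<Sum>i\<in>I. w i * expectation (\<lambda>\<omega>. \<bar>Z i \<omega>\<bar>)) \<le> (\<Sum>i\<in>I. w i * sqrt (V i))"
      by (intro sum_mono mult_left_mono est(2) w)
    then show "(\<Sum>i\<in>I. w i * expectation (\<lambda>\<omega>. \<bar>Z i \<omega>\<bar>)) \<le> K" using K by simp
  qed (use L in simp)
  finally show ?thesis using ev by blast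
qed

text \<open>Independence is given for entries labelled by matrix, row and column, but is used for
  entries labelled by edges of the dilation.\<close>

lemma indep_sets_reindex:
  assumes ind: "indep_sets F I" and \<phi>: "inj_on \<phi> J" "\<phi> ` J \<subseteq> I"
  shows "indep_sets (\<lambda>j. F (\<phi> j)) J"
  unfolding indep_sets_def
proof (intro conjI ballI allI impI)
  show "F (\<phi> j) \<subseteq> events" if "j \<in> J" for j
    using ind \<phi>(2) that by (auto simp: indep_sets_def)
  fix K A assume K: "K \<subseteq> J" "K \<noteq> {}" "finite K" and A: "A \<in> Pi K (\<lambda>j. F (\<phi> j))"
  define A' where "A' = (\<lambda>i. A (inv_into K \<phi> i))"
  have inj: "inj_on \<phi> K" using \<phi>(1) K(1) by (rule inj_on_subset)
  have A'\<phi>: "A' (\<phi> j) = A j" if "j \<in> K" for j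
    using inj that by (simp add: A'_def)
  have "A' \<in> Pi (\<phi> ` K) F" using A A'\<phi> by auto
  moreover have "\<phi> ` K \<subseteq> I" "\<phi> ` K \<noteq> {}" "finite (\<phi> ` K)" using K \<phi>(2) by auto
  ultimately have "prob (\<Inter>i\<in>\<phi> ` K. A' i) = (\<Prod>i\<in>\<phi> ` K. prob (A' i))"
    using ind unfolding indep_sets_def by blast
  moreover have "(\<Inter>i\<in>\<phi> ` K. A' i) = (\<Inter>j\<in>K. A j)" using A'\<phi> by auto
  moreover have "(\<Prod>i\<in>\<phi> ` K. prob (A' i)) = (\<Prod>j\<in>K. prob (A j))"
    using inj A'\<phi> by (simp add: prod.reindex)
  ultimately show "prob (\<Inter>j\<in>K. A j) = (\<Prod>j\<in>K. prob (A j))" by simp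
qed

lemma indep_vars_reindex:
  assumes "indep_vars M' X I" "inj_on \<phi> J" "\<phi> ` J \<subseteq> I"
  shows "indep_vars (\<lambda>j. M' (\<phi> j)) (\<lambda>j. X (\<phi> j)) J"
  using assms(1,3) indep_sets_reindex[OF _ assms(2,3)] unfolding indep_vars_def2 by blast

end

section \<open>Truncation of the entry distribution\<close>

definition clip :: "real \<Rightarrow> real \<Rightarrow> real" where
  "clip b t = (if \<bar>t\<bar> \<le> b then t else 0)"

text \<open>Recentred after clipping, because the orthogonality of monomials rests on mean
  0.\<close>

definition truncate :: "real measure \<Rightarrow> real \<Rightarrow> real \<Rightarrow> real" where
  "truncate \<mu> b t = clip b t - (\<integral>s. clip b s \<partial>\<mu>)"

lemma clip_measurable [measurable]: "clip b \<in> borel_measurable borel"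
  unfolding clip_def by measurable

lemma truncate_measurable [measurable]: "truncate \<mu> b \<in> borel_measurable borel"
  unfolding truncate_def by measurable

text \<open>As the law has mean 0, the recentring drops out of the product of an entry with its
  truncation, which has mean \<open>\<theta>\<close>; the variance of the truncation is
  \<open>\<theta>\<close> minus the squared mean of the clipped entry. This gives the order of
  moments asked for by \<open>det_coeff_diff_second_moment\<close>.\<close>

lemma truncation:
  fixes \<mu> :: "real measure"
  assumes \<mu>: "prob_space \<mu>" and sets: "sets \<mu> = sets borel"
    and sq: "integrable \<mu> (\<lambda>t. t\<^sup>2)" "(\<integral>t. t\<^sup>2 \<partial>\<mu>) = 1" and mean: "(\<integral>t. t \<partial>\<mu>) = 0" and b: "0 \<le> b"
  defines "\<theta> \<equiv> (\<integral>t. (clip b t)\<^sup>2 \<partial>\<mu>)"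
  shows "\<bar>truncate \<mu> b t\<bar> \<le> 2 * b"
    and "(\<integral>t. truncate \<mu> b t \<partial>\<mu>) = 0"
    and "integrable \<mu> (\<lambda>t. (truncate \<mu> b t)\<^sup>2)"
    and "0 \<le> (\<integral>t. (truncate \<mu> b t)\<^sup>2 \<partial>\<mu>)" and "(\<integral>t. (truncate \<mu> b t)\<^sup>2 \<partial>\<mu>) \<le> \<theta>" and "\<theta> \<le> 1"
    and "(\<integral>t. t * truncate \<mu> b t \<partial>\<mu>) = \<theta>"
proof -
  interpret prob_space \<mu> by (rule \<mu>)
  note sets[measurable_cong]
  have cb: "\<bar>clip b s\<bar> \<le> b" for s using b by (simp add: clip_def)
  have cint: "integrable \<mu> (clip b)"
    by (rule integrable_const_bound[of _ b]) (use cb in auto)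
  have c2: "(clip b s)\<^sup>2 \<le> b\<^sup>2" for s using cb[of s] by (metis abs_le_square_iff abs_of_nonneg b)
  have c2int: "integrable \<mu> (\<lambda>s. (clip b s)\<^sup>2)"
    by (rule integrable_const_bound[of _ "b\<^sup>2"]) (use c2 in auto)
  define m where "m = (\<integral>s. clip b s \<partial>\<mu>)"
  have "\<bar>m\<bar> \<le> (\<integral>s. \<bar>clip b s\<bar> \<partial>\<mu>)" unfolding m_def by (rule integral_abs_bound)
  also have "\<dots> \<le> (\<integral>s. b \<partial>\<mu>)" by (rule integral_mono) (use cint cb in auto)
  finally have mb: "\<bar>m\<bar> \<le> b" by (simp add: prob_space)
  have tr: "truncate \<mu> b s = clip b s - m" for s by (simp add: truncate_def m_def)
  show tb: "\<bar>truncate \<mu> b t\<bar> \<le> 2 * b" for t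
    using cb[of t] mb unfolding tr by linarith
  show "(\<integral>t. truncate \<mu> b t \<partial>\<mu>) = 0"
    unfolding tr using cint by (simp add: prob_space m_def)
  show "integrable \<mu> (\<lambda>t. (truncate \<mu> b t)\<^sup>2)"
  proof (rule integrable_const_bound[of _ "(2 * b)\<^sup>2"])
    show "AE t in \<mu>. norm ((truncate \<mu> b t)\<^sup>2) \<le> (2 * b)\<^sup>2"
    proof (rule AE_I2)
      fix t
      have "\<bar>truncate \<mu> b t\<bar>\<^sup>2 \<le> (2 * b)\<^sup>2" by (rule power_mono[OF tb]) simp
      then show "norm ((truncate \<mu> b t)\<^sup>2) \<le> (2 * b)\<^sup>2" by simp
    qed
  qed measurable
  show "0 \<le> (\<integral>t. (truncate \<mu> b t)\<^sup>2 \<partial>\<mu>)" by (rule integral_nonneg_AE) simp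
  have "(\<integral>t. (truncate \<mu> b t)\<^sup>2 \<partial>\<mu>) = \<theta> - m\<^sup>2"
    using variance_eq[OF cint c2int] unfolding tr \<theta>_def m_def .
  then show "(\<integral>t. (truncate \<mu> b t)\<^sup>2 \<partial>\<mu>) \<le> \<theta>" by simp
  have "\<theta> \<le> (\<integral>t. t\<^sup>2 \<partial>\<mu>)"
    unfolding \<theta>_def by (rule integral_mono[OF c2int sq(1)]) (simp add: clip_def)
  then show "\<theta> \<le> 1" using sq(2) by simp
  have idint: "integrable \<mu> (\<lambda>t. t)"
    by (rule square_integrable_imp_integrable[OF _ sq(1)]) measurable
  have eq: "t * truncate \<mu> b t = (clip b t)\<^sup>2 - m * t" for t
    unfolding tr by (simp add: clip_def power2_eq_square algebra_simps)
  show "(\<integral>t. t * truncate \<mu> b t \<partial>\<mu>) = \<theta>"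
    unfolding eq using c2int idint mean by (simp add: \<theta>_def)
qed

text \<open>Dominated convergence with t^2 itself as the bound. A second moment alone gives no rate,
  which is why the level is fixed before n grows.\<close>

lemma clip_second_moment_tendsto:
  fixes \<mu> :: "real measure"
  assumes sets: "sets \<mu> = sets borel" and sq: "integrable \<mu> (\<lambda>t. t\<^sup>2)"
  shows "(\<lambda>N. \<integral>t. (clip (real N) t)\<^sup>2 \<partial>\<mu>) \<longlonglongrightarrow> (\<integral>t. t\<^sup>2 \<partial>\<mu>)"
proof (rule integral_dominated_convergence[where w = "\<lambda>t. t\<^sup>2"])
  note sets[measurable_cong]
  show "(\<lambda>t. t\<^sup>2) \<in> borel_measurable \<mu>" "\<And>N. (\<lambda>t. (clip (real N) t)\<^sup>2) \<in> borel_measurable \<mu>" by measurable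
  show "integrable \<mu> (\<lambda>t. t\<^sup>2)" by (rule sq)
  show "AE t in \<mu>. (\<lambda>N. (clip (real N) t)\<^sup>2) \<longlonglongrightarrow> t\<^sup>2"
  proof (rule AE_I2)
    fix t :: real
    obtain N0 where "\<bar>t\<bar> \<le> real N0" using real_arch_simple by blast
    then have "\<forall>\<^sub>F N in sequentially. (clip (real N) t)\<^sup>2 = t\<^sup>2"
      unfolding eventually_sequentially by (intro exI[of _ N0]) (auto simp: clip_def)
    then show "(\<lambda>N. (clip (real N) t)\<^sup>2) \<longlonglongrightarrow> t\<^sup>2" by (rule tendsto_eventually)
  qed
  show "AE t in \<mu>. norm ((clip (real N) t)\<^sup>2) \<le> t\<^sup>2" for N
    by (rule AE_I2) (simp add: clip_def)
qed

text \<open>Termwise differentiation of the series with coefficients n^k yields the coefficients (n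
  + 1)^(k + 1), which raises the exponent by one.\<close>

lemma summable_power_times_geometric:
  fixes x :: real
  assumes "\<bar>x\<bar> < 1"
  shows "summable (\<lambda>n. (real n + 1) ^ k * x ^ n)"
  using assms
proof (induction k arbitrary: x)
  case 0
  then show ?case by (simp add: summable_geometric)
next
  case (Suc k)
  have "summable (\<lambda>n. (real n) ^ k * y ^ n)" if y: "norm y < 1" for y :: real
  proof -
    have "summable (\<lambda>n. y * ((real n + 1) ^ k * y ^ n))"
      using Suc.IH[of y] y by (intro summable_mult) auto
    then have "summable (\<lambda>n. (real (Suc n)) ^ k * y ^ Suc n)" by (simp add: mult_ac add.commute)
    then show ?thesis by (subst (asm) summable_Suc_iff)
  qed
  then have "summable (\<lambda>n. diffs (\<lambda>n. real n ^ k) n * x ^ n)"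
    by (rule termdiff_converges[rotated]) (use Suc.prems in auto)
  then show ?case by (simp add: diffs_def add.commute)
qed

context prob_space
begin

lemma coeff_measurable:
  fixes Y :: "nat \<times> nat \<Rightarrow> 'a \<Rightarrow> real"
  assumes Y: "\<And>e. e \<in> alternating_edges p n \<Longrightarrow> Y e \<in> borel_measurable M"
  shows "(\<lambda>\<omega>. det_coeff p n (\<lambda>e. Y e \<omega>) m) \<in> borel_measurable M"
    and "(\<lambda>\<omega>. cycle_coeff p n (\<lambda>e. Y e \<omega>) a b m) \<in> borel_measurable M"
    and "(\<lambda>\<omega>. path_coeff p n (\<lambda>e. Y e \<omega>) a b m) \<in> borel_measurable M"
    and "(\<lambda>\<omega>. trace_coeff p n (\<lambda>e. Y e \<omega>) m) \<in> borel_measurable M"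
proof -
  have Gp: "(\<lambda>\<omega>. \<Prod>e\<in>graph_of F \<sigma>. Y e \<omega>) \<in> borel_measurable M" if "(F, \<sigma>) \<in> alternating_perms p n m" for F \<sigma>
    using graph_of_perms(2)[OF that] Y by (intro borel_measurable_prod) blast
  have Gq: "(\<lambda>\<omega>. \<Prod>e\<in>graph_of F \<sigma>. Y e \<omega>) \<in> borel_measurable M" if "(j, F, \<sigma>) \<in> open_paths p n m" for j F \<sigma>
    using graph_of_paths(2)[OF that] Y by (intro borel_measurable_prod) blast
  show "(\<lambda>\<omega>. det_coeff p n (\<lambda>e. Y e \<omega>) m) \<in> borel_measurable M"
    unfolding det_coeff_def case_prod_unfold
    by (intro borel_measurable_sum borel_measurable_times borel_measurable_const) (auto intro: Gp)
  show "(\<lambda>\<omega>. cycle_coeff p n (\<lambda>e. Y e \<omega>) a b m) \<in> borel_measurable M"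
    unfolding cycle_coeff_def case_prod_unfold
    by (intro borel_measurable_sum borel_measurable_times borel_measurable_const) (auto intro: Gp)
  show "(\<lambda>\<omega>. path_coeff p n (\<lambda>e. Y e \<omega>) a b m) \<in> borel_measurable M"
    unfolding path_coeff_def case_prod_unfold
    by (intro borel_measurable_sum borel_measurable_times borel_measurable_const) (auto intro: Gq)
  show "(\<lambda>\<omega>. trace_coeff p n (\<lambda>e. Y e \<omega>) m) \<in> borel_measurable M"
    unfolding trace_coeff_def
  proof (intro borel_measurable_sum borel_measurable_prod Y)
    fix f k assume f: "f \<in> closed_walks p n m" and k: "k \<in> {..<m}"
    have km: "k < m" "Suc k mod m < m" using k by auto
    have "f k < p + n" "f (Suc k mod m) < p + n"
      using PiE_mem[OF closed_walksD(1)[OF f], of k] PiE_mem[OF closed_walksD(1)[OF f], of "Suc k mod m"] km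
      by simp_all
    then show "(f k, f (Suc k mod m)) \<in> alternating_edges p n"
      using closed_walksD(2)[OF f km(1)] by (simp add: alternating_edges_def)
  qed
qed

end

section \<open>Bounds for the characteristic determinant, uniform on a disc\<close>

lemma char_det_norm_le:
  assumes z: "cmod z \<le> r" and L: "(\<Sum>m\<le>p + n. r ^ m * \<bar>det_coeff p n y m\<bar>) \<le> L"
  shows "cmod (char_det (edge_mat p n y) z) \<le> L"
proof -
  have "cmod (char_det (edge_mat p n y) z) \<le> (\<Sum>m\<le>p + n. r ^ m * \<bar>det_coeff p n y m\<bar>)"
    unfolding char_det_edge_mat
    by (rule sum_norm_le) (use z in \<open>auto simp: norm_mult norm_power intro!: mult_right_mono power_mono\<close>)
  then show ?thesis using L by simp
qed

lemma char_det_diff_norm_le: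
  assumes z: "cmod z \<le> r" and L: "(\<Sum>m\<le>p + n. r ^ m * \<bar>det_coeff p n y m - det_coeff p n y' m\<bar>) \<le> L"
  shows "cmod (char_det (edge_mat p n y) z - char_det (edge_mat p n y') z) \<le> L"
proof -
  have "char_det (edge_mat p n y) z - char_det (edge_mat p n y') z
      = (\<Sum>m\<le>p + n. (- z) ^ m * complex_of_real (det_coeff p n y m - det_coeff p n y' m))"
    unfolding char_det_edge_mat by (simp add: sum_subtractf right_diff_distrib)
  also have "cmod \<dots> \<le> (\<Sum>m\<le>p + n. r ^ m * \<bar>det_coeff p n y m - det_coeff p n y' m\<bar>)"
    by (rule sum_norm_le) (use z in \<open>auto simp: norm_mult norm_power simp flip: of_real_diff intro!: mult_right_mono power_mono\<close>)
  finally show ?thesis using L by simp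
qed

lemma char_det_lower_bound:
  assumes r: "0 < r'" "cmod z \<le> r" "r < r'"
    and L1: "(\<Sum>m\<le>p + n. r' ^ m * \<bar>det_coeff p n y m\<bar>) \<le> L1"
    and L2: "(\<Sum>m=1..J. r' ^ m / real m * \<bar>trace_coeff p n y m\<bar>) \<le> L2"
    and small: "(exp L2 * L1 + 1) * (r / r') ^ Suc J \<le> 1 / 2"
  shows "exp (- L2) / 2 \<le> cmod (char_det (edge_mat p n y) z)"
proof -
  let ?A = "edge_mat p n y"
  obtain vs where vs: "\<And>z. det (1\<^sub>m (p + n) - z \<cdot>\<^sub>m ?A) = (\<Prod>\<nu>\<leftarrow>vs. 1 - z * \<nu>)"
    "\<And>k. mat_trace (?A ^\<^sub>m k) = (\<Sum>\<nu>\<leftarrow>vs. \<nu> ^ k)"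
    using eigenvalue_list_exists[of ?A "p + n"] by auto
  have Q: "char_det ?A z = (\<Prod>\<nu>\<leftarrow>vs. 1 - z * \<nu>)" for z
    using vs(1)[of z] by (simp add: edge_mat_def)
  have "exp (- L2) / 2 \<le> cmod (\<Prod>\<nu>\<leftarrow>vs. 1 - z * \<nu>)"
  proof (rule prod_list_lower_bound[OF r _ _ small])
    show "cmod (\<Prod>\<nu>\<leftarrow>vs. 1 - z * \<nu>) \<le> L1" if "cmod z \<le> r'" for z
      using char_det_norm_le[OF that L1] unfolding Q .
    have "(\<Sum>m=1..J. cmod (\<Sum>\<nu>\<leftarrow>vs. \<nu> ^ m) * r' ^ m / real m) = (\<Sum>m=1..J. r' ^ m / real m * \<bar>trace_coeff p n y m\<bar>)"
    proof (rule sum.cong[OF refl])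
      fix m assume "m \<in> {1..J}"
      then have "(\<Sum>\<nu>\<leftarrow>vs. \<nu> ^ m) = complex_of_real (trace_coeff p n y m)"
        using mat_trace_edge_mat_pow[of m p n y] vs(2)[of m] by simp
      then show "cmod (\<Sum>\<nu>\<leftarrow>vs. \<nu> ^ m) * r' ^ m / real m = r' ^ m / real m * \<bar>trace_coeff p n y m\<bar>"
        by simp
    qed
    then show "(\<Sum>m=1..J. cmod (\<Sum>\<nu>\<leftarrow>vs. \<nu> ^ m) * r' ^ m / real m) \<le> L2" using L2 by simp
  qed
  then show ?thesis unfolding Q .
qed

text \<open>Standard deviations grow like a polynomial times \<open>sqrt \<kappa> ^ m\<close>,
  against weights \<open>r ^ m\<close>. The convergent infinite series dominates all finite sums,
  which gives constants free of p and n.\<close>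

lemma weighted_sum_le:
  fixes s x :: real and r :: real
  assumes \<kappa>: "0 < \<kappa>" and r: "0 \<le> r" "r \<le> r'" and s: "sqrt \<kappa> * r' < 1"
    and V: "\<And>m. m \<in> I \<Longrightarrow> V m \<le> (x * (real m + 1) ^ k)\<^sup>2 * \<kappa> ^ m" and x: "0 \<le> x" and I: "finite I"
    and w: "\<And>m. m \<in> I \<Longrightarrow> 0 \<le> w m \<and> w m \<le> r ^ m"
  shows "(\<Sum>m\<in>I. w m * sqrt (V m)) \<le> x * (\<Sum>m. (real m + 1) ^ k * (sqrt \<kappa> * r') ^ m)"
proof -
  have r': "0 \<le> r'" using r by simp
  have sm: "summable (\<lambda>m. (real m + 1) ^ k * (sqrt \<kappa> * r') ^ m)"
    by (rule summable_power_times_geometric) (use s r' \<kappa> in auto)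
  have "w m * sqrt (V m) \<le> x * ((real m + 1) ^ k * (sqrt \<kappa> * r') ^ m)" if m: "m \<in> I" for m
  proof -
    have "(sqrt \<kappa> ^ m)\<^sup>2 = \<kappa> ^ m"
      using \<kappa> by (simp flip: power_mult add: mult.commute[of m]) (simp add: power_mult)
    then have "V m \<le> (x * (real m + 1) ^ k * sqrt \<kappa> ^ m)\<^sup>2"
      using V[OF m] by (simp only: power_mult_distrib[of "x * (real m + 1) ^ k"])
    moreover have "0 \<le> x * (real m + 1) ^ k * sqrt \<kappa> ^ m" using x \<kappa> by simp
    ultimately have "sqrt (V m) \<le> x * (real m + 1) ^ k * sqrt \<kappa> ^ m"
      by (metis abs_of_nonneg real_sqrt_abs real_sqrt_le_mono)
    then have "w m * sqrt (V m) \<le> w m * (x * (real m + 1) ^ k * sqrt \<kappa> ^ m)"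
      using w[OF m] by (intro mult_left_mono) auto
    also have "\<dots> \<le> r' ^ m * (x * (real m + 1) ^ k * sqrt \<kappa> ^ m)"
    proof (rule mult_right_mono)
      have "r ^ m \<le> r' ^ m" using r by (intro power_mono) auto
      then show "w m \<le> r' ^ m" using w[OF m] by simp
    qed (use x \<kappa> in auto)
    finally show ?thesis by (simp add: power_mult_distrib mult_ac)
  qed
  then have "(\<Sum>m\<in>I. w m * sqrt (V m)) \<le> (\<Sum>m\<in>I. x * ((real m + 1) ^ k * (sqrt \<kappa> * r') ^ m))"
    by (rule sum_mono)
  also have "\<dots> = x * (\<Sum>m\<in>I. (real m + 1) ^ k * (sqrt \<kappa> * r') ^ m)"
    by (simp add: sum_distrib_left)
  also have "\<dots> \<le> x * (\<Sum>m. (real m + 1) ^ k * (sqrt \<kappa> * r') ^ m)"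
    using sm I x r' \<kappa> by (intro mult_left_mono sum_le_suminf) auto
  finally show ?thesis .
qed

context prob_space
begin

text \<open>\<open>Bad\<close> is a finite union of Markov events about sums of coefficients, so it
  is measurable although the conclusion concerns all z at once. The four terms stand for the size of
  the truncated determinant, its traces, the truncation error and the bilinear forms; only the last
  one involves n.\<close>

lemma noise_control:
  fixes \<xi> :: "nat \<times> nat \<Rightarrow> 'a \<Rightarrow> real" and w :: "nat \<Rightarrow> nat \<Rightarrow> real"
  assumes indep: "indep_vars (\<lambda>_. borel) \<xi> (alternating_edges p n)"
    and law: "\<And>e. e \<in> alternating_edges p n \<Longrightarrow> distr M borel (\<lambda>\<omega>. sqrt (real n) * \<xi> e \<omega>) = \<mu>"
    and x: "\<And>e. e \<in> alternating_edges p n \<Longrightarrow> integrable M (\<lambda>\<omega>. (\<xi> e \<omega>)\<^sup>2)"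
      "\<And>e. e \<in> alternating_edges p n \<Longrightarrow> expectation (\<lambda>\<omega>. \<xi> e \<omega>) = 0"
      "\<And>e. e \<in> alternating_edges p n \<Longrightarrow> expectation (\<lambda>\<omega>. (\<xi> e \<omega>)\<^sup>2) = 1 / real n"
    and \<mu>: "prob_space \<mu>" "sets \<mu> = sets borel" "integrable \<mu> (\<lambda>t. t\<^sup>2)" "(\<integral>t. t\<^sup>2 \<partial>\<mu>) = 1" "(\<integral>t. t \<partial>\<mu>) = 0"
    and n: "0 < n" "0 < \<kappa>" "real p \<le> \<kappa>\<^sup>2 * real n"
    and r: "0 < r" "r < r'" "sqrt \<kappa> * r' < 1" and b: "0 \<le> b"
    and L: "0 < L1" "0 < L2" "0 < \<eta>1" and small: "(exp L2 * L1 + 1) * (r / r') ^ Suc J \<le> 1 / 2"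
    and tr: "\<And>m. m \<in> {1..J} \<Longrightarrow> real ((p + n) ^ (m - 1) * ((m - 1) ^ m * (m - 1) ^ m)) * (2 * b / sqrt (real n)) ^ (2 * m) \<le> \<kappa> ^ m"
    and w: "\<And>s. s < q \<Longrightarrow> (\<Sum>i<p + n. (w s i)\<^sup>2) = 1"
  defines "K \<equiv> \<lambda>k. \<Sum>m. (real m + 1) ^ k * (sqrt \<kappa> * r') ^ m"
  defines "\<theta> \<equiv> (\<integral>t. (clip b t)\<^sup>2 \<partial>\<mu>)"
  shows "\<exists>Bad\<in>events. prob Bad \<le> K 0 / L1 + 3 * K 0 / L2 + sqrt (1 - \<theta>) * K 1 / (exp (- L2) / 4)
        + real (q * q) * (sqrt (2 / real n) * (1 + 1 / \<kappa>) * K 2 / \<eta>1) \<and>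
      (\<forall>\<omega>\<in>space M - Bad. (\<forall>z. cmod z \<le> r \<longrightarrow> exp (- L2) / 4 \<le> cmod (char_det (edge_mat p n (\<lambda>e. \<xi> e \<omega>)) z)) \<and>
        (\<forall>s<q. \<forall>t<q. (\<Sum>m\<le>p + n. r ^ m * \<bar>path_coeff p n (\<lambda>e. \<xi> e \<omega>) (w t) (w s) m
            - cycle_coeff p n (\<lambda>e. \<xi> e \<omega>) (w t) (w s) m\<bar>) \<le> \<eta>1))"
proof -
  let ?E = "alternating_edges p n"
  \<comment> \<open>Truncation acts on the entry rescaled by sqrt n, whose law is
    \<open>\<mu>\<close>, so that a level \<open>b\<close> independent of n makes sense.\<close>
  define g where "g t = truncate \<mu> b (sqrt (real n) * t) / sqrt (real n)" for t
  define \<tau> where "\<tau> = (\<integral>t. (truncate \<mu> b t)\<^sup>2 \<partial>\<mu>)"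
  note T = truncation[OF \<mu> b, folded \<theta>_def \<tau>_def]
  have sn: "0 < sqrt (real n)" "(sqrt (real n))\<^sup>2 = real n" using n(1) by auto
  have gm: "g \<in> borel_measurable borel" unfolding g_def by measurable
  have meas: "\<xi> e \<in> borel_measurable M" if "e \<in> ?E" for e
    using indep that by (auto simp: indep_vars_def)
  have tf: "expectation (\<lambda>\<omega>. F (sqrt (real n) * \<xi> e \<omega>)) = (\<integral>t. F t \<partial>\<mu>)"
    if "e \<in> ?E" "F \<in> borel_measurable borel" for e and F :: "real \<Rightarrow> real"
    unfolding law[OF that(1), symmetric] using meas[OF that(1)] that(2) by (subst integral_distr) auto
  have ti: "integrable M (\<lambda>\<omega>. F (sqrt (real n) * \<xi> e \<omega>))"
    if "e \<in> ?E" "F \<in> borel_measurable borel" "integrable \<mu> F" for e and F :: "real \<Rightarrow> real"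
    using that(3) unfolding law[OF that(1), symmetric] using meas[OF that(1)] that(2)
    by (subst (asm) integrable_distr_eq) auto
  have tm2: "(\<lambda>t. (truncate \<mu> b t)\<^sup>2) \<in> borel_measurable borel" "(\<lambda>t. t * truncate \<mu> b t) \<in> borel_measurable borel"
    by measurable
  have g0: "expectation (\<lambda>\<omega>. g (\<xi> e \<omega>)) = 0" if "e \<in> ?E" for e
    using tf[OF that truncate_measurable] T(2) unfolding g_def by simp
  have g2: "(g t)\<^sup>2 = (truncate \<mu> b (sqrt (real n) * t))\<^sup>2 / real n" for t
    unfolding g_def power_divide sn(2) ..
  have gi: "integrable M (\<lambda>\<omega>. (g (\<xi> e \<omega>))\<^sup>2)" if "e \<in> ?E" for e
    unfolding g2 using ti[OF that tm2(1) T(3)] by simp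
  have gv: "expectation (\<lambda>\<omega>. (g (\<xi> e \<omega>))\<^sup>2) = \<tau> / real n" if "e \<in> ?E" for e
    unfolding g2 using tf[OF that tm2(1)] by (simp add: \<tau>_def)
  have gx: "expectation (\<lambda>\<omega>. \<xi> e \<omega> * g (\<xi> e \<omega>)) = \<theta> / real n" if "e \<in> ?E" for e
  proof -
    have "t * g t = (sqrt (real n) * t) * truncate \<mu> b (sqrt (real n) * t) / real n" for t
      using sn by (simp add: g_def field_simps power2_eq_square)
    then show ?thesis using tf[OF that tm2(2)] T(7) by simp
  qed
  have gb: "\<bar>g t\<bar> \<le> 2 * b / sqrt (real n)" for t
    unfolding g_def using T(1) sn(1) by (simp add: abs_mult divide_right_mono)
  have \<tau>1: "0 \<le> \<tau>" "\<tau> / real n \<le> 1 / real n" "0 \<le> \<tau> / real n"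
    using T(4,5,6) by (auto simp: divide_right_mono)
  have gmeas: "(\<lambda>\<omega>. g (\<xi> e \<omega>)) \<in> borel_measurable M" if "e \<in> ?E" for e
    using meas[OF that] gm by measurable
  have gind: "indep_vars (\<lambda>_. borel) (\<lambda>e \<omega>. g (\<xi> e \<omega>)) ?E"
    using indep_vars_compose2[OF indep, of "\<lambda>_. g" "\<lambda>_. borel"] gm by simp
  have r0: "0 \<le> r" "0 \<le> r'" "0 < r'" using r by auto
  define B1 where "B1 = {\<omega> \<in> space M. L1 < (\<Sum>m\<in>{..p + n}. r' ^ m * \<bar>det_coeff p n (\<lambda>e. g (\<xi> e \<omega>)) m\<bar>)}"
  define B2 where "B2 = {\<omega> \<in> space M. L2 < (\<Sum>m\<in>{1..J}. r' ^ m / real m * \<bar>trace_coeff p n (\<lambda>e. g (\<xi> e \<omega>)) m\<bar>)}"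
  define B3 where "B3 = {\<omega> \<in> space M. exp (- L2) / 4 < (\<Sum>m\<in>{..p + n}. r ^ m *
      \<bar>det_coeff p n (\<lambda>e. \<xi> e \<omega>) m - det_coeff p n (\<lambda>e. g (\<xi> e \<omega>)) m\<bar>)}"
  define B4 where "B4 s t = {\<omega> \<in> space M. \<eta>1 < (\<Sum>m\<in>{..p + n}. r ^ m *
      \<bar>path_coeff p n (\<lambda>e. \<xi> e \<omega>) (w t) (w s) m - cycle_coeff p n (\<lambda>e. \<xi> e \<omega>) (w t) (w s) m\<bar>)}" for s t
  have "B1 \<in> events \<and> prob B1 \<le> K 0 / L1"
    unfolding B1_def
  proof (rule markov_weighted_sum[where V = "\<lambda>m. \<kappa> ^ m"])
    fix m
    note sm = det_coeff_second_moment[OF indep gm gi g0 gv \<tau>1(3,2) n]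
    show "(\<lambda>\<omega>. det_coeff p n (\<lambda>e. g (\<xi> e \<omega>)) m) \<in> borel_measurable M"
      by (rule coeff_measurable(1)) (rule gmeas)
    show "integrable M (\<lambda>\<omega>. (det_coeff p n (\<lambda>e. g (\<xi> e \<omega>)) m)\<^sup>2)"
      by (rule sm(1))
    show "expectation (\<lambda>\<omega>. (det_coeff p n (\<lambda>e. g (\<xi> e \<omega>)) m)\<^sup>2) \<le> \<kappa> ^ m"
      by (rule sm(2))
  next
    show "(\<Sum>m\<in>{..p + n}. r' ^ m * sqrt (\<kappa> ^ m)) \<le> K 0"
      using weighted_sum_le[OF n(2) r0(2) order_refl r(3), of "{..p + n}" "\<lambda>m. \<kappa> ^ m" 1 0 "\<lambda>m. r' ^ m"] r0
      unfolding K_def by simp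
  qed (use r0 L in auto)
  then have B1: "B1 \<in> events" "prob B1 \<le> K 0 / L1" by blast+
  have "B2 \<in> events \<and> prob B2 \<le> 3 * K 0 / L2"
    unfolding B2_def
  proof (rule markov_weighted_sum[where V = "\<lambda>m. (2 * real m + 5) * \<kappa> ^ m"])
    fix m assume m: "m \<in> {1..J}"
    then have m0: "0 < m" by simp
    note sm = trace_coeff_second_moment[OF gind g0 gv gb \<tau>1(3,2) _ n m0]
    show "(\<lambda>\<omega>. trace_coeff p n (\<lambda>e. g (\<xi> e \<omega>)) m) \<in> borel_measurable M"
      by (rule coeff_measurable(4)) (rule gmeas)
    show "integrable M (\<lambda>\<omega>. (trace_coeff p n (\<lambda>e. g (\<xi> e \<omega>)) m)\<^sup>2)"
      by (rule sm(1)) (use b in auto)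
    have "expectation (\<lambda>\<omega>. (trace_coeff p n (\<lambda>e. g (\<xi> e \<omega>)) m)\<^sup>2) \<le> (2 * real m + 4) * \<kappa> ^ m
      + real ((p + n) ^ (m - 1) * ((m - 1) ^ m * (m - 1) ^ m)) * (2 * b / sqrt (real n)) ^ (2 * m)"
      by (rule sm(2)) (use b in auto)
    also have "\<dots> \<le> (2 * real m + 4) * \<kappa> ^ m + \<kappa> ^ m" using tr[OF m] by simp
    finally show "expectation (\<lambda>\<omega>. (trace_coeff p n (\<lambda>e. g (\<xi> e \<omega>)) m)\<^sup>2) \<le> (2 * real m + 5) * \<kappa> ^ m"
      by (simp add: algebra_simps)
  next
    \<comment> \<open>The division by m in the exponent of the Weierstrass factor absorbs the
      growth: \<open>2 * m + 5 \<le> 9 * m\<^sup>2\<close> for m at least 1, so the traces cost 3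
      times the constant \<open>K 0\<close>, whatever \<open>J\<close> is.\<close>
    have "(\<Sum>m\<in>{1..J}. r' ^ m / real m * sqrt ((2 * real m + 5) * \<kappa> ^ m))
        \<le> (\<Sum>m\<in>{1..J}. r' ^ m * sqrt (9 * \<kappa> ^ m))"
    proof (rule sum_mono)
      fix m assume m: "m \<in> {1..J}"
      have m1: "1 \<le> real m" using m by simp
      have "1 * 1 \<le> real m * real m" using m1 by (intro mult_mono) auto
      moreover have "real m \<le> real m * real m" using m1 by simp
      ultimately have "2 * real m + 5 \<le> 9 * (real m)\<^sup>2" using m1 unfolding power2_eq_square by linarith
      then have "(2 * real m + 5) * \<kappa> ^ m \<le> (real m)\<^sup>2 * (9 * \<kappa> ^ m)"
        using n(2) mult_right_mono[of "2 * real m + 5" "9 * (real m)\<^sup>2" "\<kappa> ^ m"] by (simp add: mult_ac)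
      then have "sqrt ((2 * real m + 5) * \<kappa> ^ m) \<le> real m * sqrt (9 * \<kappa> ^ m)"
        by (metis abs_of_nat real_sqrt_abs real_sqrt_le_mono real_sqrt_mult)
      then have "r' ^ m / real m * sqrt ((2 * real m + 5) * \<kappa> ^ m) \<le> r' ^ m / real m * (real m * sqrt (9 * \<kappa> ^ m))"
        using r0 by (intro mult_left_mono) auto
      then show "r' ^ m / real m * sqrt ((2 * real m + 5) * \<kappa> ^ m) \<le> r' ^ m * sqrt (9 * \<kappa> ^ m)"
        using m1 by simp
    qed
    also have "\<dots> \<le> 3 * K 0"
      using weighted_sum_le[OF n(2) r0(2) order_refl r(3), of "{1..J}" "\<lambda>m. 9 * \<kappa> ^ m" 3 0 "\<lambda>m. r' ^ m"] r0
      unfolding K_def by simp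
    finally show "(\<Sum>m\<in>{1..J}. r' ^ m / real m * sqrt ((2 * real m + 5) * \<kappa> ^ m)) \<le> 3 * K 0" .
  qed (use r0 L in auto)
  then have B2: "B2 \<in> events" "prob B2 \<le> 3 * K 0 / L2" by blast+
  have "B3 \<in> events \<and> prob B3 \<le> sqrt (1 - \<theta>) * K 1 / (exp (- L2) / 4)"
    unfolding B3_def
  proof (rule markov_weighted_sum[where V = "\<lambda>m. real m * (1 - \<theta>) * \<kappa> ^ m"])
    fix m
    note sm = det_coeff_diff_second_moment[OF indep gm gi g0 gv x gx \<tau>1(1) T(5,6) n]
    show "integrable M (\<lambda>\<omega>. (det_coeff p n (\<lambda>e. \<xi> e \<omega>) m - det_coeff p n (\<lambda>e. g (\<xi> e \<omega>)) m)\<^sup>2)"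
      by (rule sm(1))
    show "expectation (\<lambda>\<omega>. (det_coeff p n (\<lambda>e. \<xi> e \<omega>) m - det_coeff p n (\<lambda>e. g (\<xi> e \<omega>)) m)\<^sup>2)
      \<le> real m * (1 - \<theta>) * \<kappa> ^ m"
      by (rule sm(2))
    show "(\<lambda>\<omega>. det_coeff p n (\<lambda>e. \<xi> e \<omega>) m - det_coeff p n (\<lambda>e. g (\<xi> e \<omega>)) m) \<in> borel_measurable M"
      by (intro borel_measurable_diff coeff_measurable(1) gmeas meas)
  next
    have V: "real m * (1 - \<theta>) * \<kappa> ^ m \<le> (sqrt (1 - \<theta>) * (real m + 1) ^ 1)\<^sup>2 * \<kappa> ^ m" for m
    proof (rule mult_right_mono)
      have "real m \<le> (real m + 1)\<^sup>2" by (simp add: power2_eq_square algebra_simps)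
      then have "real m * (1 - \<theta>) \<le> (real m + 1)\<^sup>2 * (1 - \<theta>)" using T(6) by (intro mult_right_mono) auto
      then show "real m * (1 - \<theta>) \<le> (sqrt (1 - \<theta>) * (real m + 1) ^ 1)\<^sup>2"
        using T(6) by (simp add: power_mult_distrib mult_ac)
    qed (use n in simp)
    show "(\<Sum>m\<in>{..p + n}. r ^ m * sqrt (real m * (1 - \<theta>) * \<kappa> ^ m)) \<le> sqrt (1 - \<theta>) * K 1"
      unfolding K_def by (rule weighted_sum_le[OF n(2) r0(1) less_imp_le[OF r(2)] r(3) V]) (use T(6) r0 in auto)
  qed (use r0 L in auto)
  then have B3: "B3 \<in> events" "prob B3 \<le> sqrt (1 - \<theta>) * K 1 / (exp (- L2) / 4)" by blast+
  have B4': "B4 s t \<in> events \<and> prob (B4 s t) \<le> sqrt (2 / real n) * (1 + 1 / \<kappa>) * K 2 / \<eta>1" if st: "s < q" "t < q" for s t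
    unfolding B4_def
  proof (rule markov_weighted_sum[where V = "\<lambda>m. 2 * (real m + 1) ^ 3 * \<kappa> ^ m * (1 + 1 / \<kappa>)\<^sup>2 / real n"])
    fix m
    note sm = bilinear_coeff_second_moment[OF indep x n, where a = "w t" and b = "w s" and m = m]
    show "integrable M (\<lambda>\<omega>. (path_coeff p n (\<lambda>e. \<xi> e \<omega>) (w t) (w s) m - cycle_coeff p n (\<lambda>e. \<xi> e \<omega>) (w t) (w s) m)\<^sup>2)"
      by (rule sm(1))
    show "expectation (\<lambda>\<omega>. (path_coeff p n (\<lambda>e. \<xi> e \<omega>) (w t) (w s) m - cycle_coeff p n (\<lambda>e. \<xi> e \<omega>) (w t) (w s) m)\<^sup>2)
      \<le> 2 * (real m + 1) ^ 3 * \<kappa> ^ m * (1 + 1 / \<kappa>)\<^sup>2 / real n"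
      using sm(2) w[OF st(1)] w[OF st(2)] by simp
    show "(\<lambda>\<omega>. path_coeff p n (\<lambda>e. \<xi> e \<omega>) (w t) (w s) m - cycle_coeff p n (\<lambda>e. \<xi> e \<omega>) (w t) (w s) m) \<in> borel_measurable M"
      by (intro borel_measurable_diff coeff_measurable(2,3) meas)
  next
    have V: "2 * (real m + 1) ^ 3 * \<kappa> ^ m * (1 + 1 / \<kappa>)\<^sup>2 / real n
        \<le> (sqrt (2 / real n) * (1 + 1 / \<kappa>) * (real m + 1) ^ 2)\<^sup>2 * \<kappa> ^ m" for m
    proof -
      have "(real m + 1) ^ 3 \<le> (real m + 1) ^ 4" by (rule power_increasing) auto
      then have "(2 / real n * (1 + 1 / \<kappa>)\<^sup>2 * \<kappa> ^ m) * (real m + 1) ^ 3 \<le> (2 / real n * (1 + 1 / \<kappa>)\<^sup>2 * \<kappa> ^ m) * (real m + 1) ^ 4"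
        using n by (intro mult_left_mono) auto
      moreover have "(sqrt (2 / real n) * (1 + 1 / \<kappa>) * (real m + 1) ^ 2)\<^sup>2 * \<kappa> ^ m
          = (2 / real n * (1 + 1 / \<kappa>)\<^sup>2 * \<kappa> ^ m) * (real m + 1) ^ 4"
        using n(1) by (simp add: power_mult_distrib mult_ac flip: power_mult)
      ultimately show ?thesis by (simp add: mult_ac)
    qed
    show "(\<Sum>m\<in>{..p + n}. r ^ m * sqrt (2 * (real m + 1) ^ 3 * \<kappa> ^ m * (1 + 1 / \<kappa>)\<^sup>2 / real n))
        \<le> sqrt (2 / real n) * (1 + 1 / \<kappa>) * K 2"
      unfolding K_def by (rule weighted_sum_le[OF n(2) r0(1) less_imp_le[OF r(2)] r(3) V]) (use n r0 in auto)
  qed (use r0 L in auto)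
  then have B4: "B4 s t \<in> events" "prob (B4 s t) \<le> sqrt (2 / real n) * (1 + 1 / \<kappa>) * K 2 / \<eta>1"
    if "s < q" "t < q" for s t using that by blast+
  define B4U where "B4U = (\<Union>(s, t)\<in>{..<q} \<times> {..<q}. B4 s t)"
  have B4U: "B4U \<in> events" "prob B4U \<le> real (q * q) * (sqrt (2 / real n) * (1 + 1 / \<kappa>) * K 2 / \<eta>1)"
  proof -
    show "B4U \<in> events" unfolding B4U_def using B4(1) by (intro sets.finite_UN) auto
    have "prob B4U \<le> (\<Sum>x\<in>{..<q} \<times> {..<q}. prob (case x of (s, t) \<Rightarrow> B4 s t))"
      unfolding B4U_def using B4(1) by (intro finite_measure_subadditive_finite) auto
    also have "\<dots> \<le> (\<Sum>x\<in>{..<q} \<times> {..<q}. sqrt (2 / real n) * (1 + 1 / \<kappa>) * K 2 / \<eta>1)"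
      using B4(2) by (intro sum_mono) auto
    finally show "prob B4U \<le> real (q * q) * (sqrt (2 / real n) * (1 + 1 / \<kappa>) * K 2 / \<eta>1)"
      by (simp add: card_cartesian_product)
  qed
  define Bad where "Bad = (B1 \<union> B2) \<union> (B3 \<union> B4U)"
  have ev: "Bad \<in> events" unfolding Bad_def using B1 B2 B3 B4U by auto
  have "prob Bad \<le> prob (B1 \<union> B2) + prob (B3 \<union> B4U)"
    unfolding Bad_def using B1 B2 B3 B4U by (intro measure_Un_le) auto
  also have "\<dots> \<le> (prob B1 + prob B2) + (prob B3 + prob B4U)"
    using B1 B2 B3 B4U by (intro add_mono measure_Un_le) auto
  finally have pr: "prob Bad \<le> K 0 / L1 + 3 * K 0 / L2 + sqrt (1 - \<theta>) * K 1 / (exp (- L2) / 4)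
        + real (q * q) * (sqrt (2 / real n) * (1 + 1 / \<kappa>) * K 2 / \<eta>1)"
    using B1(2) B2(2) B3(2) B4U(2) by linarith
  \<comment> \<open>The truncated determinant is at least \<open>exp (- L2) / 2\<close>, and undoing
    the truncation costs at most half of that.\<close>
  have good: "exp (- L2) / 4 \<le> cmod (char_det (edge_mat p n (\<lambda>e. \<xi> e \<omega>)) z)"
    if \<omega>: "\<omega> \<in> space M - Bad" and z: "cmod z \<le> r" for \<omega> z
  proof -
    have b1: "(\<Sum>m\<le>p + n. r' ^ m * \<bar>det_coeff p n (\<lambda>e. g (\<xi> e \<omega>)) m\<bar>) \<le> L1"
      and b2: "(\<Sum>m=1..J. r' ^ m / real m * \<bar>trace_coeff p n (\<lambda>e. g (\<xi> e \<omega>)) m\<bar>) \<le> L2"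
      and b3: "(\<Sum>m\<le>p + n. r ^ m * \<bar>det_coeff p n (\<lambda>e. \<xi> e \<omega>) m - det_coeff p n (\<lambda>e. g (\<xi> e \<omega>)) m\<bar>) \<le> exp (- L2) / 4"
      using \<omega> unfolding Bad_def B1_def B2_def B3_def by auto
    have "exp (- L2) / 2 \<le> cmod (char_det (edge_mat p n (\<lambda>e. g (\<xi> e \<omega>))) z)"
      by (rule char_det_lower_bound[OF r0(3) z r(2) b1 b2 small])
    moreover have "cmod (char_det (edge_mat p n (\<lambda>e. \<xi> e \<omega>)) z - char_det (edge_mat p n (\<lambda>e. g (\<xi> e \<omega>))) z) \<le> exp (- L2) / 4"
      by (rule char_det_diff_norm_le[OF z b3])
    ultimately show ?thesis
      using norm_triangle_ineq3[of "char_det (edge_mat p n (\<lambda>e. \<xi> e \<omega>)) z" "char_det (edge_mat p n (\<lambda>e. g (\<xi> e \<omega>))) z"]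
      by linarith
  qed
  show ?thesis
  proof (intro bexI[OF _ ev] conjI ballI allI impI pr)
    show "exp (- L2) / 4 \<le> cmod (char_det (edge_mat p n (\<lambda>e. \<xi> e \<omega>)) z)" if "\<omega> \<in> space M - Bad" "cmod z \<le> r" for \<omega> z
      by (rule good[OF that])
    fix \<omega> s t assume *: "\<omega> \<in> space M - Bad" "s < q" "t < q"
    then have "\<omega> \<notin> B4 s t" unfolding Bad_def B4U_def by auto
    then show "(\<Sum>m\<le>p + n. r ^ m * \<bar>path_coeff p n (\<lambda>e. \<xi> e \<omega>) (w t) (w s) m
            - cycle_coeff p n (\<lambda>e. \<xi> e \<omega>) (w t) (w s) m\<bar>) \<le> \<eta>1"
      using *(1) unfolding B4_def by auto
  qed
qed

end

subsection \<open>The spiked model\<close>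

definition edge_entry :: "nat \<Rightarrow> nat \<times> nat \<Rightarrow> nat \<times> nat \<times> nat" where
  "edge_entry p = (\<lambda>(i, j). if i < p then (1, i, j - p) else (2, j, i - p))"

lemma edge_entry_bij:
  "inj_on (edge_entry p) (alternating_edges p n)"
  "e \<in> alternating_edges p n \<Longrightarrow> edge_entry p e \<in> {1, 2} \<times> {..<p} \<times> {..<n}"
  by (auto simp: edge_entry_def alternating_edges_def inj_on_def split: if_splits)

lemma entry_fun_edge_entry:
  "entry_fun p (X 1 \<omega>) (X 2 \<omega>) e = (case edge_entry p e of (a, i, j) \<Rightarrow> X a \<omega> $$ (i, j))"
  by (cases e) (simp add: entry_fun_def edge_entry_def)

lemma iid_matrix_pair_entries:
  assumes iid: "iid_matrix_pair M p n \<mu> X"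
  defines "\<xi> \<equiv> \<lambda>e \<omega>. entry_fun p (X 1 \<omega>) (X 2 \<omega>) e"
  shows "prob_space.indep_vars M (\<lambda>_. borel) \<xi> (alternating_edges p n)"
    and "e \<in> alternating_edges p n \<Longrightarrow> distr M borel (\<lambda>\<omega>. sqrt (real n) * \<xi> e \<omega>) = \<mu>"
    and "e \<in> alternating_edges p n \<Longrightarrow> integrable M (\<lambda>\<omega>. (\<xi> e \<omega>)\<^sup>2)"
    and "e \<in> alternating_edges p n \<Longrightarrow> integral\<^sup>L M (\<xi> e) = 0"
    and "e \<in> alternating_edges p n \<Longrightarrow> integral\<^sup>L M (\<lambda>\<omega>. (\<xi> e \<omega>)\<^sup>2) = 1 / real n"
proof -
  interpret prob_space M using iid by (simp add: iid_matrix_pair_def)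
  have "indep_vars (\<lambda>_. borel) (\<lambda>(a, i, j) \<omega>. X a \<omega> $$ (i, j)) ({1, 2} \<times> {..<p} \<times> {..<n})"
    using iid unfolding iid_matrix_pair_def by blast
  then have "indep_vars (\<lambda>_. borel) (\<lambda>e. (\<lambda>(a, i, j) \<omega>. X a \<omega> $$ (i, j)) (edge_entry p e)) (alternating_edges p n)"
  proof (rule indep_vars_reindex)
    show "edge_entry p ` alternating_edges p n \<subseteq> {1, 2} \<times> {..<p} \<times> {..<n}"
      by (rule image_subsetI) (rule edge_entry_bij(2))
  qed (rule edge_entry_bij(1))
  moreover have "(\<lambda>e. (\<lambda>(a, i, j) \<omega>. X a \<omega> $$ (i, j)) (edge_entry p e)) = \<xi>"
    unfolding \<xi>_def entry_fun_edge_entry by (auto simp: fun_eq_iff split: prod.splits)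
  ultimately show "indep_vars (\<lambda>_. borel) \<xi> (alternating_edges p n)" by simp
  have ent: "\<forall>a\<in>{1, 2}. \<forall>i<p. \<forall>j<n.
        distr M borel (\<lambda>\<omega>. sqrt (real n) * X a \<omega> $$ (i, j)) = \<mu> \<and>
        integrable M (\<lambda>\<omega>. X a \<omega> $$ (i, j)) \<and>
        integrable M (\<lambda>\<omega>. (X a \<omega> $$ (i, j))\<^sup>2) \<and>
        expectation (\<lambda>\<omega>. X a \<omega> $$ (i, j)) = 0 \<and>
        expectation (\<lambda>\<omega>. (X a \<omega> $$ (i, j))\<^sup>2) = 1 / real n"
    using iid unfolding iid_matrix_pair_def by blast
  have all: "distr M borel (\<lambda>\<omega>. sqrt (real n) * \<xi> e \<omega>) = \<mu> \<and> integrable M (\<lambda>\<omega>. (\<xi> e \<omega>)\<^sup>2) \<and>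
      expectation (\<xi> e) = 0 \<and> expectation (\<lambda>\<omega>. (\<xi> e \<omega>)\<^sup>2) = 1 / real n" if e: "e \<in> alternating_edges p n" for e
  proof -
    obtain a i j where aij: "edge_entry p e = (a, i, j)" by (cases "edge_entry p e")
    then have "a \<in> {1, 2}" "i < p" "j < n" using edge_entry_bij(2)[OF e] by auto
    moreover have "\<xi> e = (\<lambda>\<omega>. X a \<omega> $$ (i, j))"
      unfolding \<xi>_def entry_fun_edge_entry aij by simp
    ultimately show ?thesis using ent by auto
  qed
  show "e \<in> alternating_edges p n \<Longrightarrow> distr M borel (\<lambda>\<omega>. sqrt (real n) * \<xi> e \<omega>) = \<mu>"
    "e \<in> alternating_edges p n \<Longrightarrow> integrable M (\<lambda>\<omega>. (\<xi> e \<omega>)\<^sup>2)"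
    "e \<in> alternating_edges p n \<Longrightarrow> expectation (\<xi> e) = 0"
    "e \<in> alternating_edges p n \<Longrightarrow> expectation (\<lambda>\<omega>. (\<xi> e \<omega>)\<^sup>2) = 1 / real n"
    using all by blast+
qed

text \<open>The moments of \<open>\<mu>\<close> are read off a single entry, whose existence needs p
  and n positive; the edge \<open>(0, p)\<close> is entry (0, 0) of the first matrix.\<close>

lemma iid_matrix_pair_law:
  assumes iid: "iid_matrix_pair M p n \<mu> X" and pn: "0 < p" "0 < n"
  shows "prob_space \<mu>" "sets \<mu> = sets borel" "integrable \<mu> (\<lambda>t. t\<^sup>2)" "(\<integral>t. t\<^sup>2 \<partial>\<mu>) = 1" "(\<integral>t. t \<partial>\<mu>) = 0"
proof -
  interpret prob_space M using iid by (simp add: iid_matrix_pair_def)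
  let ?\<xi> = "\<lambda>\<omega>. entry_fun p (X 1 \<omega>) (X 2 \<omega>) (0, p)"
  have e: "(0, p) \<in> alternating_edges p n" using pn by (simp add: alternating_edges_def)
  note en = iid_matrix_pair_entries[OF iid]
  have m: "?\<xi> \<in> borel_measurable M" using en(1) e by (auto simp: indep_vars_def)
  have \<mu>: "distr M borel (\<lambda>\<omega>. sqrt (real n) * ?\<xi> \<omega>) = \<mu>" by (rule en(2)[OF e])
  have m': "(\<lambda>\<omega>. sqrt (real n) * ?\<xi> \<omega>) \<in> borel_measurable M" using m by measurable
  show "prob_space \<mu>" unfolding \<mu>[symmetric] by (rule prob_space_distr[OF m'])
  show "sets \<mu> = sets borel" unfolding \<mu>[symmetric] by simp
  have sq: "(sqrt (real n) * t)\<^sup>2 = real n * t\<^sup>2" for t by (simp add: power_mult_distrib)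
  show "integrable \<mu> (\<lambda>t. t\<^sup>2)"
    unfolding \<mu>[symmetric] using en(3)[OF e] m' by (subst integrable_distr_eq) (auto simp: sq)
  show "(\<integral>t. t\<^sup>2 \<partial>\<mu>) = 1"
    unfolding \<mu>[symmetric] using en(5)[OF e] m' pn by (subst integral_distr) (auto simp: sq)
  show "(\<integral>t. t \<partial>\<mu>) = 0"
    unfolding \<mu>[symmetric] using en(4)[OF e] m' by (subst integral_distr) auto
qed

lemma eigenvalue_near_spike_of_noise:
  fixes u v :: "nat \<Rightarrow> real Matrix.vec" and d :: "nat \<Rightarrow> real"
  assumes X: "X1 \<in> carrier_mat p n" "X2 \<in> carrier_mat p n"
    and ortho: "orthonormal_family p k u" "orthonormal_family n k v"
    and d: "\<And>j. j \<in> {1..k} \<Longrightarrow> 0 \<le> d j \<and> d j < C" and C: "0 < C"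
    and mono: "\<And>j l. j \<in> {1..k} \<Longrightarrow> l \<in> {1..k} \<Longrightarrow> j \<le> l \<Longrightarrow> d l \<le> d j"
    and lam: "eigenvalue_listing p n (asymmetric_dilation p n (signal_matrix p n k d u v + X1) (signal_matrix p n k d u v + X2)) lam"
    and r: "0 < r" and i: "1 \<le> i" "i \<le> k" and \<epsilon>: "0 < \<epsilon>" "\<epsilon> \<le> 1" "1 / r + \<epsilon> < d i"
    and \<eta>: "0 < \<eta>0" "0 \<le> \<eta>1" "\<eta>1 \<le> \<eta>0"
      "fact (2 * k) * ((1 + 2 * r * C) ^ (2 * k) * (real (2 * k) * (r * C * (\<eta>1 / \<eta>0)))) < (\<epsilon> / (2 * (real k + 1)) / (C + 1)) ^ k"
    and Q: "\<And>z. cmod z \<le> r \<Longrightarrow> \<eta>0 \<le> cmod (char_det (edge_mat p n (entry_fun p X1 X2)) z)"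
    and small: "\<And>s t. s < 2 * k \<Longrightarrow> t < 2 * k \<Longrightarrow>
      (\<Sum>m\<le>p + n. r ^ m * \<bar>path_coeff p n (entry_fun p X1 X2) (spike_vec p k u v t) (spike_vec p k u v s) m
        - cycle_coeff p n (entry_fun p X1 X2) (spike_vec p k u v t) (spike_vec p k u v s) m\<bar>) \<le> \<eta>1"
  shows "cmod (lam i - complex_of_real (d i)) \<le> 3 * \<epsilon>"
proof -
  let ?y = "entry_fun p X1 X2"
  let ?Y = "asymmetric_dilation p n (signal_matrix p n k d u v + X1) (signal_matrix p n k d u v + X2)"
  define P where "P z = det (1\<^sub>m (p + n) - z \<cdot>\<^sub>m map_mat complex_of_real ?Y)" for z
  define Qp where "Qp = (\<Sum>m\<le>p + n. Polynomial.monom ((- 1) ^ m * complex_of_real (det_coeff p n ?y m)) m)"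
  have Qp: "poly Qp z = char_det (edge_mat p n ?y) z" for z
    unfolding Qp_def char_det_edge_mat
    by (simp add: poly_sum poly_monom power_minus[of z] mult_ac)
  have "signal_matrix p n k d u v \<in> carrier_mat p n" by (simp add: signal_matrix_def)
  then have Y: "?Y \<in> carrier_mat (p + n) (p + n)"
    using X unfolding asymmetric_dilation_def by (intro four_block_carrier_mat) auto
  have PP: "poly (pair_poly (min n p) lam) z = P z" for z
    unfolding P_def char_det_eigenvalue_listing[OF Y lam] poly_pair_poly ..
  \<comment> \<open>\<open>det_dilation_factor\<close> yields a value for each z separately; the
    quotient puts these values together into one function of z.\<close>
  define D' where "D' z = P z / char_det (edge_mat p n ?y) z" for z
  have ex: "P z = poly Qp z * D' z \<and> cmod (D' z - poly (pair_poly k (\<lambda>j. complex_of_real (d j))) z)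
      \<le> fact (2 * k) * ((1 + 2 * r * C) ^ (2 * k) * (real (2 * k) * (r * C * (\<eta>1 / \<eta>0))))"
    if z: "cmod z \<le> r" for z
  proof -
    have nz: "char_det (edge_mat p n ?y) z \<noteq> 0" using Q[OF z] \<eta>(1) by auto
    have sm: "(\<Sum>m\<le>p + n. cmod z ^ m * \<bar>path_coeff p n ?y (spike_vec p k u v t) (spike_vec p k u v s) m
        - cycle_coeff p n ?y (spike_vec p k u v t) (spike_vec p k u v s) m\<bar>) \<le> \<eta>1" if "s < 2 * k" "t < 2 * k" for s t
      by (rule order_trans[OF sum_mono small[OF that]]) (intro mult_right_mono power_mono z; simp)
    obtain D where D: "P z = char_det (edge_mat p n ?y) z * D"
      "cmod (D - poly (pair_poly k (\<lambda>j. complex_of_real (d j))) z)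
        \<le> fact (2 * k) * ((1 + 2 * r * C) ^ (2 * k) * (real (2 * k) * (r * C * (\<eta>1 / \<eta>0))))"
      using det_dilation_factor[where d = d, OF X ortho d C z \<eta>(1-3) Q[OF z] sm] unfolding P_def by blast
    have "D' z = D" using nz D(1) by (simp add: D'_def)
    then show ?thesis using D Qp by simp
  qed
  note lam' = lam[unfolded eigenvalue_listing_def, THEN conjunct2]
  have listing: "\<forall>i\<in>{1..min n p}. - pi / 2 < Arg (lam i) \<and> Arg (lam i) \<le> pi / 2"
    "\<forall>i\<in>{1..min n p}. \<forall>j\<in>{1..min n p}. i \<le> j \<longrightarrow> cmod (lam j) \<le> cmod (lam i)"
    by (rule lam'[THEN conjunct1] lam'[THEN conjunct2, THEN conjunct1])+
  have "i \<le> min n p \<and> cmod (lam i - complex_of_real (d i)) \<le> 3 * \<epsilon>"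
  proof (rule eigenvalue_near_spike[where d = d, OF r i \<epsilon> d mono _ _ _ _ _ \<eta>(4)])
    show "- pi / 2 < Arg (lam j) \<and> Arg (lam j) \<le> pi / 2" if "j \<in> {1..min n p}" for j
      using listing(1) that by blast
    show "cmod (lam l) \<le> cmod (lam j)" if "j \<in> {1..min n p}" "l \<in> {1..min n p}" "j \<le> l" for j l
      using listing(2) that by blast
    show "poly Qp z \<noteq> 0" if "cmod z \<le> r" for z
      using Q[OF that] \<eta>(1) unfolding Qp by auto
    show "poly (pair_poly (min n p) lam) z = poly Qp z * D' z" if "cmod z \<le> r" for z
      using ex[OF that] PP by simp
    show "cmod (D' z - poly (pair_poly k (\<lambda>j. complex_of_real (d j))) z)
      \<le> fact (2 * k) * ((1 + 2 * r * C) ^ (2 * k) * (real (2 * k) * (r * C * (\<eta>1 / \<eta>0))))" if "cmod z \<le> r" for z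
      using ex[OF that] by simp
  qed auto
  then show ?thesis by simp
qed

text \<open>There are O(n^(m-1)) pairs with few vertices, and a product of 2m truncated entries is
  O(n^(-m)); for fixed m and b the total is O(1 / n).\<close>

lemma eventually_trace_remainder_small:
  fixes p :: "nat \<Rightarrow> nat"
  assumes \<kappa>: "0 < \<kappa>" and p: "\<forall>\<^sub>F n in sequentially. real (p n) \<le> \<kappa>\<^sup>2 * real n" and m: "0 < m" and b: "0 \<le> b"
  shows "\<forall>\<^sub>F n in sequentially. real ((p n + n) ^ (m - 1) * ((m - 1) ^ m * (m - 1) ^ m)) *
    (2 * b / sqrt (real n)) ^ (2 * m) \<le> \<kappa> ^ m"
proof -
  define K where "K = (\<kappa>\<^sup>2 + 1) ^ (m - 1) * real ((m - 1) ^ m * (m - 1) ^ m) * (4 * b\<^sup>2) ^ m"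
  have "(\<lambda>n. K / real n) \<longlonglongrightarrow> 0" by (rule lim_const_over_n)
  then have "\<forall>\<^sub>F n in sequentially. K / real n < \<kappa> ^ m"
    by (rule order_tendstoD(2)) (use \<kappa> in simp)
  then show ?thesis using p eventually_gt_at_top[of 0]
  proof eventually_elim
    case (elim n)
    have n: "0 < real n" using elim(3) by simp
    have pw: "(2 * b / sqrt (real n)) ^ (2 * m) = (4 * b\<^sup>2) ^ m / real n ^ m"
      using n by (simp add: power_mult power_divide power_mult_distrib)
    have "real (p n + n) \<le> (\<kappa>\<^sup>2 + 1) * real n" using elim(2) by (simp add: algebra_simps)
    then have "real (p n + n) ^ (m - 1) \<le> ((\<kappa>\<^sup>2 + 1) * real n) ^ (m - 1)" by (intro power_mono) auto
    then have "real ((p n + n) ^ (m - 1) * ((m - 1) ^ m * (m - 1) ^ m)) * ((4 * b\<^sup>2) ^ m / real n ^ m)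
        \<le> ((\<kappa>\<^sup>2 + 1) * real n) ^ (m - 1) * real ((m - 1) ^ m * (m - 1) ^ m) * ((4 * b\<^sup>2) ^ m / real n ^ m)"
      unfolding of_nat_mult of_nat_power by (intro mult_right_mono) auto
    also have "\<dots> = K * (real n ^ (m - 1) / real n ^ m)"
      unfolding K_def by (simp add: power_mult_distrib)
    also have "real n ^ (m - 1) / real n ^ m = 1 / real n"
      using n m by (cases m) auto
    also have "K * (1 / real n) = K / real n" by simp
    finally show ?case using elim(1) unfolding pw by simp
  qed
qed

theorem theorem1p11:
  fixes p :: "nat \<Rightarrow> nat" and c C \<delta> :: real and k kt :: nat
    and M :: "nat \<Rightarrow> 'w measure" and \<mu> :: "real measure"
    and X :: "nat \<Rightarrow> nat \<Rightarrow> 'w \<Rightarrow> real mat"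
    and d :: "nat \<Rightarrow> nat \<Rightarrow> real"
    and u v :: "nat \<Rightarrow> nat \<Rightarrow> real Matrix.vec"
    and lam :: "nat \<Rightarrow> 'w \<Rightarrow> nat \<Rightarrow> complex"
  defines "S \<equiv> \<lambda>n. signal_matrix (p n) n k (d n) (u n) (v n)"
  assumes "0 < c" and "(\<lambda>n. real (p n) / real n) \<longlonglongrightarrow> c"
    and "\<And>n. iid_matrix_pair (M n) (p n) n \<mu> (X n)"
    and "0 < C"
    and "\<forall>\<^sub>F n in sequentially.
           orthonormal_family (p n) k (u n) \<and> orthonormal_family n k (v n) \<and>
           (\<forall>i\<in>{1..k}. 0 \<le> d n i \<and> d n i < C) \<and>
           (\<forall>i\<in>{1..k}. \<forall>j\<in>{1..k}. i \<le> j \<longrightarrow> d n j \<le> d n i)"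
    and "1 \<le> kt" and "kt \<le> k" and "0 < \<delta>"
    and "\<forall>\<^sub>F n in sequentially. sqrt (sqrt (real (p n) / real n) + \<delta>) < d n kt"
    and "\<And>n i. i \<in> {1..min n (p n)} \<Longrightarrow> (\<lambda>\<omega>. lam n \<omega> i) \<in> borel_measurable (M n)"
    and "\<And>n \<omega>. \<omega> \<in> space (M n) \<Longrightarrow>
           eigenvalue_listing (p n) n
             (asymmetric_dilation (p n) n (S n + X n 1 \<omega>) (S n + X n 2 \<omega>)) (lam n \<omega>)"
  shows "\<forall>i\<in>{1..kt}. \<forall>\<epsilon>>0.
           (\<lambda>n. measure (M n) {\<omega> \<in> space (M n). cmod (lam n \<omega> i - complex_of_real (d n i)) > \<epsilon>})
             \<longlonglongrightarrow> 0"
proof (intro ballI allI impI)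
  fix i and \<epsilon>0 :: real assume i: "i \<in> {1..kt}" and \<epsilon>0: "0 < \<epsilon>0"
  note ratio = assms(3) and iid = assms(4) and C = assms(5) and sig = assms(6) and thr = assms(10) and listing = assms(12)
  have \<delta>: "0 < \<delta>" and c: "0 < c" and kt: "1 \<le> kt" "kt \<le> k" using assms by auto
  \<comment> \<open>The margin \<open>\<delta>\<close> is cut at 1/4 < 1/3 < 1/2 < 3/4. The first
    cut puts \<open>\<kappa>\<close> above sqrt c, so that p is eventually at most
    \<open>\<kappa>\<^sup>2 * n\<close>; the second gives \<open>sqrt \<kappa> * r' < 1\<close>, the
    third \<open>r < r'\<close>. The last puts \<open>D0\<close> above 1 / r and still below
    \<open>d n kt\<close> eventually, when sqrt (p / n) is within \<open>\<delta> / 4\<close> of its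
    limit.\<close>
  define \<kappa> where "\<kappa> = sqrt c + \<delta> / 4"
  define r where "r = 1 / sqrt (sqrt c + \<delta> / 2)"
  define r' where "r' = 1 / sqrt (sqrt c + \<delta> / 3)"
  define D0 where "D0 = sqrt (sqrt c + 3 * \<delta> / 4)"
  have sc: "0 < sqrt c" using c by simp
  have \<kappa>: "0 < \<kappa>" using sc \<delta> by (simp add: \<kappa>_def add_pos_pos)
  have r: "0 < r" "r < r'" "0 < r'"
    using sc \<delta> by (auto simp: r_def r'_def add_pos_pos intro!: divide_strict_left_mono mult_pos_pos)
  have kr: "sqrt \<kappa> * r' < 1"
    using sc \<delta> \<kappa> by (simp add: r'_def \<kappa>_def add_pos_pos)
  have D0: "1 / r < D0"
    using sc \<delta> by (simp add: r_def D0_def)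
  \<comment> \<open>The 3 matches the \<open>3 * \<epsilon>\<close> of
    \<open>eigenvalue_near_spike\<close>; the last term keeps \<open>1 / r + \<epsilon>\<close>
    below all the spikes considered.\<close>
  define \<epsilon> where "\<epsilon> = min (\<epsilon>0 / 3) (min 1 (D0 - 1 / r))"
  have \<epsilon>: "0 < \<epsilon>" "\<epsilon> \<le> 1" "3 * \<epsilon> \<le> \<epsilon>0" "1 / r + \<epsilon> \<le> D0"
    using \<epsilon>0 D0 by (auto simp: \<epsilon>_def min_def)
  define \<eta>s where "\<eta>s = (\<epsilon> / (2 * (real k + 1)) / (C + 1)) ^ k"
  have \<eta>s: "0 < \<eta>s" using \<epsilon>(1) C by (simp add: \<eta>s_def add_pos_pos)
  define K3 where "K3 = fact (2 * k) * ((1 + 2 * r * C) ^ (2 * k) * (real (2 * k) * (r * C)))"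
  have K3: "0 \<le> K3" using r C by (simp add: K3_def)
  define K where "K k = (\<Sum>m. (real m + 1) ^ k * (sqrt \<kappa> * r') ^ m)" for k
  have K0: "0 \<le> K k" for k
    unfolding K_def using \<kappa> r kr
    by (intro suminf_nonneg summable_power_times_geometric) auto
  have ev_p: "\<forall>\<^sub>F n in sequentially. real (p n) \<le> \<kappa>\<^sup>2 * real n"
  proof -
    have "c < \<kappa>\<^sup>2"
    proof -
      have "(sqrt c)\<^sup>2 < \<kappa>\<^sup>2" using sc \<delta> by (intro power_strict_mono) (auto simp: \<kappa>_def)
      then show ?thesis using c by simp
    qed
    then have "\<forall>\<^sub>F n in sequentially. real (p n) / real n < \<kappa>\<^sup>2" by (rule order_tendstoD(2)[OF ratio])
    then show ?thesis using eventually_gt_at_top[of 0]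
      by eventually_elim (simp add: divide_less_eq)
  qed
  have ev_p0: "\<forall>\<^sub>F n in sequentially. 0 < p n"
  proof -
    have "\<forall>\<^sub>F n in sequentially. 0 < real (p n) / real n" by (rule order_tendstoD(1)[OF ratio c])
    then show ?thesis by eventually_elim (simp add: zero_less_divide_iff)
  qed
  have ev_d: "\<forall>\<^sub>F n in sequentially. D0 < d n kt"
  proof -
    have "(\<lambda>n. sqrt (real (p n) / real n)) \<longlonglongrightarrow> sqrt c" by (intro tendsto_intros ratio)
    then have "\<forall>\<^sub>F n in sequentially. sqrt c - \<delta> / 4 < sqrt (real (p n) / real n)"
      by (rule order_tendstoD(1)) (use \<delta> in simp)
    then show ?thesis using thr
    proof eventually_elim
      case (elim n)
      have "D0 \<le> sqrt (sqrt (real (p n) / real n) + \<delta>)"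
        unfolding D0_def using elim(1) by (intro real_sqrt_le_mono) simp
      then show ?case using elim(2) by simp
    qed
  qed
  \<comment> \<open>One index with nonempty matrices gives the moments of the law common to all
    n.\<close>
  obtain n0 where n0: "0 < n0" "0 < p n0"
    using eventually_conj[OF eventually_gt_at_top[of 0] ev_p0]
    by (auto dest!: eventually_happens)
  note \<mu> = iid_matrix_pair_law[OF iid[of n0] n0(2,1)]
  let ?prob = "\<lambda>n. measure (M n) {\<omega> \<in> space (M n). cmod (lam n \<omega> i - complex_of_real (d n i)) > \<epsilon>0}"
  have main: "\<forall>\<^sub>F n in sequentially. ?prob n < e" if e: "0 < e" for e
  proof -
    \<comment> \<open>Each of the four terms in \<open>noise_control\<close> is given at most e / 5,
      which leaves the total strictly below e. The summand 1 keeps \<open>L1\<close> and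
      \<open>L2\<close> positive.\<close>
    define L1 where "L1 = 5 * (K 0 + 1) / e"
    define L2 where "L2 = 15 * (K 0 + 1) / e"
    have L: "0 < L1" "0 < L2" using K0[of 0] e by (auto simp: L1_def L2_def)
    have L1e: "K 0 / L1 \<le> e / 5" and L2e: "3 * K 0 / L2 \<le> e / 5"
      using K0[of 0] e by (auto simp: L1_def L2_def field_simps)
    define \<eta>0 where "\<eta>0 = exp (- L2) / 4"
    have \<eta>0: "0 < \<eta>0" by (simp add: \<eta>0_def)
    \<comment> \<open>The second term makes \<open>K3 * (\<eta>1 / \<eta>0)\<close>, the error in
      the small determinant, less than \<open>\<eta>s\<close>, the lower bound that Rouche's theorem
      compares it with.\<close>
    define \<eta>1 where "\<eta>1 = min \<eta>0 (\<eta>s * \<eta>0 / (2 * (K3 + 1)))"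
    have \<eta>1: "0 < \<eta>1" "\<eta>1 \<le> \<eta>0" using \<eta>0 \<eta>s K3 by (auto simp: \<eta>1_def)
    have \<eta>K: "K3 * (\<eta>1 / \<eta>0) < \<eta>s"
    proof -
      have "K3 * (\<eta>1 / \<eta>0) \<le> K3 * (\<eta>s * \<eta>0 / (2 * (K3 + 1)) / \<eta>0)"
        using K3 \<eta>0 by (intro mult_left_mono divide_right_mono) (auto simp: \<eta>1_def)
      also have "\<dots> = \<eta>s * (K3 / (2 * (K3 + 1)))" using \<eta>0 by simp
      also have "\<dots> < \<eta>s * 1" using \<eta>s K3 by (intro mult_strict_left_mono) (auto simp: divide_less_eq)
      finally show ?thesis by simp
    qed
    obtain J where J: "(exp L2 * L1 + 1) * (r / r') ^ Suc J \<le> 1 / 2"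
    proof -
      have "(\<lambda>J. (exp L2 * L1 + 1) * (r / r') ^ Suc J) \<longlonglongrightarrow> (exp L2 * L1 + 1) * 0"
        using r by (intro tendsto_mult tendsto_const LIMSEQ_Suc LIMSEQ_realpow_zero) auto
      then have "\<forall>\<^sub>F J in sequentially. (exp L2 * L1 + 1) * (r / r') ^ Suc J < 1 / 2"
        by (intro order_tendstoD(2)) auto
      then obtain J where "(exp L2 * L1 + 1) * (r / r') ^ Suc J < 1 / 2"
        by (auto dest!: eventually_happens)
      then show ?thesis by (intro that[of J]) simp
    qed
    obtain b where b: "0 \<le> b" "sqrt (1 - (\<integral>t. (clip b t)\<^sup>2 \<partial>\<mu>)) * K 1 / \<eta>0 \<le> e / 5"
    proof -
      have "(\<lambda>N. \<integral>t. (clip (real N) t)\<^sup>2 \<partial>\<mu>) \<longlonglongrightarrow> 1"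
        using clip_second_moment_tendsto[OF \<mu>(2,3)] \<mu>(4) by simp
      then have "(\<lambda>N. sqrt (1 - (\<integral>t. (clip (real N) t)\<^sup>2 \<partial>\<mu>)) * K 1 / \<eta>0) \<longlonglongrightarrow> sqrt (1 - 1) * K 1 / \<eta>0"
        using \<eta>0 by (intro tendsto_intros) auto
      then have "\<forall>\<^sub>F N in sequentially. sqrt (1 - (\<integral>t. (clip (real N) t)\<^sup>2 \<partial>\<mu>)) * K 1 / \<eta>0 < e / 5"
        by (rule order_tendstoD(2)) (use e in simp)
      then obtain N where "sqrt (1 - (\<integral>t. (clip (real N) t)\<^sup>2 \<partial>\<mu>)) * K 1 / \<eta>0 < e / 5"
        by (auto dest!: eventually_happens)
      then show ?thesis by (intro that[of "real N"]) auto
    qed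
    have ev_tr: "\<forall>\<^sub>F n in sequentially. \<forall>m\<in>{1..J}. real ((p n + n) ^ (m - 1) * ((m - 1) ^ m * (m - 1) ^ m)) *
        (2 * b / sqrt (real n)) ^ (2 * m) \<le> \<kappa> ^ m"
      by (rule eventually_ball_finite) (use eventually_trace_remainder_small[OF \<kappa> ev_p _ b(1)] in auto)
    have ev_B: "\<forall>\<^sub>F n in sequentially. real (2 * k * (2 * k)) * (sqrt (2 / real n) * (1 + 1 / \<kappa>) * K 2 / \<eta>1) < e / 5"
    proof -
      have "(\<lambda>n. 2 / real n) \<longlonglongrightarrow> 0" by (rule lim_const_over_n)
      then have "(\<lambda>n. real (2 * k * (2 * k)) * (sqrt (2 / real n) * (1 + 1 / \<kappa>) * K 2 / \<eta>1))
          \<longlonglongrightarrow> real (2 * k * (2 * k)) * (sqrt 0 * (1 + 1 / \<kappa>) * K 2 / \<eta>1)"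
        using \<eta>1 by (intro tendsto_intros) auto
      then show ?thesis by (rule order_tendstoD(2)) (use e in simp)
    qed
    show ?thesis
      using ev_p eventually_gt_at_top[of 0] ev_d ev_tr ev_B sig
    proof eventually_elim
      case (elim n)
      have prob: "prob_space (M n)" using iid[of n] by (simp add: iid_matrix_pair_def)
      interpret prob_space "M n" by (rule prob)
      note en = iid_matrix_pair_entries[OF iid[of n]]
      define w where "w = spike_vec (p n) k (u n) (v n)"
      have ortho: "orthonormal_family (p n) k (u n)" "orthonormal_family n k (v n)"
        and dn: "\<And>j. j \<in> {1..k} \<Longrightarrow> 0 \<le> d n j \<and> d n j < C"
        and dmono: "\<And>j l. j \<in> {1..k} \<Longrightarrow> l \<in> {1..k} \<Longrightarrow> j \<le> l \<Longrightarrow> d n l \<le> d n j"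
        using elim(6) by blast+
      have w1: "(\<Sum>i<p n + n. (w s i)\<^sup>2) = 1" if "s < 2 * k" for s
        using spike_vec_orthonormal[OF ortho that that] by (simp add: w_def power2_eq_square)
      have tr: "real ((p n + n) ^ (m - 1) * ((m - 1) ^ m * (m - 1) ^ m)) *
        (2 * b / sqrt (real n)) ^ (2 * m) \<le> \<kappa> ^ m" if "m \<in> {1..J}" for m
        using elim(4) that by blast
      let ?y = "\<lambda>\<omega>. entry_fun (p n) (X n 1 \<omega>) (X n 2 \<omega>)"
      obtain Bad where Bad: "Bad \<in> events" and
        B: "prob Bad \<le> K 0 / L1 + 3 * K 0 / L2 + sqrt (1 - (\<integral>t. (clip b t)\<^sup>2 \<partial>\<mu>)) * K 1 / \<eta>0
          + real (2 * k * (2 * k)) * (sqrt (2 / real n) * (1 + 1 / \<kappa>) * K 2 / \<eta>1) \<and>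
        (\<forall>\<omega>\<in>space (M n) - Bad. (\<forall>z. cmod z \<le> r \<longrightarrow> \<eta>0 \<le> cmod (char_det (edge_mat (p n) n (?y \<omega>)) z)) \<and>
          (\<forall>s<2 * k. \<forall>t<2 * k. (\<Sum>m\<le>p n + n. r ^ m * \<bar>path_coeff (p n) n (?y \<omega>) (w t) (w s) m
            - cycle_coeff (p n) n (?y \<omega>) (w t) (w s) m\<bar>) \<le> \<eta>1))"
        using noise_control[where \<xi> = "\<lambda>e \<omega>. ?y \<omega> e",
            OF en \<mu> elim(2) \<kappa> elim(1) r(1,2) kr b(1) L \<eta>1(1) J tr w1] unfolding K_def \<eta>0_def
        by (rule bexE)
      note good = bspec[OF conjunct2[OF B]]
      have "{\<omega> \<in> space (M n). cmod (lam n \<omega> i - complex_of_real (d n i)) > \<epsilon>0} \<subseteq> Bad"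
      proof (rule subsetI, rule ccontr)
        fix \<omega> assume \<omega>: "\<omega> \<in> {\<omega> \<in> space (M n). cmod (lam n \<omega> i - complex_of_real (d n i)) > \<epsilon>0}" and "\<omega> \<notin> Bad"
        then have \<omega>B: "\<omega> \<in> space (M n) - Bad" by auto
        have X: "X n 1 \<omega> \<in> carrier_mat (p n) n" "X n 2 \<omega> \<in> carrier_mat (p n) n"
          using iid[of n] \<omega>B by (auto simp: iid_matrix_pair_def)
        have "d n kt \<le> d n i" using i kt by (intro dmono) auto
        then have di: "1 / r + \<epsilon> < d n i" using elim(3) \<epsilon>(4) by simp
        have "cmod (lam n \<omega> i - complex_of_real (d n i)) \<le> 3 * \<epsilon>"
        proof (rule eigenvalue_near_spike_of_noise[where d = "d n", OF X ortho dn C dmono _ r(1) _ _ \<epsilon>(1,2) di \<eta>0 less_imp_le[OF \<eta>1(1)] \<eta>1(2)])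
          show "eigenvalue_listing (p n) n (asymmetric_dilation (p n) n (signal_matrix (p n) n k (d n) (u n) (v n) + X n 1 \<omega>)
              (signal_matrix (p n) n k (d n) (u n) (v n) + X n 2 \<omega>)) (lam n \<omega>)"
            using listing[of \<omega> n] \<omega>B unfolding S_def by simp
          show "1 \<le> i" "i \<le> k" using i kt by auto
          show "fact (2 * k) * ((1 + 2 * r * C) ^ (2 * k) * (real (2 * k) * (r * C * (\<eta>1 / \<eta>0))))
              < (\<epsilon> / (2 * (real k + 1)) / (C + 1)) ^ k"
            using \<eta>K unfolding K3_def \<eta>s_def by (simp only: mult.assoc)
          show "\<eta>0 \<le> cmod (char_det (edge_mat (p n) n (entry_fun (p n) (X n 1 \<omega>) (X n 2 \<omega>))) z)" if "cmod z \<le> r" for z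
            by (rule conjunct1[OF good[OF \<omega>B], rule_format, OF that])
          show "(\<Sum>m\<le>p n + n. r ^ m * \<bar>path_coeff (p n) n (entry_fun (p n) (X n 1 \<omega>) (X n 2 \<omega>))
                (spike_vec (p n) k (u n) (v n) t) (spike_vec (p n) k (u n) (v n) s) m
              - cycle_coeff (p n) n (entry_fun (p n) (X n 1 \<omega>) (X n 2 \<omega>))
                (spike_vec (p n) k (u n) (v n) t) (spike_vec (p n) k (u n) (v n) s) m\<bar>) \<le> \<eta>1"
            if "s < 2 * k" "t < 2 * k" for s t
            by (rule conjunct2[OF good[OF \<omega>B], rule_format, OF that, unfolded w_def])
        qed
        then show False using \<omega> \<epsilon>(3) by auto
      qed
      then have "?prob n \<le> prob Bad" by (rule finite_measure_mono[OF _ Bad])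
      also have "\<dots> < e" using conjunct1[OF B] L1e L2e b(2) elim(5) e by linarith
      finally show ?case .
    qed
  qed
  show "?prob \<longlonglongrightarrow> 0"
  proof (rule order_tendstoI)
    show "\<forall>\<^sub>F n in sequentially. a < ?prob n" if "a < 0" for a
      using that by (intro always_eventually allI) (auto intro: less_le_trans[OF _ measure_nonneg])
  qed (rule main)
qed

end
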